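(* Let $m>1$ and $n>2m$ be integers and let $x_0\in\mathbb B^n$. There exist nonnegative functions $\bar\alpha\in L^{n/(2m)}(\mathbb B^n)$ and $\alpha\in L^{n/(2m)}(\mathbb R^n)$ with $\alpha\not\equiv0$ and \[ \|\alpha\|_{L^{n/(2m)}(\mathbb R^n)}<S_{m,n}\bigl(2^{2m/n}-1\bigr) \] such that, for every $\lambda>0$, the operator \[ (-\Delta)^m+\bar\alpha(x)+\lambda^{2m}\alpha\bigl(\lambda(x-x_0)\bigr)\quad\text{on }W^{m,2}_0(\mathbb B^n) \] has an inverse that fails to be positivity preserving.
   Context: $\mathbb B^n$ is the open unit ball of $\mathbb R^n$. $S_{m,n}$ is the sharp Euclidean Sobolev constant, i.e. the largest constant with $S_{m,n}\|v\|_{L^q(\mathbb R^n)}^2\le\int_{\mathbb R^n}|\nabla^mv|^2dx$ for $v\in C_c^\infty(\mathbb R^n)$, where $q=\frac{2n}{n-2m}$ and $\int|\nabla^mv|^2dx$ means $\int|\Delta^{m/2}v|^2dx$ for $m$ even and $\int|\nabla\Delta^{(m-1)/2}v|^2dx$ for $m$ odd. For a nonnegative $A\in L^{n/(2m)}(\mathbb B^n)$ the operator $(-\Delta)^m+A:W_0^{m,2}(\mathbb B^n)\to W^{-m,2}(\mathbb B^n)$ is the isomorphism induced by the quadratic form $\int_{\mathbb B^n}(|\nabla^mv|^2+Av^2)dx$. Its inverse is positivity preserving if $f\ge0$ (i.e. $\langle f,v\rangle\ge0$ for every nonnegative $v\in W_0^{m,2}(\mathbb B^n)$) implies that the solution $u\in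 W_0^{m,2}(\mathbb B^n)$ of $(-\Delta)^mu+Au=f$ satisfies $u\ge0$ a.e. *)

theory Defs
  imports "HOL-Analysis.Analysis"
begin

definition Lp_space :: "real \<Rightarrow> (real^'n) set \<Rightarrow> (real^'n \<Rightarrow> real) set" where
  "Lp_space p \<Omega> = {f. f \<in> borel_measurable (lebesgue_on \<Omega>) \<and>
                        integrable (lebesgue_on \<Omega>) (\<lambda>x. \<bar>f x\<bar> powr p)}"

definition Lp_norm :: "real \<Rightarrow> (real^'n) set \<Rightarrow> (real^'n \<Rightarrow> real) \<Rightarrow> real" where
  "Lp_norm p \<Omega> f = (LINT x|lebesgue_on \<Omega>. \<bar>f x\<bar> powr p) powr (1 / p)"

text \<open>
  Higher partial derivatives are indexed by lists of coordinate directions: the list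
  \<open>[i\<^sub>1, \<dots>, i\<^sub>k]\<close> stands for the partial derivative of order \<open>k\<close> in the
  directions \<open>i\<^sub>1, \<dots>, i\<^sub>k\<close>.
\<close>

fun partial_deriv :: "'n list \<Rightarrow> (real^'n \<Rightarrow> real) \<Rightarrow> real^'n \<Rightarrow> real" where
  "partial_deriv [] f = f"
| "partial_deriv (i # is) f =
     (\<lambda>x. frechet_derivative (partial_deriv is f) (at x) (axis i 1))"

text \<open>
  Every iterated partial derivative is totally differentiable, hence continuous, so this is
  smoothness in the usual sense.
\<close>

definition smooth :: "(real^'n \<Rightarrow> real) \<Rightarrow> bool" where
  "smooth f \<longleftrightarrow> (\<forall>is x. partial_deriv is f differentiable (at x))"

text \<open>The space \<open>C\<^sub>c\<^sup>\<infinity>(\<Omega>)\<close>, its elements being extended by zero.\<close>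

definition test_functions :: "(real^'n) set \<Rightarrow> (real^'n \<Rightarrow> real) set" where
  "test_functions \<Omega> =
     {\<phi>. smooth \<phi> \<and> compact (closure {x. \<phi> x \<noteq> 0}) \<and> closure {x. \<phi> x \<noteq> 0} \<subseteq> \<Omega>}"

definition locally_integrable :: "(real^'n) set \<Rightarrow> (real^'n \<Rightarrow> real) \<Rightarrow> bool" where
  "locally_integrable \<Omega> f \<longleftrightarrow> (\<forall>K. compact K \<and> K \<subseteq> \<Omega> \<longrightarrow> integrable (lebesgue_on K) f)"

definition is_weak_deriv ::
    "(real^'n) set \<Rightarrow> 'n list \<Rightarrow> (real^'n \<Rightarrow> real) \<Rightarrow> (real^'n \<Rightarrow> real) \<Rightarrow> bool" where
  "is_weak_deriv \<Omega> is u w \<longleftrightarrow>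
     locally_integrable \<Omega> u \<and> locally_integrable \<Omega> w \<and>
     (\<forall>\<phi>\<in>test_functions \<Omega>.
        (LINT x|lebesgue_on \<Omega>. u x * partial_deriv is \<phi> x) =
        (-1) ^ length is * (LINT x|lebesgue_on \<Omega>. w x * \<phi> x))"

text \<open>
  Weak derivatives are unique up to null sets. The following picks a representative; it is
  meaningful only if a weak derivative exists.
\<close>

definition weak_deriv ::
    "(real^'n) set \<Rightarrow> 'n list \<Rightarrow> (real^'n \<Rightarrow> real) \<Rightarrow> real^'n \<Rightarrow> real" where
  "weak_deriv \<Omega> is u = (SOME w. is_weak_deriv \<Omega> is u w)"

text \<open>
  The parameter \<open>D\<close> is the notion of derivative, either \<^const>\<open>partial_deriv\<close> or
  \<open>weak_deriv \<Omega>\<close>.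
\<close>

definition laplacian ::
    "('n list \<Rightarrow> (real^'n \<Rightarrow> real) \<Rightarrow> real^'n \<Rightarrow> real) \<Rightarrow>
     (real^'n \<Rightarrow> real) \<Rightarrow> real^'n \<Rightarrow> real" where
  "laplacian D u = (\<lambda>x. \<Sum>i\<in>UNIV. D [i, i] u x)"

definition gradient ::
    "('n list \<Rightarrow> (real^'n \<Rightarrow> real) \<Rightarrow> real^'n \<Rightarrow> real) \<Rightarrow>
     (real^'n \<Rightarrow> real) \<Rightarrow> real^'n \<Rightarrow> real^'n" where
  "gradient D u = (\<lambda>x. \<chi> i. D [i] u x)"

text \<open>
  The pointwise product \<open>\<nabla>\<^sup>m u \<cdot> \<nabla>\<^sup>m v\<close>, where \<open>\<nabla>\<^sup>m\<close> is the scalar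
  \<open>\<Delta>\<^bsup>m/2\<^esup>\<close> for even \<open>m\<close> and the vector
  \<open>\<nabla>\<Delta>\<^bsup>(m-1)/2\<^esup>\<close> for odd \<open>m\<close>.
\<close>

definition nabla_inner ::
    "('n list \<Rightarrow> (real^'n \<Rightarrow> real) \<Rightarrow> real^'n \<Rightarrow> real) \<Rightarrow> nat \<Rightarrow>
     (real^'n \<Rightarrow> real) \<Rightarrow> (real^'n \<Rightarrow> real) \<Rightarrow> real^'n \<Rightarrow> real" where
  "nabla_inner D m u v x =
     (if even m
      then (laplacian D ^^ (m div 2)) u x * (laplacian D ^^ (m div 2)) v x
      else gradient D ((laplacian D ^^ (m div 2)) u) x \<bullet>
           gradient D ((laplacian D ^^ (m div 2)) v) x)"

definition sobolev_constant :: "'n::finite itself \<Rightarrow> nat \<Rightarrow> real" where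
  "sobolev_constant _ m =
     (GREATEST S. \<forall>v\<in>test_functions (UNIV :: (real^'n) set).
        S * (Lp_norm (2 * real CARD('n) / (real CARD('n) - 2 * real m)) UNIV v)\<^sup>2
          \<le> (LINT x|lebesgue. nabla_inner partial_deriv m v v x))"

definition sobolev_space :: "(real^'n) set \<Rightarrow> nat \<Rightarrow> (real^'n \<Rightarrow> real) set" where
  "sobolev_space \<Omega> m =
     {u \<in> Lp_space 2 \<Omega>. \<forall>is. length is \<le> m \<longrightarrow> (\<exists>w\<in>Lp_space 2 \<Omega>. is_weak_deriv \<Omega> is u w)}"

text \<open>
  Summing over lists rather than multi-indices counts each mixed derivative with its
  multinomial multiplicity: the \<open>k\<close>-th order part is the integral of the squared Euclidean
  norm of the full tensor \<open>D\<^sup>k u\<close>.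
\<close>

definition sobolev_norm :: "(real^'n) set \<Rightarrow> nat \<Rightarrow> (real^'n \<Rightarrow> real) \<Rightarrow> real" where
  "sobolev_norm \<Omega> m u =
     sqrt (\<Sum>is\<in>{is. length is \<le> m}. (Lp_norm 2 \<Omega> (weak_deriv \<Omega> is u))\<^sup>2)"

definition sobolev_space0 :: "(real^'n) set \<Rightarrow> nat \<Rightarrow> (real^'n \<Rightarrow> real) set" where
  "sobolev_space0 \<Omega> m =
     {u \<in> sobolev_space \<Omega> m.
        \<forall>\<epsilon>>0. \<exists>\<phi>\<in>test_functions \<Omega>. sobolev_norm \<Omega> m (\<lambda>x. u x - \<phi> x) < \<epsilon>}"

text \<open>
  \<open>W\<^sup>-\<^sup>m\<^sup>,\<^sup>2\<close>: bounded linear functionals on \<open>W\<^sub>0\<^sup>m\<^sup>,\<^sup>2\<close>. Linearity and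
  boundedness force such a functional to respect equality almost everywhere in \<open>\<Omega>\<close>.
  Its values outside \<^const>\<open>sobolev_space0\<close> are irrelevant.
\<close>

definition sobolev_dual :: "(real^'n) set \<Rightarrow> nat \<Rightarrow> ((real^'n \<Rightarrow> real) \<Rightarrow> real) set" where
  "sobolev_dual \<Omega> m =
     {f. (\<forall>u\<in>sobolev_space0 \<Omega> m. \<forall>v\<in>sobolev_space0 \<Omega> m. f (\<lambda>x. u x + v x) = f u + f v) \<and>
         (\<forall>c. \<forall>u\<in>sobolev_space0 \<Omega> m. f (\<lambda>x. c * u x) = c * f u) \<and>
         (\<exists>K. \<forall>u\<in>sobolev_space0 \<Omega> m. \<bar>f u\<bar> \<le> K * sobolev_norm \<Omega> m u)}"

definition sobolev_dual_norm ::
    "(real^'n) set \<Rightarrow> nat \<Rightarrow> ((real^'n \<Rightarrow> real) \<Rightarrow> real) \<Rightarrow> real" where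
  "sobolev_dual_norm \<Omega> m f =
     (SUP v\<in>{v \<in> sobolev_space0 \<Omega> m. sobolev_norm \<Omega> m v \<le> 1}. \<bar>f v\<bar>)"

definition dual_eq ::
    "(real^'n) set \<Rightarrow> nat \<Rightarrow> ((real^'n \<Rightarrow> real) \<Rightarrow> real) \<Rightarrow> ((real^'n \<Rightarrow> real) \<Rightarrow> real) \<Rightarrow> bool" where
  "dual_eq \<Omega> m f g \<longleftrightarrow> (\<forall>v\<in>sobolev_space0 \<Omega> m. f v = g v)"

definition dual_nonneg ::
    "(real^'n) set \<Rightarrow> nat \<Rightarrow> ((real^'n \<Rightarrow> real) \<Rightarrow> real) \<Rightarrow> bool" where
  "dual_nonneg \<Omega> m f \<longleftrightarrow>
     (\<forall>v\<in>sobolev_space0 \<Omega> m. (AE x in lebesgue_on \<Omega>. 0 \<le> v x) \<longrightarrow> 0 \<le> f v)"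

text \<open>The operator is curried: \<open>polyharmonic_op \<Omega> m A u\<close> is the functional \<open>(-\<Delta>)\<^sup>m u + A u\<close>.\<close>

definition polyharmonic_op ::
    "(real^'n) set \<Rightarrow> nat \<Rightarrow> (real^'n \<Rightarrow> real) \<Rightarrow> (real^'n \<Rightarrow> real) \<Rightarrow> (real^'n \<Rightarrow> real) \<Rightarrow> real" where
  "polyharmonic_op \<Omega> m A u v =
     (LINT x|lebesgue_on \<Omega>. nabla_inner (weak_deriv \<Omega>) m u v x + A x * u x * v x)"

text \<open>
  \<open>T\<close> is an isomorphism of \<open>W\<^sub>0\<^sup>m\<^sup>,\<^sup>2\<close> onto \<open>W\<^sup>-\<^sup>m\<^sup>,\<^sup>2\<close>: linear, bounded, bijective (up to
  equality almost everywhere), with bounded inverse.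
\<close>

definition sobolev_isomorphism ::
    "(real^'n) set \<Rightarrow> nat \<Rightarrow> ((real^'n \<Rightarrow> real) \<Rightarrow> (real^'n \<Rightarrow> real) \<Rightarrow> real) \<Rightarrow> bool" where
  "sobolev_isomorphism \<Omega> m T \<longleftrightarrow>
     (\<forall>u\<in>sobolev_space0 \<Omega> m. T u \<in> sobolev_dual \<Omega> m) \<and>
     (\<forall>u\<in>sobolev_space0 \<Omega> m. \<forall>u'\<in>sobolev_space0 \<Omega> m.
        dual_eq \<Omega> m (T (\<lambda>x. u x + u' x)) (\<lambda>v. T u v + T u' v)) \<and>
     (\<forall>c. \<forall>u\<in>sobolev_space0 \<Omega> m. dual_eq \<Omega> m (T (\<lambda>x. c * u x)) (\<lambda>v. c * T u v)) \<and>
     (\<forall>f\<in>sobolev_dual \<Omega> m. \<exists>u\<in>sobolev_space0 \<Omega> m. dual_eq \<Omega> m (T u) f) \<and>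
     (\<forall>u\<in>sobolev_space0 \<Omega> m. \<forall>u'\<in>sobolev_space0 \<Omega> m.
        dual_eq \<Omega> m (T u) (T u') \<longrightarrow> (AE x in lebesgue_on \<Omega>. u x = u' x)) \<and>
     (\<exists>C. \<forall>u\<in>sobolev_space0 \<Omega> m. sobolev_dual_norm \<Omega> m (T u) \<le> C * sobolev_norm \<Omega> m u) \<and>
     (\<exists>C. \<forall>u\<in>sobolev_space0 \<Omega> m. sobolev_norm \<Omega> m u \<le> C * sobolev_dual_norm \<Omega> m (T u))"

definition inverse_positivity_preserving ::
    "(real^'n) set \<Rightarrow> nat \<Rightarrow> ((real^'n \<Rightarrow> real) \<Rightarrow> (real^'n \<Rightarrow> real) \<Rightarrow> real) \<Rightarrow> bool" where
  "inverse_positivity_preserving \<Omega> m T \<longleftrightarrow>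
     (\<forall>f\<in>sobolev_dual \<Omega> m. dual_nonneg \<Omega> m f \<longrightarrow>
        (\<forall>u\<in>sobolev_space0 \<Omega> m. dual_eq \<Omega> m (T u) f \<longrightarrow> (AE x in lebesgue_on \<Omega>. 0 \<le> u x)))"

end

theory Submission
  imports Defs "HOL-Real_Asymp.Real_Asymp"
begin

text \<open>
  A smooth \<open>u\<close> in \<open>W\<^sub>0\<^sup>m\<^sup>,\<^sup>2\<close> that is negative at a point \<open>y \<noteq> x\<^sub>0\<close> is constructed so that
  \<open>(-\<Delta>)\<^sup>m u\<close> equals a positive constant \<open>\<kappa>\<close> wherever \<open>u \<le> 0\<close> and near the unit sphere. Because
  \<open>m > 1\<close>, this is possible: \<open>\<bar>x - y\<bar>\<^sup>2 + (-1)\<^sup>m \<bar>x - y\<bar>\<^sup>2\<^sup>m - c\<close> has a negative minimum at \<open>y\<close> and satisfies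
  \<open>(-\<Delta>)\<^sup>m u = \<kappa>\<close>, and so does \<open>(1 - \<bar>x\<bar>\<^sup>2)\<^sup>m\<close>, which takes over away from \<open>y\<close>. In the shell
  between the two regimes \<open>u\<close> is bounded below by a positive number, so there a large bounded \<open>\<alpha>bar\<close>
  makes \<open>(-\<Delta>)\<^sup>m u + \<alpha>bar u\<close> nonnegative. For \<open>\<alpha> = \<epsilon> 1\<close> on the unit ball, the rescaled potential can
  meet the set \<open>{u < 0}\<close>, which stays at a distance \<open>r\<close> from \<open>x\<^sub>0\<close>, only if \<open>\<lambda> < 1 / r\<close>; there it is at most
  \<open>\<epsilon> r\<^sup>-\<^sup>2\<^sup>m \<le> \<kappa>\<close>. Hence \<open>u\<close> has a nonnegative image for every \<open>\<lambda>\<close>. Since all potentials are bounded, the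
  isomorphism property is the Riesz theorem for a coercive form. A positive \<open>\<epsilon>\<close> is admissible because
  the Sobolev constant is positive, by iterating the Gagliardo--Nirenberg--Sobolev inequality.
\<close>

section \<open>Smooth functions and test functions\<close>

text \<open>For \<open>m = 1\<close> the weak maximum principle excludes such a \<open>u\<close>.
  For \<open>m > 1\<close> the operator \<open>lap ^^ m\<close> reads off only the top coefficient
  of a polynomial of degree \<open>m\<close> in |x - y|^2, so all lower coefficients can be chosen
  freely; this is what allows a strict well whose image is the same constant \<kappa> =
  \<open>lap_coeff TYPE('n) m m\<close> as that of the boundary function. Three points shape the
  rest. Nonnegativity of the image has to be tested against every nonnegative element of W_0^{m,2},
  so \<open>u\<close> is kept smooth and the integration by parts is extended from test functions by
  density. \<open>weak_deriv\<close> is a choice of representative, so iterated weak Laplacians are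
  first replaced, almost everywhere, by sums of single weak derivatives of \<open>u\<close>. Finally
  (1 - |x|^2)^m vanishes at the sphere only to order \<open>m\<close>; it lies in W_0^{m,2} because
  explicit compactly supported approximants have derivatives up to order \<open>m\<close> bounded
  uniformly, which is the borderline order. The Sobolev constant enters through its positivity,
  which also requires that its defining maximum exists.\<close>

definition pd :: "'n \<Rightarrow> (real^'n \<Rightarrow> real) \<Rightarrow> real^'n \<Rightarrow> real" where
  "pd i f = (\<lambda>x. frechet_derivative f (at x) (axis i 1))"

text \<open>Takes the place of the recursive equation, which is removed from the simpset right
  below, so that simplified goals speak of \<open>pd\<close>. The head of the list is the outermost
  derivative.\<close>

lemma partial_deriv_Cons [simp]: "partial_deriv (i # is) f = pd i (partial_deriv is f)"
  by (simp add: pd_def)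

declare partial_deriv.simps(2) [simp del]

lemma partial_deriv_append: "partial_deriv (is @ js) f = partial_deriv is (partial_deriv js f)"
  by (induction "is") auto

text \<open>The smooth functions form the largest family of differentiable functions that is closed
  under all \<open>pd i\<close>; any such family \<open>F\<close> is therefore a
  certificate.\<close>

lemma smooth_coinduct:
  assumes "f \<in> F"
    and "\<And>g x. g \<in> F \<Longrightarrow> g differentiable (at x)"
    and "\<And>g i. g \<in> F \<Longrightarrow> pd i g \<in> F"
  shows "smooth f"
proof -
  have "partial_deriv is f \<in> F" for "is"
    by (induction "is") (use assms in auto)
  then show ?thesis
    using assms(2) by (auto simp: smooth_def)
qed

lemma smooth_partial_deriv: "smooth f \<Longrightarrow> smooth (partial_deriv is f)"
  unfolding smooth_def by (metis partial_deriv_append)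

lemma smooth_pd: "smooth f \<Longrightarrow> smooth (pd i f)"
  using smooth_partial_deriv[of f "[i]"] by simp

lemma smooth_differentiable: "smooth f \<Longrightarrow> f differentiable (at x)"
  unfolding smooth_def by (metis partial_deriv.simps(1))

lemma smooth_continuous_on: "smooth f \<Longrightarrow> continuous_on A f"
  by (meson continuous_at_imp_continuous_on differentiable_imp_continuous_within
      smooth_differentiable)

lemma smooth_borel: "smooth f \<Longrightarrow> f \<in> borel_measurable borel"
  by (intro borel_measurable_continuous_onI smooth_continuous_on)

lemma frechet_derivative_eq: "(f has_derivative f') (at x) \<Longrightarrow> frechet_derivative f (at x) = f'"
  using frechet_derivative_at by metis

lemma pd_eqI: "(f has_derivative f') (at x) \<Longrightarrow> pd i f x = f' (axis i 1)"
  by (simp add: pd_def frechet_derivative_eq)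

lemma has_derivative_frechet: "f differentiable (at x) \<Longrightarrow> (f has_derivative frechet_derivative f (at x)) (at x)"
  using frechet_derivative_works by blast

lemma pd_add:
  assumes "f differentiable (at x)" "g differentiable (at x)"
  shows "pd i (\<lambda>x. f x + g x) x = pd i f x + pd i g x"
  by (subst pd_eqI[OF has_derivative_add[OF assms[THEN has_derivative_frechet]]]) (simp add: pd_def)

lemma pd_mult:
  assumes "f differentiable (at x)" "g differentiable (at x)"
  shows "pd i (\<lambda>x. f x * g x) x = f x * pd i g x + pd i f x * g x"
  by (subst pd_eqI[OF has_derivative_mult[OF assms[THEN has_derivative_frechet]]]) (simp add: pd_def)

lemma has_derivative_compose_real:
  fixes h :: "real \<Rightarrow> real"
  assumes "(h has_real_derivative d) (at (f x))" "f differentiable (at x)"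
  shows "((\<lambda>x. h (f x)) has_derivative (\<lambda>v. d * frechet_derivative f (at x) v)) (at x)"
  using has_derivative_compose[OF has_derivative_frechet[OF assms(2)], of h "times d"] assms(1)
  by (simp add: has_field_derivative_def)

lemma pd_compose:
  fixes h :: "real \<Rightarrow> real"
  assumes "(h has_real_derivative d) (at (f x))" "f differentiable (at x)"
  shows "pd i (\<lambda>x. h (f x)) x = d * pd i f x"
  by (subst pd_eqI[OF has_derivative_compose_real[OF assms]]) (simp add: pd_def)

lemma pd_const [simp]: "pd i (\<lambda>x. c) = (\<lambda>x. 0)"
  by (rule ext, subst pd_eqI[OF has_derivative_const]) simp

lemma pd_nth: "pd i (\<lambda>x. x $ j) = (\<lambda>x. if i = j then 1 else 0)"
proof
  fix x :: "real^'a"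
  have "((\<lambda>x. x $ j) has_derivative (\<lambda>x. x $ j)) (at x)"
    by (intro bounded_linear_imp_has_derivative bounded_linear_vec_nth)
  from pd_eqI[OF this, of i] show "pd i (\<lambda>x. x $ j) x = (if i = j then 1 else 0)"
    by (simp add: axis_def)
qed

text \<open>Closing the smooth functions under algebraic operations and one-dimensional compositions
  in a single step makes all the closure properties instances of one coinduction.\<close>

inductive smooth_expr :: "(real^'n \<Rightarrow> real) \<Rightarrow> bool" where
  "smooth f \<Longrightarrow> smooth_expr f"
| "smooth_expr f \<Longrightarrow> smooth_expr g \<Longrightarrow> smooth_expr (\<lambda>x. f x + g x)"
| "smooth_expr f \<Longrightarrow> smooth_expr g \<Longrightarrow> smooth_expr (\<lambda>x. f x * g x)"
| "(\<And>k x. (H k has_real_derivative H (Suc k) (f x)) (at (f x))) \<Longrightarrow> smooth_expr f \<Longrightarrow>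
    smooth_expr (\<lambda>x. H (k::nat) (f x))"

text \<open>The closure is the invariant for \<open>smooth_coinduct\<close>. In the composition rule
  \<open>H\<close> lists all derivatives of one profile, so the chain rule only raises the index and
  yields a product of two members.\<close>

lemma smooth_expr_step: "smooth_expr f \<Longrightarrow> (\<forall>x. f differentiable (at x)) \<and> (\<forall>i. smooth_expr (pd i f))"
proof (induction rule: smooth_expr.induct)
  case (1 f)
  then show ?case
    by (simp add: smooth_differentiable smooth_expr.intros(1) smooth_pd)
next
  case (2 f g)
  then have "pd i (\<lambda>x. f x + g x) = (\<lambda>x. pd i f x + pd i g x)" for i
    by (auto simp: pd_add)
  moreover have "smooth_expr (\<lambda>x. pd i f x + pd i g x)" for i
    by (intro smooth_expr.intros(2)) (use 2 in auto)
  ultimately show ?case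
    using 2 by (auto intro: differentiable_add)
next
  case (3 f g)
  then have "pd i (\<lambda>x. f x * g x) = (\<lambda>x. f x * pd i g x + pd i f x * g x)" for i
    by (auto simp: pd_mult)
  moreover have "smooth_expr (\<lambda>x. f x * pd i g x + pd i f x * g x)" for i
    by (intro smooth_expr.intros(2) smooth_expr.intros(3)) (use 3 in auto)
  ultimately show ?case
    using 3 by (auto intro: differentiable_mult)
next
  case (4 H f k)
  then have "pd i (\<lambda>x. H k (f x)) x = H (Suc k) (f x) * pd i f x" for i x
    using pd_compose[where h="H k" and f=f] by blast
  then have "pd i (\<lambda>x. H k (f x)) = (\<lambda>x. H (Suc k) (f x) * pd i f x)" for i
    by blast
  moreover have "(\<lambda>x. H k (f x)) differentiable (at x)" for x
    using has_derivative_compose_real[where h="H k" and f=f and x=x] 4 differentiableI by blast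
  moreover have "smooth_expr (\<lambda>x. H (Suc k) (f x) * pd i f x)" for i
    by (intro smooth_expr.intros(3) smooth_expr.intros(4)[of H]) (use 4 in auto)
  ultimately show ?case by auto
qed

lemma smooth_expr_smooth: "smooth_expr f \<Longrightarrow> smooth f"
  by (rule smooth_coinduct[of f "{f. smooth_expr f}"]) (auto dest: smooth_expr_step)

lemma smooth_add: "smooth f \<Longrightarrow> smooth g \<Longrightarrow> smooth (\<lambda>x. f x + g x)"
  by (rule smooth_expr_smooth, rule smooth_expr.intros(2); rule smooth_expr.intros(1))

lemma smooth_mult: "smooth f \<Longrightarrow> smooth g \<Longrightarrow> smooth (\<lambda>x. f x * g x)"
  by (rule smooth_expr_smooth, rule smooth_expr.intros(3); rule smooth_expr.intros(1))

lemma smooth_compose: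
  assumes "\<And>k x. (H k has_real_derivative H (Suc k) (f x)) (at (f x))" "smooth f"
  shows "smooth (\<lambda>x. H (k::nat) (f x))"
  by (rule smooth_expr_smooth, rule smooth_expr.intros(4)[of H], rule assms,
      rule smooth_expr.intros(1), rule assms)

lemma smooth_inverse:
  assumes f: "smooth f" and nz: "\<And>x. f x \<noteq> 0"
  shows "smooth (\<lambda>x. 1 / f x)"
proof -
  \<comment> \<open>The \<open>k\<close>-th derivative of 1/s.\<close>
  define H where "H k s = (-1) ^ k * fact k / s ^ Suc k" for k and s :: real
  have "(H k has_real_derivative H (Suc k) s) (at s)" if "s \<noteq> 0" for k s
    unfolding H_def using that
    by (auto intro!: derivative_eq_intros simp: field_simps simp del: power_Suc)
       (simp add: field_simps)
  then have "smooth (\<lambda>x. H 0 (f x))"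
    using smooth_compose[of H f 0] f nz by blast
  then show ?thesis
    by (simp add: H_def)
qed

lemma smooth_const: "smooth (\<lambda>x. c)"
  by (rule smooth_coinduct[of _ "range (\<lambda>c x. c)"]) auto

lemma smooth_cmult: "smooth f \<Longrightarrow> smooth (\<lambda>x. c * f x)"
  by (intro smooth_mult smooth_const)

lemma smooth_minus: "smooth f \<Longrightarrow> smooth (\<lambda>x. - f x)"
  using smooth_cmult[of f "-1"] by simp

lemma smooth_diff: "smooth f \<Longrightarrow> smooth g \<Longrightarrow> smooth (\<lambda>x. f x - g x)"
  using smooth_add[of f "\<lambda>x. - g x"] smooth_minus by auto

lemma smooth_sum: "(\<And>i. i \<in> I \<Longrightarrow> smooth (f i)) \<Longrightarrow> smooth (\<lambda>x. \<Sum>i\<in>I. f i x)"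
  by (induction I rule: infinite_finite_induct) (auto intro: smooth_const smooth_add)

lemma smooth_prod: "(\<And>i. i \<in> I \<Longrightarrow> smooth (f i)) \<Longrightarrow> smooth (\<lambda>x. \<Prod>i\<in>I. f i x)"
  by (induction I rule: infinite_finite_induct) (auto intro: smooth_const smooth_mult)

lemma smooth_power: "smooth f \<Longrightarrow> smooth (\<lambda>x. f x ^ k)"
  by (induction k) (auto intro: smooth_const smooth_mult)

lemma smooth_nth: "smooth (\<lambda>x. x $ j)"
proof (rule smooth_coinduct[of _ "insert (\<lambda>x. x $ j) (range (\<lambda>c x. c))"])
  show "g differentiable (at x)" if "g \<in> insert (\<lambda>x. x $ j) (range (\<lambda>c x. c))"
    for g :: "real^'a \<Rightarrow> real" and x
    using that by (auto intro: bounded_linear_imp_differentiable bounded_linear_vec_nth)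
qed (auto simp: pd_nth)

lemmas smooth_intros = smooth_const smooth_add smooth_mult smooth_diff smooth_minus smooth_sum
  smooth_prod smooth_power smooth_nth smooth_partial_deriv smooth_pd

lemma smooth_inner_self: "smooth (\<lambda>x. (x - y) \<bullet> (x - y))"
  unfolding inner_vec_def inner_real_def by (auto intro!: smooth_intros)

section \<open>Linearity, locality and symmetry of iterated partial derivatives\<close>

lemma partial_deriv_add:
  "smooth f \<Longrightarrow> smooth g \<Longrightarrow>
    partial_deriv is (\<lambda>x. f x + g x) = (\<lambda>x. partial_deriv is f x + partial_deriv is g x)"
  by (induction "is") (auto simp: pd_add smooth_differentiable smooth_partial_deriv)

lemma pd_cmult: "f differentiable (at x) \<Longrightarrow> pd i (\<lambda>x. c * f x) x = c * pd i f x"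
  using pd_mult[of "\<lambda>x. c" x f i] by simp

lemma partial_deriv_cmult:
  "smooth f \<Longrightarrow> partial_deriv is (\<lambda>x. c * f x) = (\<lambda>x. c * partial_deriv is f x)"
  by (induction "is") (auto simp: pd_cmult smooth_differentiable smooth_partial_deriv)

lemma partial_deriv_0: "partial_deriv is (\<lambda>x. 0) = (\<lambda>x. 0)"
  by (induction "is") auto

lemma partial_deriv_diff:
  "smooth f \<Longrightarrow> smooth g \<Longrightarrow>
    partial_deriv is (\<lambda>x. f x - g x) = (\<lambda>x. partial_deriv is f x - partial_deriv is g x)"
  using partial_deriv_add[of f "\<lambda>x. -1 * g x" "is"] partial_deriv_cmult[of g "is" "-1"]
  by (auto simp: smooth_minus)

lemma partial_deriv_sum:
  "(\<And>i. i \<in> I \<Longrightarrow> smooth (f i)) \<Longrightarrow>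
    partial_deriv is (\<lambda>x. \<Sum>i\<in>I. f i x) = (\<lambda>x. \<Sum>i\<in>I. partial_deriv is (f i) x)"
  by (induction I rule: infinite_finite_induct)
    (auto simp: partial_deriv_0 partial_deriv_add smooth_sum)

text \<open>On a neighbourhood of \<open>x\<close> the two functions agree, so they have the same
  candidates for a derivative at \<open>x\<close>, and the choice inside
  \<open>frechet_derivative\<close> returns the same map.\<close>

lemma pd_cong_open:
  assumes "open U" "x \<in> U" "\<And>y. y \<in> U \<Longrightarrow> f y = g y"
  shows "pd i f x = pd i g x"
proof -
  have "(f has_derivative f') (at x) = (g has_derivative f') (at x)" for f'
    using assms has_derivative_transform_within_open by metis
  then show ?thesis
    by (simp add: pd_def frechet_derivative_def)
qed

lemma partial_deriv_cong_open:
  assumes "open U" "\<And>y. y \<in> U \<Longrightarrow> f y = g y" "x \<in> U"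
  shows "partial_deriv is f x = partial_deriv is g x"
  using assms(3)
proof (induction "is" arbitrary: x)
  case (Cons i "is")
  then show ?case
    using pd_cong_open[OF assms(1), of x "partial_deriv is f"] by auto
qed (use assms in auto)

lemma has_real_derivative_along_axis:
  assumes "smooth f"
  shows "((\<lambda>t. f (x + t *\<^sub>R axis i 1)) has_real_derivative pd i f (x + t *\<^sub>R axis i 1)) (at t)"
proof -
  have "(f has_derivative frechet_derivative f (at (x + t *\<^sub>R axis i 1))) (at (x + t *\<^sub>R axis i 1))"
    using assms by (simp add: has_derivative_frechet smooth_differentiable)
  moreover have "((\<lambda>t. x + t *\<^sub>R axis i 1) has_derivative (\<lambda>t. t *\<^sub>R axis i 1)) (at t)"
    by (auto intro!: derivative_eq_intros)
  ultimately have "((\<lambda>t. f (x + t *\<^sub>R axis i 1)) has_derivative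
      (\<lambda>s. frechet_derivative f (at (x + t *\<^sub>R axis i 1)) (s *\<^sub>R axis i 1))) (at t)"
    by (rule has_derivative_compose[rotated])
  moreover have "linear (frechet_derivative f (at (x + t *\<^sub>R axis i 1)))"
    using assms by (simp add: linear_frechet_derivative smooth_differentiable)
  ultimately show ?thesis
    by (simp add: has_field_derivative_def pd_def linear_scale mult.commute[of _ "frechet_derivative _ _ _"])
qed

text \<open>The mean value theorem twice: first in direction \<open>i\<close> for the increment in
  direction \<open>j\<close>, then in direction \<open>j\<close> for \<open>pd i f\<close>.\<close>

lemma second_difference:
  assumes f: "smooth f" and h: "h > 0"
  shows "\<exists>\<xi> \<eta>. 0 < \<xi> \<and> \<xi> < h \<and> 0 < \<eta> \<and> \<eta> < h \<and>
    f (x + h *\<^sub>R axis i 1 + h *\<^sub>R axis j 1) - f (x + h *\<^sub>R axis i 1) - f (x + h *\<^sub>R axis j 1) + f x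
    = h\<^sup>2 * pd j (pd i f) (x + \<xi> *\<^sub>R axis i 1 + \<eta> *\<^sub>R axis j 1)"
proof -
  define g where "g s = f (x + h *\<^sub>R axis j 1 + s *\<^sub>R axis i 1) - f (x + s *\<^sub>R axis i 1)" for s
  define g' where "g' s = pd i f (x + h *\<^sub>R axis j 1 + s *\<^sub>R axis i 1) - pd i f (x + s *\<^sub>R axis i 1)" for s
  have "(g has_real_derivative g' s) (at s)" for s
    unfolding g_def g'_def by (intro DERIV_diff has_real_derivative_along_axis f)
  then obtain \<xi> where xi: "0 < \<xi>" "\<xi> < h" "g h - g 0 = (h - 0) * g' \<xi>"
    using MVT2[of 0 h g g'] h by auto
  have "((\<lambda>t. pd i f (x + \<xi> *\<^sub>R axis i 1 + t *\<^sub>R axis j 1)) has_real_derivative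
     pd j (pd i f) (x + \<xi> *\<^sub>R axis i 1 + t *\<^sub>R axis j 1)) (at t)" for t
    by (intro has_real_derivative_along_axis smooth_pd f)
  then obtain \<eta> where eta: "0 < \<eta>" "\<eta> < h"
    "pd i f (x + \<xi> *\<^sub>R axis i 1 + h *\<^sub>R axis j 1) - pd i f (x + \<xi> *\<^sub>R axis i 1 + 0 *\<^sub>R axis j 1)
     = (h - 0) * pd j (pd i f) (x + \<xi> *\<^sub>R axis i 1 + \<eta> *\<^sub>R axis j 1)"
    using MVT2[of 0 h "\<lambda>t. pd i f (x + \<xi> *\<^sub>R axis i 1 + t *\<^sub>R axis j 1)"
        "\<lambda>t. pd j (pd i f) (x + \<xi> *\<^sub>R axis i 1 + t *\<^sub>R axis j 1)"] h by auto
  have "g' \<xi> = h * pd j (pd i f) (x + \<xi> *\<^sub>R axis i 1 + \<eta> *\<^sub>R axis j 1)"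
    using eta(3) by (simp add: g'_def algebra_simps)
  then have "g h - g 0 = h\<^sup>2 * pd j (pd i f) (x + \<xi> *\<^sub>R axis i 1 + \<eta> *\<^sub>R axis j 1)"
    using xi by (simp add: power2_eq_square)
  then show ?thesis
    using xi eta by (intro exI[of _ \<xi>] exI[of _ \<eta>]) (simp add: g_def algebra_simps)
qed

text \<open>The second difference over a square of side \<open>h\<close> is symmetric in the two
  directions. Dividing by h^2 and letting \<open>h\<close> tend to 0, the intermediate points on
  both sides shrink to \<open>x\<close>.\<close>

lemma pd_commute:
  assumes f: "smooth f"
  shows "pd i (pd j f) = pd j (pd i f)"
proof
  fix x
  define h :: "nat \<Rightarrow> real" where "h k = 1 / real (Suc k)" for k
  have h: "h k > 0" for k by (simp add: h_def)
  have h0: "h \<longlonglongrightarrow> 0" unfolding h_def by (rule LIMSEQ_Suc) (rule lim_1_over_n)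
  obtain a b where ab: "\<And>k. 0 < a k \<and> a k < h k \<and> 0 < b k \<and> b k < h k \<and>
     f (x + h k *\<^sub>R axis i 1 + h k *\<^sub>R axis j 1) - f (x + h k *\<^sub>R axis i 1) - f (x + h k *\<^sub>R axis j 1) + f x
    = (h k)\<^sup>2 * pd j (pd i f) (x + a k *\<^sub>R axis i 1 + b k *\<^sub>R axis j 1)"
    using second_difference[OF f h, where x=x and i=i and j=j] by metis
  obtain c d where cd: "\<And>k. 0 < c k \<and> c k < h k \<and> 0 < d k \<and> d k < h k \<and>
     f (x + h k *\<^sub>R axis j 1 + h k *\<^sub>R axis i 1) - f (x + h k *\<^sub>R axis j 1) - f (x + h k *\<^sub>R axis i 1) + f x
    = (h k)\<^sup>2 * pd i (pd j f) (x + c k *\<^sub>R axis j 1 + d k *\<^sub>R axis i 1)"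
    using second_difference[OF f h, where x=x and i=j and j=i] by metis
  have lim0: "s \<longlonglongrightarrow> 0" if "\<And>k. 0 < s k \<and> s k < h k" for s :: "nat \<Rightarrow> real"
    by (rule tendsto_sandwich[OF _ _ tendsto_const h0]) (use that in \<open>auto simp: less_imp_le\<close>)
  have lim: "(\<lambda>k. F (x + s k *\<^sub>R axis p 1 + t k *\<^sub>R axis q 1)) \<longlonglongrightarrow> F x"
    if "smooth F" "\<And>k. 0 < s k \<and> s k < h k" "\<And>k. 0 < t k \<and> t k < h k" for F s t p q
  proof -
    have "(\<lambda>k. x + s k *\<^sub>R axis p 1 + t k *\<^sub>R axis q 1) \<longlonglongrightarrow> x + 0 *\<^sub>R axis p 1 + 0 *\<^sub>R axis q 1"
      by (intro tendsto_intros lim0 that)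
    moreover have "isCont F x"
      using that(1) differentiable_imp_continuous_within smooth_differentiable by blast
    ultimately show ?thesis
      using isCont_tendsto_compose[of x F] by force
  qed
  have eq: "pd j (pd i f) (x + a k *\<^sub>R axis i 1 + b k *\<^sub>R axis j 1) =
        pd i (pd j f) (x + c k *\<^sub>R axis j 1 + d k *\<^sub>R axis i 1)" for k
  proof -
    have "(h k)\<^sup>2 * pd j (pd i f) (x + a k *\<^sub>R axis i 1 + b k *\<^sub>R axis j 1) =
       (h k)\<^sup>2 * pd i (pd j f) (x + c k *\<^sub>R axis j 1 + d k *\<^sub>R axis i 1)"
      using ab[of k] cd[of k] by (simp add: algebra_simps)
    then show ?thesis using h[of k] by simp
  qed
  have "(\<lambda>k. pd j (pd i f) (x + a k *\<^sub>R axis i 1 + b k *\<^sub>R axis j 1)) \<longlonglongrightarrow> pd j (pd i f) x"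
    using ab by (intro lim smooth_pd f) auto
  then have "(\<lambda>k. pd i (pd j f) (x + c k *\<^sub>R axis j 1 + d k *\<^sub>R axis i 1)) \<longlonglongrightarrow> pd j (pd i f) x"
    by (simp only: eq)
  moreover have "(\<lambda>k. pd i (pd j f) (x + c k *\<^sub>R axis j 1 + d k *\<^sub>R axis i 1)) \<longlonglongrightarrow> pd i (pd j f) x"
    using cd by (intro lim smooth_pd f) auto
  ultimately show "pd i (pd j f) x = pd j (pd i f) x"
    by (rule LIMSEQ_unique[rotated])
qed

lemma partial_deriv_pd: "smooth f \<Longrightarrow> partial_deriv is (pd i f) = pd i (partial_deriv is f)"
  by (induction "is") (auto simp: pd_commute smooth_partial_deriv)

lemma partial_deriv_commute:
  "smooth f \<Longrightarrow> partial_deriv is (partial_deriv js f) = partial_deriv js (partial_deriv is f)"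
  by (induction "is") (auto simp: partial_deriv_pd smooth_partial_deriv)

section \<open>Test functions and integration by parts\<close>

lemma test_functionsI:
  assumes "smooth \<phi>" "compact K" "K \<subseteq> \<Omega>" "\<And>x. x \<notin> K \<Longrightarrow> \<phi> x = 0"
  shows "\<phi> \<in> test_functions \<Omega>"
proof -
  have "closure {x. \<phi> x \<noteq> 0} \<subseteq> K"
    using assms by (intro closure_minimal compact_imp_closed) auto
  moreover from this have "compact (closure {x. \<phi> x \<noteq> 0})"
    using assms(2) bounded_subset by (auto simp: compact_eq_bounded_closed)
  ultimately show ?thesis
    using assms unfolding test_functions_def by auto
qed

lemma test_functionsE:
  assumes "\<phi> \<in> test_functions \<Omega>"
  obtains K where "smooth \<phi>" "compact K" "K \<subseteq> \<Omega>" "\<And>x. x \<notin> K \<Longrightarrow> \<phi> x = 0"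
  using assms closure_subset[of "{x. \<phi> x \<noteq> 0}"]
  by (intro that[of "closure {x. \<phi> x \<noteq> 0}"]) (auto simp: test_functions_def)

lemma test_smooth: "\<phi> \<in> test_functions \<Omega> \<Longrightarrow> smooth \<phi>"
  by (simp add: test_functions_def)

lemma partial_deriv_eq_0_outside:
  assumes "closed K" "\<And>x. x \<notin> K \<Longrightarrow> \<phi> x = 0" "x \<notin> K"
  shows "partial_deriv is \<phi> x = 0"
  using partial_deriv_cong_open[of "- K" \<phi> "\<lambda>x. 0" x "is"] assms by (auto simp: partial_deriv_0)

lemma test_partial_deriv: "\<phi> \<in> test_functions \<Omega> \<Longrightarrow> partial_deriv is \<phi> \<in> test_functions \<Omega>"
  by (erule test_functionsE, rule test_functionsI)
    (auto intro: smooth_partial_deriv partial_deriv_eq_0_outside compact_imp_closed)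

lemma test_pd: "\<phi> \<in> test_functions \<Omega> \<Longrightarrow> pd i \<phi> \<in> test_functions \<Omega>"
  using test_partial_deriv[of \<phi> \<Omega> "[i]"] by simp

lemma test_mult: "smooth f \<Longrightarrow> \<phi> \<in> test_functions \<Omega> \<Longrightarrow> (\<lambda>x. f x * \<phi> x) \<in> test_functions \<Omega>"
  by (erule test_functionsE, rule test_functionsI) (auto intro: smooth_mult)

lemma test_cmult: "\<phi> \<in> test_functions \<Omega> \<Longrightarrow> (\<lambda>x. c * \<phi> x) \<in> test_functions \<Omega>"
  by (rule test_mult[OF smooth_const])

lemma test_add:
  assumes "\<phi> \<in> test_functions \<Omega>" "\<psi> \<in> test_functions \<Omega>"
  shows "(\<lambda>x. \<phi> x + \<psi> x) \<in> test_functions \<Omega>"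
proof -
  obtain K where K: "smooth \<phi>" "compact K" "K \<subseteq> \<Omega>" "\<And>x. x \<notin> K \<Longrightarrow> \<phi> x = 0"
    using test_functionsE[OF assms(1)] by blast
  obtain L where L: "smooth \<psi>" "compact L" "L \<subseteq> \<Omega>" "\<And>x. x \<notin> L \<Longrightarrow> \<psi> x = 0"
    using test_functionsE[OF assms(2)] by blast
  show ?thesis
    by (rule test_functionsI[of _ "K \<union> L"]) (use K L in \<open>auto intro: smooth_add\<close>)
qed

lemma test_0: "(\<lambda>x. 0) \<in> test_functions \<Omega>"
  by (rule test_functionsI[of _ "{}"]) (auto intro: smooth_const)

lemma test_sum:
  "(\<And>i. i \<in> I \<Longrightarrow> f i \<in> test_functions \<Omega>) \<Longrightarrow> (\<lambda>x. \<Sum>i\<in>I. f i x) \<in> test_functions \<Omega>"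
  by (induction I rule: infinite_finite_induct) (auto intro: test_0 test_add)

lemma continuous_compact_support_integrable:
  fixes f :: "'a::euclidean_space \<Rightarrow> real"
  assumes "continuous_on UNIV f" "compact K" "\<And>x. x \<notin> K \<Longrightarrow> f x = 0"
  shows "integrable lborel f"
proof -
  have "integrable lborel (\<lambda>x. indicator K x *\<^sub>R f x)"
    using assms by (intro borel_integrable_compact) (auto intro: continuous_on_subset)
  moreover have "(\<lambda>x. indicator K x *\<^sub>R f x) = f"
    using assms(3) by (auto simp: indicator_def fun_eq_iff)
  ultimately show ?thesis by simp
qed

lemma test_integrable:
  assumes "\<phi> \<in> test_functions \<Omega>"
  shows "integrable lborel \<phi>"
  using assms
  by (rule test_functionsE)
    (auto intro!: continuous_compact_support_integrable smooth_continuous_on)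

lemma test_bounded:
  assumes "\<phi> \<in> test_functions \<Omega>"
  obtains B where "\<And>x. \<bar>\<phi> x\<bar> \<le> B"
proof -
  obtain K where K: "smooth \<phi>" "compact K" "K \<subseteq> \<Omega>" "\<And>x. x \<notin> K \<Longrightarrow> \<phi> x = 0"
    using test_functionsE[OF assms] by blast
  have "compact (\<phi> ` K)"
    using K by (intro compact_continuous_image smooth_continuous_on)
  then obtain B where "\<And>y. y \<in> \<phi> ` K \<Longrightarrow> \<bar>y\<bar> \<le> B"
    using compact_imp_bounded bounded_iff by (metis real_norm_def)
  then have "\<bar>\<phi> x\<bar> \<le> max B 0" for x
    using K(4) by (cases "x \<in> K") (auto simp: le_max_iff_disj)
  then show ?thesis by (rule that)
qed

text \<open>The integral of \<open>w(x + t e\<^sub>i)\<close> does not depend on \<open>t\<close>; differentiate in \<open>t\<close>.\<close>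

lemma integral_pd_eq_0:
  assumes w: "w \<in> test_functions \<Omega>"
  shows "integral\<^sup>L lborel (pd i w) = 0"
proof -
  obtain K where K: "smooth w" "compact K" "K \<subseteq> \<Omega>" "\<And>x. x \<notin> K \<Longrightarrow> w x = 0"
    using test_functionsE[OF w] by blast
  obtain B where B: "\<And>x. \<bar>pd i w x\<bar> \<le> B"
    using test_bounded[OF test_pd[OF w, of i]] by blast
  obtain R where R: "\<And>x. x \<in> K \<Longrightarrow> norm x \<le> R"
    using K(2) compact_imp_bounded bounded_iff by metis
  define h :: "nat \<Rightarrow> real" where "h k = 1 / real (Suc k)" for k
  have h: "h k > 0" "h k \<le> 1" for k by (auto simp: h_def)
  have h0: "h \<longlonglongrightarrow> 0" unfolding h_def by (rule LIMSEQ_Suc) (rule lim_1_over_n)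
  define q where "q k x = (w (x + h k *\<^sub>R axis i 1) - w x) / h k" for k x
  have w_int: "integrable lborel w"
    using w by (rule test_integrable)
  have shift_int: "integrable lborel (\<lambda>x. w (x + v))"
    and shift_eq: "integral\<^sup>L lborel (\<lambda>x. w (x + v)) = integral\<^sup>L lborel w" for v
  proof -
    have "integrable (distr lborel borel ((+) v)) w" using w_int by (simp add: lborel_distr_plus)
    then show "integrable lborel (\<lambda>x. w (x + v))"
      by (subst (asm) integrable_distr_eq) (auto simp: add.commute smooth_borel[OF K(1)])
    have "integral\<^sup>L (distr lborel borel ((+) v)) w = integral\<^sup>L lborel (\<lambda>x. w (v + x))"
      by (rule integral_distr) (auto simp: smooth_borel[OF K(1)])
    then show "integral\<^sup>L lborel (\<lambda>x. w (x + v)) = integral\<^sup>L lborel w"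
      by (simp add: lborel_distr_plus add.commute)
  qed
  have q0: "integral\<^sup>L lborel (q k) = 0" for k
    unfolding q_def using shift_int shift_eq w_int by simp
  have "(\<lambda>k. integral\<^sup>L lborel (q k)) \<longlonglongrightarrow> integral\<^sup>L lborel (pd i w)"
  \<comment> \<open>By the mean value theorem the difference quotients are bounded by
    \<open>B\<close>. Since the increments \<open>h k\<close> are at most 1, they vanish outside the
    ball of radius \<open>R + 1\<close>, which gives an integrable majorant.\<close>
  proof (rule integral_dominated_convergence[where w="\<lambda>x. B * indicator (cball 0 (R + 1)) x"])
    show "pd i w \<in> borel_measurable lborel"
      using K(1) by (simp add: smooth_borel smooth_pd)
    show "q k \<in> borel_measurable lborel" for k
      unfolding q_def
      using borel_measurable_integrable[OF shift_int] borel_measurable_integrable[OF w_int]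
      by (auto intro!: borel_measurable_divide borel_measurable_diff)
    show "integrable lborel (\<lambda>x. B * indicator (cball 0 (R + 1)) x)"
      by (intro integrable_mult_right integrable_real_indicator emeasure_bounded_finite) auto
    show "AE x in lborel. (\<lambda>k. q k x) \<longlonglongrightarrow> pd i w x"
    proof (rule AE_I2)
      fix x
      have "((\<lambda>t. w (x + t *\<^sub>R axis i 1)) has_real_derivative pd i w x) (at 0)"
        using has_real_derivative_along_axis[OF K(1), of x i 0] by simp
      then have "((\<lambda>t. (w (x + t *\<^sub>R axis i 1) - w x) / t) \<longlongrightarrow> pd i w x) (at 0)"
        by (simp add: DERIV_def)
      moreover have "filterlim h (at 0) sequentially"
        using h0 h(1) by (auto simp: filterlim_at less_imp_neq[THEN not_sym] intro!: always_eventually)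
      ultimately show "(\<lambda>k. q k x) \<longlonglongrightarrow> pd i w x"
        unfolding q_def by (rule filterlim_compose)
    qed
    show "AE x in lborel. norm (q k x) \<le> B * indicator (cball 0 (R + 1)) x" for k
    proof (rule AE_I2)
      fix x
      obtain \<xi> where xi: "w (x + h k *\<^sub>R axis i 1) - w (x + 0 *\<^sub>R axis i 1) = (h k - 0) * pd i w (x + \<xi> *\<^sub>R axis i 1)"
        using MVT2[of 0 "h k" "\<lambda>t. w (x + t *\<^sub>R axis i 1)" "\<lambda>t. pd i w (x + t *\<^sub>R axis i 1)"]
          h(1)[of k] has_real_derivative_along_axis[OF K(1)] by blast
      have "\<bar>q k x\<bar> \<le> B"
        using xi h(1)[of k] B by (simp add: q_def)
      moreover have "q k x = 0" if "norm x > R + 1"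
      proof -
        have "norm x \<le> norm (x + h k *\<^sub>R axis i 1) + norm (h k *\<^sub>R (axis i 1 :: real^'a))"
          by (metis add_diff_cancel_right' norm_triangle_ineq4)
        then have "norm x \<le> norm (x + h k *\<^sub>R axis i 1) + 1"
          using h[of k] by simp
        then have "x \<notin> K" "x + h k *\<^sub>R axis i 1 \<notin> K" using R that by fastforce+
        then show ?thesis by (simp add: q_def K(4))
      qed
      ultimately show "norm (q k x) \<le> B * indicator (cball 0 (R + 1)) x"
        by (auto simp: indicator_def not_le)
    qed
  qed
  then have "(\<lambda>k. 0 :: real) \<longlonglongrightarrow> integral\<^sup>L lborel (pd i w)"
    by (simp only: q0)
  then show ?thesis
    using LIMSEQ_unique[OF tendsto_const] by metis
qed

lemma integral_by_parts_pd:
  assumes "smooth f" "\<phi> \<in> test_functions \<Omega>"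
  shows "(LINT x|lborel. f x * pd i \<phi> x) = - (LINT x|lborel. pd i f x * \<phi> x)"
proof -
  have "pd i (\<lambda>x. f x * \<phi> x) = (\<lambda>x. f x * pd i \<phi> x + pd i f x * \<phi> x)"
    by (rule ext, rule pd_mult)
      (use assms test_smooth smooth_differentiable in auto)
  then have "(LINT x|lborel. f x * pd i \<phi> x + pd i f x * \<phi> x) = 0"
    using integral_pd_eq_0[OF test_mult[OF assms], of i] by simp
  moreover have "integrable lborel (\<lambda>x. f x * pd i \<phi> x)" "integrable lborel (\<lambda>x. pd i f x * \<phi> x)"
    by (rule test_integrable[OF test_mult]; use assms test_pd smooth_pd in blast)+
  ultimately show ?thesis
    by (simp add: Bochner_Integration.integral_add)
qed

lemma integral_by_parts:
  assumes "smooth f" "\<phi> \<in> test_functions \<Omega>"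
  shows "(LINT x|lborel. f x * partial_deriv is \<phi> x) =
    (-1) ^ length is * (LINT x|lborel. partial_deriv is f x * \<phi> x)"
  using assms
proof (induction "is" arbitrary: f)
  case (Cons i "is")
  have "(LINT x|lborel. f x * pd i (partial_deriv is \<phi>) x) =
      - (LINT x|lborel. pd i f x * partial_deriv is \<phi> x)"
    using Cons.prems test_partial_deriv by (intro integral_by_parts_pd)
  also have "\<dots> = - ((-1) ^ length is * (LINT x|lborel. partial_deriv is (pd i f) x * \<phi> x))"
    using Cons.IH[OF smooth_pd Cons.prems(2)] Cons.prems by simp
  finally show ?case
    using Cons.prems by (simp add: partial_deriv_pd)
qed simp

section \<open>Square-integrable functions\<close>

text \<open>Stated for an arbitrary measure, since energies are computed over \<open>lborel\<close>
  on the whole space while Sobolev norms live on \<open>lebesgue_on\<close> of a domain.\<close>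

definition sqint :: "'a measure \<Rightarrow> ('a \<Rightarrow> real) \<Rightarrow> bool" where
  "sqint M f \<longleftrightarrow> f \<in> borel_measurable M \<and> integrable M (\<lambda>x. (f x)\<^sup>2)"

definition l2 :: "'a measure \<Rightarrow> ('a \<Rightarrow> real) \<Rightarrow> real" where
  "l2 M f = sqrt (LINT x|M. (f x)\<^sup>2)"

lemma sqint_mult_integrable:
  assumes "sqint M f" "sqint M g"
  shows "integrable M (\<lambda>x. f x * g x)"
proof (rule Bochner_Integration.integrable_bound[of M "\<lambda>x. (f x)\<^sup>2 + (g x)\<^sup>2"])
  have "\<bar>f x * g x\<bar> \<le> (f x)\<^sup>2 + (g x)\<^sup>2" for x
  proof -
    have "0 \<le> \<bar>f x\<bar> * \<bar>g x\<bar>" by simp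
    then show ?thesis
      using sum_squares_bound[of "\<bar>f x\<bar>" "\<bar>g x\<bar>"] unfolding power2_abs abs_mult by linarith
  qed
  then show "AE x in M. norm (f x * g x) \<le> norm ((f x)\<^sup>2 + (g x)\<^sup>2)"
    by (auto simp: abs_of_nonneg)
qed (use assms in \<open>auto simp: sqint_def\<close>)

lemma sqint_add:
  assumes "sqint M f" "sqint M g"
  shows "sqint M (\<lambda>x. f x + g x)"
proof -
  have "integrable M (\<lambda>x. (f x)\<^sup>2 + (g x)\<^sup>2 + 2 * (f x * g x))"
    using assms sqint_mult_integrable[OF assms] by (intro Bochner_Integration.integrable_add) (auto simp: sqint_def)
  then show ?thesis
    using assms by (auto simp: sqint_def power2_sum mult.assoc)
qed

lemma sqint_cmult: "sqint M f \<Longrightarrow> sqint M (\<lambda>x. c * f x)"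
  by (auto simp: sqint_def power_mult_distrib)

lemma sqint_diff: "sqint M f \<Longrightarrow> sqint M g \<Longrightarrow> sqint M (\<lambda>x. f x - g x)"
  using sqint_add[of M f "\<lambda>x. -1 * g x"] sqint_cmult[of M g "-1"] by simp

lemma sqint_0: "sqint M (\<lambda>x. 0)"
  by (simp add: sqint_def)

lemma sqint_sum: "(\<And>i. i \<in> I \<Longrightarrow> sqint M (f i)) \<Longrightarrow> sqint M (\<lambda>x. \<Sum>i\<in>I. f i x)"
  by (induction I rule: infinite_finite_induct) (auto intro: sqint_0 sqint_add)

lemma sqint_cong_AE:
  assumes "sqint M f" "g \<in> borel_measurable M" "AE x in M. f x = g x"
  shows "sqint M g"
proof -
  have "AE x in M. (f x)\<^sup>2 = (g x)\<^sup>2"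
    using assms(3) by eventually_elim simp
  then have "integrable M (\<lambda>x. (f x)\<^sup>2) = integrable M (\<lambda>x. (g x)\<^sup>2)"
    using assms by (intro integrable_cong_AE) (auto simp: sqint_def)
  then show ?thesis
    using assms by (simp add: sqint_def)
qed

lemma sqint_bounded_mult:
  assumes f: "sqint M f" and a: "a \<in> borel_measurable M" "\<And>x. x \<in> space M \<Longrightarrow> \<bar>a x\<bar> \<le> B"
  shows "sqint M (\<lambda>x. a x * f x)"
proof -
  have "integrable M (\<lambda>x. (a x * f x)\<^sup>2)"
  proof (rule Bochner_Integration.integrable_bound[of M "\<lambda>x. B\<^sup>2 * (f x)\<^sup>2"])
    have "\<bar>(a x * f x)\<^sup>2\<bar> \<le> \<bar>B\<^sup>2 * (f x)\<^sup>2\<bar>" if "x \<in> space M" for x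
    proof -
      have "\<bar>a x\<bar>\<^sup>2 \<le> B\<^sup>2"
        using a(2)[OF that] by (intro power_mono) auto
      then show ?thesis
        by (simp add: power_mult_distrib mult_right_mono)
    qed
    then show "AE x in M. norm ((a x * f x)\<^sup>2) \<le> norm (B\<^sup>2 * (f x)\<^sup>2)"
      by (auto simp del: abs_power2)
  qed (use f a in \<open>auto simp: sqint_def\<close>)
  then show ?thesis
    using f a by (auto simp: sqint_def)
qed

lemma sqint_bounded:
  assumes "finite_measure M" "f \<in> borel_measurable M" "\<And>x. x \<in> space M \<Longrightarrow> \<bar>f x\<bar> \<le> B"
  shows "sqint M f"
proof -
  interpret finite_measure M by fact
  have "sqint M (\<lambda>x. f x * 1)"
    by (rule sqint_bounded_mult) (use assms in \<open>auto simp: sqint_def\<close>)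
  then show ?thesis by simp
qed

lemma l2_nonneg [simp]: "0 \<le> l2 M f"
  by (simp add: l2_def)

lemma l2_power2: "(l2 M f)\<^sup>2 = (LINT x|M. (f x)\<^sup>2)"
  by (simp add: l2_def)

lemma l2_cong_AE:
  assumes "f \<in> borel_measurable M" "g \<in> borel_measurable M" "AE x in M. f x = g x"
  shows "l2 M f = l2 M g"
proof -
  have "AE x in M. (f x)\<^sup>2 = (g x)\<^sup>2"
    using assms(3) by eventually_elim simp
  then have "(LINT x|M. (f x)\<^sup>2) = (LINT x|M. (g x)\<^sup>2)"
    using assms by (intro integral_cong_AE) auto
  then show ?thesis
    by (simp add: l2_def)
qed

lemma l2_cmult: "l2 M (\<lambda>x. c * f x) = \<bar>c\<bar> * l2 M f"
  by (simp add: l2_def power_mult_distrib real_sqrt_mult)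

text \<open>The discriminant condition in homogeneous form, so that no coefficient has to be nonzero.\<close>

lemma quadratic_form_discriminant:
  fixes F G P :: real
  assumes q: "\<And>s t. 0 \<le> F * s\<^sup>2 + 2 * s * t * P + G * t\<^sup>2"
  shows "\<bar>P\<bar> \<le> sqrt F * sqrt G"
proof -
  have FG: "F \<ge> 0" "G \<ge> 0" using q[of 1 0] q[of 0 1] by auto
  have "P\<^sup>2 \<le> F * G"
  proof (cases "G = 0")
    case True
    have "P = 0"
    proof (rule ccontr)
      assume "P \<noteq> 0"
      then have "2 * 1 * (- (F + 1) / P) * P = - 2 * (F + 1)"
        by simp
      then show False
        using q[of 1 "- (F + 1) / P"] True FG by simp
    qed
    then show ?thesis using FG by simp
  next
    case False
    then have "0 \<le> G * (F * G - P\<^sup>2)"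
      using q[of G "- P"] by (simp add: algebra_simps power2_eq_square)
    then show ?thesis
      using False FG by (simp add: zero_le_mult_iff)
  qed
  then show ?thesis
    unfolding real_sqrt_mult[symmetric] by (simp add: real_le_rsqrt)
qed

lemma l2_Cauchy_Schwarz:
  assumes "sqint M f" "sqint M g"
  shows "\<bar>LINT x|M. f x * g x\<bar> \<le> l2 M f * l2 M g"
  unfolding l2_def
proof (rule quadratic_form_discriminant)
  fix s t :: real
  have "0 \<le> (LINT x|M. (s * f x + t * g x)\<^sup>2)"
    by simp
  also have "(\<lambda>x. (s * f x + t * g x)\<^sup>2) = (\<lambda>x. s\<^sup>2 * (f x)\<^sup>2 + (2 * s * t) * (f x * g x) + t\<^sup>2 * (g x)\<^sup>2)"
    by (auto simp: fun_eq_iff power2_sum power_mult_distrib)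
  also have "(LINT x|M. \<dots> x) = s\<^sup>2 * (LINT x|M. (f x)\<^sup>2) + (2 * s * t) * (LINT x|M. f x * g x) + t\<^sup>2 * (LINT x|M. (g x)\<^sup>2)"
    using assms sqint_mult_integrable[OF assms] by (simp add: sqint_def)
  finally show "0 \<le> (LINT x|M. (f x)\<^sup>2) * s\<^sup>2 + 2 * s * t * (LINT x|M. f x * g x) + (LINT x|M. (g x)\<^sup>2) * t\<^sup>2"
    by (simp add: algebra_simps)
qed

lemma l2_triangle:
  assumes "sqint M f" "sqint M g"
  shows "l2 M (\<lambda>x. f x + g x) \<le> l2 M f + l2 M g"
proof (rule power2_le_imp_le)
  have "(l2 M (\<lambda>x. f x + g x))\<^sup>2 = (LINT x|M. (f x)\<^sup>2 + (g x)\<^sup>2 + 2 * (f x * g x))"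
    by (simp add: l2_power2 power2_sum mult.assoc)
  also have "\<dots> = (l2 M f)\<^sup>2 + (l2 M g)\<^sup>2 + 2 * (LINT x|M. f x * g x)"
    using assms sqint_mult_integrable[OF assms] by (simp add: sqint_def l2_power2)
  also have "\<dots> \<le> (l2 M f + l2 M g)\<^sup>2"
    using l2_Cauchy_Schwarz[OF assms] by (simp add: power2_sum)
  finally show "(l2 M (\<lambda>x. f x + g x))\<^sup>2 \<le> (l2 M f + l2 M g)\<^sup>2" .
qed simp

lemma l2_sum_le:
  assumes "\<And>i. i \<in> I \<Longrightarrow> sqint M (f i)"
  shows "l2 M (\<lambda>x. \<Sum>i\<in>I. f i x) \<le> (\<Sum>i\<in>I. l2 M (f i))"
  using assms
proof (induction I rule: infinite_finite_induct)
  case (insert i I)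
  then have "l2 M (\<lambda>x. f i x + (\<Sum>i\<in>I. f i x)) \<le> l2 M (f i) + l2 M (\<lambda>x. \<Sum>i\<in>I. f i x)"
    by (intro l2_triangle sqint_sum) auto
  with insert show ?case by (auto simp: intro: order_trans)
qed (auto simp: l2_def)

lemma l2_bounded_mult:
  assumes f: "sqint M f" and a: "a \<in> borel_measurable M" "\<And>x. x \<in> space M \<Longrightarrow> \<bar>a x\<bar> \<le> B"
    and B: "0 \<le> B"
  shows "l2 M (\<lambda>x. a x * f x) \<le> B * l2 M f"
proof -
  have "(LINT x|M. (a x * f x)\<^sup>2) \<le> (LINT x|M. B\<^sup>2 * (f x)\<^sup>2)"
  proof (rule integral_mono)
    show "integrable M (\<lambda>x. (a x * f x)\<^sup>2)"
      using sqint_bounded_mult[OF f a] by (simp add: sqint_def)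
    show "integrable M (\<lambda>x. B\<^sup>2 * (f x)\<^sup>2)"
      using f by (simp add: sqint_def)
    show "(a x * f x)\<^sup>2 \<le> B\<^sup>2 * (f x)\<^sup>2" if "x \<in> space M" for x
    proof -
      have "\<bar>a x\<bar>\<^sup>2 \<le> B\<^sup>2"
        using a(2)[OF that] by (intro power_mono) auto
      then show ?thesis
        by (simp add: power_mult_distrib mult_right_mono)
    qed
  qed
  then have "l2 M (\<lambda>x. a x * f x) \<le> sqrt (B\<^sup>2 * (LINT x|M. (f x)\<^sup>2))"
    by (simp add: l2_def)
  then show ?thesis
    using B by (simp add: l2_def real_sqrt_mult)
qed

lemma l2_abs: "l2 M (\<lambda>x. \<bar>f x\<bar>) = l2 M f"
  by (simp add: l2_def)

lemma (in finite_measure) sqint_integrable: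
  assumes "sqint M f"
  shows "integrable M f" "(LINT x|M. \<bar>f x\<bar>) \<le> sqrt (measure M (space M)) * l2 M f"
proof -
  have 1: "sqint M (\<lambda>x. 1)" by (simp add: sqint_def)
  from sqint_mult_integrable[OF assms this] show "integrable M f" by simp
  have "sqint M (\<lambda>x. \<bar>f x\<bar>)" using assms by (auto simp: sqint_def)
  from l2_Cauchy_Schwarz[OF this 1] show "(LINT x|M. \<bar>f x\<bar>) \<le> sqrt (measure M (space M)) * l2 M f"
    by (simp add: l2_abs l2_def[of M "\<lambda>x. 1"] mult.commute)
qed

text \<open>Riesz-Fischer. Along a subsequence with gaps below 2^-i the increments are summable in
  L^1, as the measure is finite, so this subsequence converges almost everywhere. Fatou's lemma then
  bounds the distance of every late member of the full sequence to the limit.\<close>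

lemma (in finite_measure) l2_complete:
  assumes f: "\<And>k. sqint M (f k)"
    and cauchy: "\<And>e. e > 0 \<Longrightarrow> \<exists>N. \<forall>j\<ge>N. \<forall>k\<ge>N. l2 M (\<lambda>x. f j x - f k x) < e"
  shows "\<exists>g. sqint M g \<and> (\<lambda>k. l2 M (\<lambda>x. f k x - g x)) \<longlonglongrightarrow> 0"
proof -
  have "\<exists>N. \<forall>j\<ge>N. \<forall>k\<ge>N. l2 M (\<lambda>x. f j x - f k x) < (1/2) ^ i" for i :: nat
    by (rule cauchy) simp
  then obtain N where N: "\<And>i j k. j \<ge> N i \<Longrightarrow> k \<ge> N i \<Longrightarrow> l2 M (\<lambda>x. f j x - f k x) < (1/2) ^ (i::nat)"
    by metis
  \<comment> \<open>Partial sums make \<open>r\<close> monotone and at least \<open>N i\<close>; the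
    summand \<open>i\<close> forces it to infinity.\<close>
  define r where "r i = (\<Sum>j\<le>i. N j) + i" for i
  have rN: "r i \<ge> N i" and r_Suc: "r (Suc i) \<ge> r i" and r_ge: "r i \<ge> i" for i
    by (auto simp: r_def member_le_sum intro: trans_le_add1)
  define d where "d i x = f (r (Suc i)) x - f (r i) x" for i x
  have d: "sqint M (d i)" for i
    unfolding d_def by (intro sqint_diff f)
  have d_int: "integrable M (d i)" for i
    by (rule sqint_integrable d)+
  let ?C = "sqrt (measure M (space M))"
  have d_le: "(LINT x|M. \<bar>d i x\<bar>) \<le> ?C * (1/2) ^ i" for i
  proof -
    have "l2 M (d i) \<le> (1/2) ^ i"
      unfolding d_def using N[of i "r (Suc i)" "r i"] rN[of i] r_Suc[of i] by simp
    then have "?C * l2 M (d i) \<le> ?C * (1/2) ^ i"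
      by (intro mult_left_mono) auto
    with sqint_integrable(2)[OF d, of i] show ?thesis by simp
  qed
  have d_meas: "d i \<in> borel_measurable M" for i
    using d by (simp add: sqint_def)
  have "(\<integral>\<^sup>+x. (\<Sum>i. ennreal \<bar>d i x\<bar>) \<partial>M) = (\<Sum>i. \<integral>\<^sup>+x. ennreal \<bar>d i x\<bar> \<partial>M)"
    using d_meas by (intro nn_integral_suminf) auto
  also have "\<dots> = (\<Sum>i. ennreal (LINT x|M. \<bar>d i x\<bar>))"
    using d_int by (intro suminf_cong nn_integral_eq_integral) auto
  also have "\<dots> \<le> (\<Sum>i. ennreal (?C * (1/2) ^ i))"
    using d_le by (intro suminf_le ennreal_leI) auto
  also have "\<dots> < \<infinity>"
  proof -
    have "(\<lambda>i. ?C * (1/2) ^ i) sums (?C * 2)"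
      using geometric_sums[of "1/2 :: real"] by (intro sums_mult) auto
    then have "(\<Sum>i. ennreal (?C * (1/2) ^ i)) = ennreal (?C * 2)"
      by (intro suminf_ennreal_eq) auto
    then show ?thesis by simp
  qed
  finally have "AE x in M. (\<Sum>i. ennreal \<bar>d i x\<bar>) \<noteq> \<infinity>"
    using d_meas by (intro nn_integral_PInf_AE) auto
  then have conv: "AE x in M. (\<lambda>k. f (r k) x) \<longlonglongrightarrow> lim (\<lambda>k. f (r k) x)"
  proof (rule AE_mp, intro AE_I2 impI)
    fix x assume "(\<Sum>i. ennreal \<bar>d i x\<bar>) \<noteq> \<infinity>"
    then have "summable (\<lambda>i. \<bar>d i x\<bar>)"
      by (intro summable_suminf_not_top) auto
    then have "summable (\<lambda>i. d i x)"
      by (rule summable_rabs_cancel)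
    then have "convergent (\<lambda>k. f (r 0) x + (\<Sum>i<k. d i x))"
      by (intro convergent_add convergent_const) (simp add: summable_iff_convergent)
    moreover have "f (r 0) x + (\<Sum>i<k. d i x) = f (r k) x" for k
      unfolding d_def by (subst sum_lessThan_telescope) simp
    ultimately show "(\<lambda>k. f (r k) x) \<longlonglongrightarrow> lim (\<lambda>k. f (r k) x)"
      by (simp add: convergent_LIMSEQ_iff)
  qed
  define g where "g x = lim (\<lambda>k. f (r k) x)" for x
  have f_meas: "f k \<in> borel_measurable M" for k
    using f by (simp add: sqint_def)
  have g_meas: "g \<in> borel_measurable M"
    unfolding g_def by (intro borel_measurable_lim_metric f_meas)
  have fatou: "sqint M (\<lambda>x. f j x - g x) \<and> l2 M (\<lambda>x. f j x - g x) \<le> (1/2) ^ i" if j: "j \<ge> N i" for i j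
  proof -
    have "(\<integral>\<^sup>+x. ennreal ((f j x - g x)\<^sup>2) \<partial>M) = (\<integral>\<^sup>+x. liminf (\<lambda>k. ennreal ((f j x - f (r k) x)\<^sup>2)) \<partial>M)"
    proof (rule nn_integral_cong_AE, rule AE_mp[OF conv], intro AE_I2 impI)
      fix x assume "(\<lambda>k. f (r k) x) \<longlonglongrightarrow> lim (\<lambda>k. f (r k) x)"
      then have "(\<lambda>k. ennreal ((f j x - f (r k) x)\<^sup>2)) \<longlonglongrightarrow> ennreal ((f j x - g x)\<^sup>2)"
        unfolding g_def by (intro tendsto_intros)
      then show "ennreal ((f j x - g x)\<^sup>2) = liminf (\<lambda>k. ennreal ((f j x - f (r k) x)\<^sup>2))"
        by (rule lim_imp_Liminf[OF trivial_limit_sequentially, symmetric])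
    qed
    also have "\<dots> \<le> liminf (\<lambda>k. \<integral>\<^sup>+x. ennreal ((f j x - f (r k) x)\<^sup>2) \<partial>M)"
      using f_meas by (intro nn_integral_liminf) auto
    also have "\<dots> \<le> limsup (\<lambda>k. \<integral>\<^sup>+x. ennreal ((f j x - f (r k) x)\<^sup>2) \<partial>M)"
      by (rule Liminf_le_Limsup) simp
    also have "\<dots> \<le> ennreal (((1/2) ^ i)\<^sup>2)"
    proof (rule Limsup_bounded)
      show "\<forall>\<^sub>F k in sequentially. (\<integral>\<^sup>+x. ennreal ((f j x - f (r k) x)\<^sup>2) \<partial>M) \<le> ennreal (((1/2) ^ i)\<^sup>2)"
      proof (rule eventually_sequentiallyI[of "N i"])
        fix k assume "k \<ge> N i"
        then have "r k \<ge> N i" using r_ge[of k] by linarith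
        then have "l2 M (\<lambda>x. f j x - f (r k) x) \<le> (1/2) ^ i"
          using N[of i j "r k"] j by simp
        then have "(l2 M (\<lambda>x. f j x - f (r k) x))\<^sup>2 \<le> ((1/2) ^ i)\<^sup>2"
          by (intro power_mono) auto
        moreover have "(\<integral>\<^sup>+x. ennreal ((f j x - f (r k) x)\<^sup>2) \<partial>M) = ennreal ((l2 M (\<lambda>x. f j x - f (r k) x))\<^sup>2)"
          using sqint_diff[OF f f, of j "r k"] unfolding l2_power2 sqint_def
          by (intro nn_integral_eq_integral) auto
        ultimately show "(\<integral>\<^sup>+x. ennreal ((f j x - f (r k) x)\<^sup>2) \<partial>M) \<le> ennreal (((1/2) ^ i)\<^sup>2)"
          by (simp add: ennreal_leI)
      qed
    qed
    finally have le: "(\<integral>\<^sup>+x. ennreal ((f j x - g x)\<^sup>2) \<partial>M) \<le> ennreal (((1/2) ^ i)\<^sup>2)" .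
    have int: "integrable M (\<lambda>x. (f j x - g x)\<^sup>2)"
      using f_meas g_meas le by (intro integrableI_nonneg) (auto intro: le_less_trans)
    moreover have "(LINT x|M. (f j x - g x)\<^sup>2) \<le> ((1/2) ^ i)\<^sup>2"
      using le nn_integral_eq_integral[OF int] by (simp add: ennreal_le_iff)
    ultimately show ?thesis
      using f_meas[of j] g_meas by (auto simp: sqint_def l2_def intro: real_le_lsqrt)
  qed
  have "sqint M (\<lambda>x. f (N 0) x - g x)"
    using fatou[of 0 "N 0"] by simp
  from sqint_diff[OF f[of "N 0"] this] have "sqint M g" by simp
  moreover have "(\<lambda>k. l2 M (\<lambda>x. f k x - g x)) \<longlonglongrightarrow> 0"
  proof (rule LIMSEQ_I)
    fix e :: real assume "e > 0"
    then obtain i :: nat where "(1/2) ^ i < e"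
      using real_arch_pow_inv[of e "1/2"] by auto
    then have "\<forall>k\<ge>N i. norm (l2 M (\<lambda>x. f k x - g x) - 0) < e"
      using fatou by fastforce
    then show "\<exists>no. \<forall>k\<ge>no. norm (l2 M (\<lambda>x. f k x - g x) - 0) < e" by blast
  qed
  ultimately show ?thesis by blast
qed

text \<open>The one-dimensional profile behind all smooth cutoffs here. The exponent is an integer
  because differentiation drives it below zero. The parameter \<open>e\<close> is kept so that e ->
  0 recovers the truncated power: \<open>p = 0\<close> serves for bumps and plateaus,
  \<open>p = m\<close> for approximating (1 - |x|^2)^m.\<close>

definition flat :: "int \<Rightarrow> real \<Rightarrow> real \<Rightarrow> real" where
  "flat p e t = (if t > 0 then t powi p * exp (- e / t) else 0)"

lemma flat_tendsto_0:
  assumes "e > 0"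
  shows "((\<lambda>t :: real. t powi p * exp (- e / t)) \<longlongrightarrow> 0) (at_right 0)"
proof -
  have "((\<lambda>t::real. t powr (of_int p) * exp (- e / t)) \<longlongrightarrow> 0) (at_right 0)"
    using assms by real_asymp
  moreover have "\<forall>\<^sub>F t in at_right 0. t powr (of_int p) * exp (- e / t) = t powi p * exp (- e / t)"
    by (simp add: eventually_at_filter powr_real_of_int')
  ultimately show ?thesis
    by (rule Lim_transform_eventually)
qed

text \<open>Away from 0 this is the product rule. At 0 the difference quotient from the right is
  again t^(p-1) exp(-e/t), which the exponential drives to 0 for every integer exponent.\<close>

lemma flat_has_derivative:
  assumes e: "e > 0"
  shows "(flat p e has_real_derivative (of_int p * flat (p - 1) e t + e * flat (p - 2) e t)) (at t)"
proof -
  consider "t > 0" | "t < 0" | "t = 0" by linarith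
  then show ?thesis
  proof cases
    case 1
    have "((\<lambda>t. t powi p * exp (- e / t)) has_real_derivative
        (of_int p * (t powi (p - 1)) * exp (- e / t) + t powi p * (exp (- e / t) * (e / t\<^sup>2)))) (at t)"
      using 1 by (auto intro!: derivative_eq_intros simp: power2_eq_square)
    also have "t powi p * (exp (- e / t) * (e / t\<^sup>2)) = e * (t powi (p - 2) * exp (- e / t))"
      using 1 by (simp add: power_int_diff)
    finally have "((\<lambda>t. t powi p * exp (- e / t)) has_real_derivative
        (of_int p * flat (p - 1) e t + e * flat (p - 2) e t)) (at t)"
      using 1 by (simp add: flat_def mult.assoc)
    then show ?thesis
      by (rule has_field_derivative_transform_within_open[of _ _ _ "{0<..}"]) (use 1 in \<open>auto simp: flat_def\<close>)
  next
    case 2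
    have "((\<lambda>t. 0) has_real_derivative 0) (at t)" by simp
    then have "(flat p e has_real_derivative 0) (at t)"
      by (rule has_field_derivative_transform_within_open[of _ _ _ "{..<0}"]) (use 2 in \<open>auto simp: flat_def\<close>)
    then show ?thesis
      using 2 by (simp add: flat_def)
  next
    case 3
    have "((\<lambda>h. flat p e h / h) \<longlongrightarrow> 0) (at_right 0)"
    proof (rule Lim_transform_eventually[OF flat_tendsto_0[OF e, of "p - 1"]])
      show "\<forall>\<^sub>F t in at_right 0. t powi (p - 1) * exp (- e / t) = flat p e t / t"
        by (simp add: eventually_at_filter flat_def power_int_diff)
    qed
    moreover have "((\<lambda>h. flat p e h / h) \<longlongrightarrow> 0) (at_left 0)"
    proof (rule Lim_transform_eventually[OF tendsto_const])
      show "\<forall>\<^sub>F t in at_left 0. 0 = flat p e t / t"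
        by (simp add: eventually_at_filter flat_def)
    qed
    ultimately have "((\<lambda>h. flat p e h / h) \<longlongrightarrow> 0) (at 0)"
      by (simp add: filterlim_split_at)
    then show ?thesis
      using 3 by (simp add: DERIV_def flat_def)
  qed
qed

text \<open>Coefficients of the iterated derivatives of \<open>flat p e\<close>: each derivative lowers the
  exponent by one or, at the cost of a factor \<open>e\<close>, by two.\<close>

fun flat_coeff :: "int \<Rightarrow> nat \<Rightarrow> nat \<Rightarrow> real" where
  "flat_coeff p 0 j = (if j = 0 then 1 else 0)"
| "flat_coeff p (Suc k) 0 = of_int (p - int k) * flat_coeff p k 0"
| "flat_coeff p (Suc k) (Suc j) =
     of_int (p - int k - int (Suc j)) * flat_coeff p k (Suc j) + flat_coeff p k j"

definition flat_deriv :: "int \<Rightarrow> real \<Rightarrow> nat \<Rightarrow> real \<Rightarrow> real" where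
  "flat_deriv p e k t = (\<Sum>j\<le>k. flat_coeff p k j * e ^ j * flat (p - int k - int j) e t)"

lemma flat_coeff_eq_0: "k < j \<Longrightarrow> flat_coeff p k j = 0"
proof (induction k arbitrary: j)
  case (Suc k)
  then show ?case by (cases j) auto
qed simp

lemma flat_deriv_0 [simp]: "flat_deriv p e 0 = flat p e"
  by (simp add: flat_deriv_def fun_eq_iff)

lemma flat_deriv_has_derivative:
  assumes e: "e > 0"
  shows "(flat_deriv p e k has_real_derivative flat_deriv p e (Suc k) t) (at t)"
proof -
  have "(flat_deriv p e k has_real_derivative
      (\<Sum>j\<le>k. flat_coeff p k j * e ^ j * (of_int (p - int k - int j) * flat (p - int k - int j - 1) e t
        + e * flat (p - int k - int j - 2) e t))) (at t)"
    unfolding flat_deriv_def[abs_def]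
    by (intro DERIV_sum DERIV_cmult flat_has_derivative e)
  also have "(\<Sum>j\<le>k. flat_coeff p k j * e ^ j * (of_int (p - int k - int j) * flat (p - int k - int j - 1) e t
        + e * flat (p - int k - int j - 2) e t)) =
      (\<Sum>j\<le>k. of_int (p - int k - int j) * flat_coeff p k j * e ^ j * flat (p - int (Suc k) - int j) e t) +
      (\<Sum>j\<le>k. flat_coeff p k j * e ^ Suc j * flat (p - int (Suc k) - int (Suc j)) e t)"
    unfolding sum.distrib[symmetric] by (intro sum.cong) (auto simp: algebra_simps)
  \<comment> \<open>The additional summand has coefficient \<open>flat_coeff p k (Suc k)\<close>,
    which is 0; it makes both sums fit the index shift that follows.\<close>
  also have "(\<Sum>j\<le>k. of_int (p - int k - int j) * flat_coeff p k j * e ^ j * flat (p - int (Suc k) - int j) e t) =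
     (\<Sum>j\<le>Suc k. of_int (p - int k - int j) * flat_coeff p k j * e ^ j * flat (p - int (Suc k) - int j) e t)"
    by (simp add: flat_coeff_eq_0)
  also have "\<dots> = of_int (p - int k) * flat_coeff p k 0 * flat (p - int (Suc k)) e t +
     (\<Sum>j\<le>k. of_int (p - int k - int (Suc j)) * flat_coeff p k (Suc j) * e ^ Suc j * flat (p - int (Suc k) - int (Suc j)) e t)"
    by (subst sum.atMost_Suc_shift) simp
  also have "\<dots> + (\<Sum>j\<le>k. flat_coeff p k j * e ^ Suc j * flat (p - int (Suc k) - int (Suc j)) e t) =
     flat_coeff p (Suc k) 0 * flat (p - int (Suc k)) e t + 
     (\<Sum>j\<le>k. flat_coeff p (Suc k) (Suc j) * e ^ Suc j * flat (p - int (Suc k) - int (Suc j)) e t)"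
    unfolding add.assoc sum.distrib[symmetric]
    by (intro arg_cong2[of _ _ _ _ "(+)"] sum.cong) (auto simp: algebra_simps)
  also have "\<dots> = flat_deriv p e (Suc k) t"
    unfolding flat_deriv_def by (subst sum.atMost_Suc_shift) simp
  finally show ?thesis .
qed

lemma smooth_flat:
  assumes "e > 0" "smooth f"
  shows "smooth (\<lambda>x. flat p e (f x))"
  using smooth_compose[of "flat_deriv p e" f 0] flat_deriv_has_derivative[OF assms(1)] assms(2) by simp

section \<open>Energies of test functions\<close>

definition lap :: "(real^'n \<Rightarrow> real) \<Rightarrow> real^'n \<Rightarrow> real" where
  "lap f = (\<lambda>x. \<Sum>i\<in>UNIV. pd i (pd i f) x)"

lemma laplacian_partial_deriv: "laplacian partial_deriv = lap"
  by (simp add: fun_eq_iff laplacian_def lap_def)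

lemma lap_eq: "lap f x = (\<Sum>i\<in>UNIV. partial_deriv [i, i] f x)"
  by (simp add: lap_def)

lemma smooth_lap: "smooth f \<Longrightarrow> smooth (lap f)"
  unfolding lap_def by (intro smooth_sum smooth_pd)

lemma test_lap: "\<phi> \<in> test_functions \<Omega> \<Longrightarrow> lap \<phi> \<in> test_functions \<Omega>"
  unfolding lap_def by (intro test_sum test_pd)

lemma smooth_lap_funpow: "smooth f \<Longrightarrow> smooth ((lap ^^ k) f)"
  by (induction k) (auto intro: smooth_lap)

lemma test_lap_funpow: "\<phi> \<in> test_functions \<Omega> \<Longrightarrow> (lap ^^ k) \<phi> \<in> test_functions \<Omega>"
  by (induction k) (auto intro: test_lap)

lemma partial_deriv_lap:
  assumes "smooth f"
  shows "partial_deriv is (lap f) = lap (partial_deriv is f)"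
  unfolding lap_def using assms
  by (subst partial_deriv_sum) (auto simp: partial_deriv_pd smooth_pd)

lemma partial_deriv_lap_funpow:
  "smooth f \<Longrightarrow> partial_deriv is ((lap ^^ k) f) = (lap ^^ k) (partial_deriv is f)"
  by (induction k) (auto simp: partial_deriv_lap smooth_lap_funpow)

lemma lap_funpow_cong_open:
  assumes "open U" "\<And>y. y \<in> U \<Longrightarrow> f y = g y" "x \<in> U"
  shows "(lap ^^ k) f x = (lap ^^ k) g x"
  using assms(3)
proof (induction k arbitrary: x)
  case (Suc k)
  have "partial_deriv [i, i] ((lap ^^ k) f) x = partial_deriv [i, i] ((lap ^^ k) g) x" for i
    by (rule partial_deriv_cong_open[OF assms(1) _ Suc.prems]) (rule Suc.IH)
  then show ?case by (simp add: lap_eq[of "(lap ^^ k) f"] lap_eq[of "(lap ^^ k) g"])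
qed (use assms in auto)

lemma finite_lists_length [simp]: "finite {is :: 'n::finite list. length is = k}"
  using finite_lists_length_eq[of "UNIV :: 'n set" k] by simp

lemma sum_lists_Suc:
  fixes f :: "'n::finite list \<Rightarrow> 'a::comm_monoid_add"
  shows "(\<Sum>is | length is = Suc k. f is) = (\<Sum>i\<in>UNIV. \<Sum>is | length is = k. f (i # is))"
proof -
  have "(\<Sum>is | length is = Suc k. f is) =
      (\<Sum>(i, is)\<in>UNIV \<times> {is. length is = k}. f (i # is))"
    by (rule sum.reindex_bij_witness[of _ "\<lambda>(i, is). i # is" "\<lambda>is. (hd is, tl is)"])
      (auto simp: length_Suc_conv)
  then show ?thesis
    by (simp add: sum.cartesian_product)
qed

text \<open>The Dirichlet integral of the full derivative tensor. The Poincare and Sobolev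
  inequalities are proved for single derivatives and hence give bounds by this quantity;
  \<open>energy_nabla_inner\<close> identifies it with the integral of |nabla^m v|^2.\<close>

definition energy :: "nat \<Rightarrow> (real^'n \<Rightarrow> real) \<Rightarrow> real" where
  "energy k v = (\<Sum>is | length is = k. LINT x|lborel. (partial_deriv is v x)\<^sup>2)"

lemma energy_nonneg: "0 \<le> energy k v"
  unfolding energy_def by (intro sum_nonneg) simp

lemma test_mult_integrable:
  assumes "smooth f" "\<phi> \<in> test_functions \<Omega>"
  shows "integrable lborel (\<lambda>x. f x * \<phi> x)"
  by (rule test_integrable[OF test_mult[OF assms]])

lemma test_sqint:
  assumes "\<phi> \<in> test_functions \<Omega>"
  shows "sqint lborel \<phi>"
  using test_mult_integrable[OF test_smooth[OF assms] assms] smooth_borel[OF test_smooth[OF assms]]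
  by (simp add: sqint_def power2_eq_square)

text \<open>Two integrations by parts move one \<open>pd i\<close> and one \<open>pd j\<close>
  across; the two signs cancel and compact support removes the boundary terms.\<close>

lemma integral_second_derivs:
  assumes w: "w \<in> test_functions \<Omega>"
  shows "(LINT x|lborel. (pd i (pd j w) x)\<^sup>2) = (LINT x|lborel. pd i (pd i w) x * pd j (pd j w) x)"
proof -
  have s: "smooth w" by (rule test_smooth[OF w])
  have "(LINT x|lborel. pd i (pd j w) x * pd i (pd j w) x) =
      - (LINT x|lborel. pd i (pd i (pd j w)) x * pd j w x)"
    by (rule integral_by_parts_pd[where \<Omega>=\<Omega>]) (intro smooth_pd s test_pd w)+
  also have "pd i (pd i (pd j w)) = pd j (pd i (pd i w))"
    using s by (simp add: pd_commute[of _ i j] smooth_pd)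
  also have "- (LINT x|lborel. pd j (pd i (pd i w)) x * pd j w x) =
      (LINT x|lborel. pd i (pd i w) x * pd j (pd j w) x)"
    by (subst integral_by_parts_pd[where \<Omega>=\<Omega>]) (auto intro!: smooth_pd s test_pd w)
  finally show ?thesis by (simp add: power2_eq_square)
qed

lemma sum_integral_second_derivs:
  assumes w: "w \<in> test_functions \<Omega>"
  shows "(\<Sum>i\<in>UNIV. \<Sum>j\<in>UNIV. LINT x|lborel. (pd i (pd j w) x)\<^sup>2) = (LINT x|lborel. (lap w x)\<^sup>2)"
proof -
  have int: "integrable lborel (\<lambda>x. pd i (pd i w) x * pd j (pd j w) x)" for i j
    by (rule test_mult_integrable[where \<Omega>=\<Omega>]) (intro smooth_pd test_smooth[OF w] test_pd w)+
  have "(LINT x|lborel. (lap w x)\<^sup>2) =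
      (LINT x|lborel. (\<Sum>i\<in>UNIV. \<Sum>j\<in>UNIV. pd i (pd i w) x * pd j (pd j w) x))"
    by (simp add: lap_def power2_eq_square sum_product)
  also have "\<dots> = (\<Sum>i\<in>UNIV. \<Sum>j\<in>UNIV. LINT x|lborel. pd i (pd i w) x * pd j (pd j w) x)"
    using int by (simp add: Bochner_Integration.integral_sum)
  finally show ?thesis
    using integral_second_derivs[OF w] by simp
qed

text \<open>The two outermost derivatives of each list are summed first: applied to
  \<open>partial_deriv is v\<close>, they give the integral of the squared Laplacian.\<close>

lemma energy_Suc_Suc:
  assumes v: "v \<in> test_functions \<Omega>"
  shows "energy (Suc (Suc k)) v = energy k (lap v)"
proof -
  have "energy (Suc (Suc k)) v =
    (\<Sum>i\<in>UNIV. \<Sum>j\<in>UNIV. \<Sum>is | length is = k. LINT x|lborel. (pd i (pd j (partial_deriv is v)) x)\<^sup>2)"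
    by (simp add: energy_def sum_lists_Suc)
  also have "\<dots> = (\<Sum>i\<in>UNIV. \<Sum>is | length is = k. \<Sum>j\<in>UNIV. LINT x|lborel. (pd i (pd j (partial_deriv is v)) x)\<^sup>2)"
    by (intro sum.cong refl sum.swap)
  also have "\<dots> = (\<Sum>is | length is = k. \<Sum>i\<in>UNIV. \<Sum>j\<in>UNIV. LINT x|lborel. (pd i (pd j (partial_deriv is v)) x)\<^sup>2)"
    by (rule sum.swap)
  also have "\<dots> = (\<Sum>is | length is = k. LINT x|lborel. (partial_deriv is (lap v) x)\<^sup>2)"
    using sum_integral_second_derivs[OF test_partial_deriv[OF v]] test_smooth[OF v]
    by (simp add: partial_deriv_lap)
  finally show ?thesis by (simp add: energy_def)
qed

lemma energy_add_double:
  "v \<in> test_functions \<Omega> \<Longrightarrow> energy (2 * k + r) v = energy r ((lap ^^ k) v)"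
proof (induction k arbitrary: v)
  case (Suc k)
  then have "energy (2 * Suc k + r) v = energy (2 * k + r) (lap v)"
    using energy_Suc_Suc[of v \<Omega> "2 * k + r"] by simp
  also have "\<dots> = energy r ((lap ^^ k) (lap v))"
    by (rule Suc.IH[OF test_lap[OF Suc.prems]])
  finally show ?case by (simp add: funpow_swap1)
qed simp

text \<open>Treats both parities at once: the lists \<open>c\<close> of length
  \<open>m mod 2\<close> are the empty list alone, giving the product of scalars, or the singletons,
  giving the inner product of gradients.\<close>

lemma nabla_inner_partial_deriv:
  "nabla_inner partial_deriv m u v x =
    (\<Sum>c | length c = m mod 2. partial_deriv c ((lap ^^ (m div 2)) u) x *
      partial_deriv c ((lap ^^ (m div 2)) v) x)"
proof (cases "even m")
  case True
  then show ?thesis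
    by (simp add: nabla_inner_def laplacian_partial_deriv even_iff_mod_2_eq_zero)
next
  case False
  then have "m mod 2 = Suc 0" by presburger
  then show ?thesis using False
    by (simp add: nabla_inner_def laplacian_partial_deriv sum_lists_Suc gradient_def inner_vec_def
        del: length_0_conv) simp
qed

lemma energy_nabla_inner:
  assumes v: "v \<in> test_functions \<Omega>"
  shows "energy m v = (LINT x|lborel. nabla_inner partial_deriv m v v x)"
proof -
  have "energy m v = energy (m mod 2) ((lap ^^ (m div 2)) v)"
    using energy_add_double[OF v, of "m div 2" "m mod 2"] by simp
  also have "\<dots> = (LINT x|lborel. (\<Sum>c | length c = m mod 2. partial_deriv c ((lap ^^ (m div 2)) v) x *
      partial_deriv c ((lap ^^ (m div 2)) v) x))"
    unfolding energy_def power2_eq_square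
    by (rule Bochner_Integration.integral_sum[symmetric])
      (intro test_mult_integrable[of _ _ \<Omega>] smooth_partial_deriv smooth_lap_funpow test_smooth[OF v]
        test_partial_deriv test_lap_funpow v)
  finally show ?thesis
    by (simp add: nabla_inner_partial_deriv)
qed

text \<open>Compact support of \<open>v\<close> alone removes the boundary terms; \<open>u\<close>
  will later be a function that does not vanish near the sphere. Laplacians move across without
  sign, so the sign is (-1)^(m mod 2) = (-1)^m.\<close>

lemma integral_nabla_inner_by_parts:
  assumes u: "smooth u" and v: "v \<in> test_functions \<Omega>"
  shows "(LINT x|lborel. nabla_inner partial_deriv m u v x) = (-1) ^ m * (LINT x|lborel. (lap ^^ m) u x * v x)"
proof -
  define k r where "k = m div 2" and "r = m mod 2"
  have m: "m = 2 * k + r" by (simp add: k_def r_def)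
  have lap1: "(LINT x|lborel. f x * lap \<phi> x) = (LINT x|lborel. lap f x * \<phi> x)"
    if f: "smooth f" and \<phi>: "\<phi> \<in> test_functions \<Omega>" for f \<phi>
  proof -
    have "(LINT x|lborel. f x * pd i (pd i \<phi>) x) = (LINT x|lborel. pd i (pd i f) x * \<phi> x)" for i
      using integral_by_parts[OF f \<phi>, of "[i, i]"] by simp
    then show ?thesis
      unfolding lap_def sum_distrib_left sum_distrib_right
      by (subst (1 2) Bochner_Integration.integral_sum)
        (auto intro!: test_mult_integrable[of _ _ \<Omega>] f \<phi> smooth_pd test_pd)
  qed
  have lapk: "(LINT x|lborel. f x * (lap ^^ j) \<phi> x) = (LINT x|lborel. (lap ^^ j) f x * \<phi> x)"
    if f: "smooth f" and \<phi>: "\<phi> \<in> test_functions \<Omega>" for f \<phi> j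
    using f
  proof (induction j arbitrary: f)
    case (Suc j)
    then show ?case
      using lap1[OF Suc.prems test_lap_funpow[OF \<phi>, of j]] Suc.IH[OF smooth_lap[OF Suc.prems]]
      by (simp add: funpow_swap1)
  qed simp
  have 1: "(LINT x|lborel. partial_deriv c ((lap ^^ k) u) x * partial_deriv c ((lap ^^ k) v) x) =
     (-1) ^ r * (LINT x|lborel. partial_deriv c (partial_deriv c ((lap ^^ (2 * k)) u)) x * v x)"
    if "length c = r" for c
  proof -
    have "(LINT x|lborel. partial_deriv c ((lap ^^ k) u) x * partial_deriv c ((lap ^^ k) v) x) =
      (-1) ^ r * (LINT x|lborel. partial_deriv c (partial_deriv c ((lap ^^ k) u)) x * (lap ^^ k) v x)"
      using that integral_by_parts[of "partial_deriv c ((lap ^^ k) u)" "(lap ^^ k) v" \<Omega> c]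
      by (simp add: u v smooth_lap_funpow smooth_partial_deriv test_lap_funpow)
    also have "(LINT x|lborel. partial_deriv c (partial_deriv c ((lap ^^ k) u)) x * (lap ^^ k) v x) =
      (LINT x|lborel. (lap ^^ k) (partial_deriv c (partial_deriv c ((lap ^^ k) u))) x * v x)"
      by (rule lapk) (intro smooth_partial_deriv smooth_lap_funpow u v)+
    also have "(lap ^^ k) (partial_deriv c (partial_deriv c ((lap ^^ k) u))) =
      partial_deriv c (partial_deriv c ((lap ^^ (2 * k)) u))"
      by (simp add: u smooth_lap_funpow smooth_partial_deriv partial_deriv_lap_funpow[symmetric]
          mult_2 funpow_add)
    finally show ?thesis .
  qed
  have "(LINT x|lborel. nabla_inner partial_deriv m u v x) =
    (\<Sum>c | length c = r. LINT x|lborel. partial_deriv c ((lap ^^ k) u) x * partial_deriv c ((lap ^^ k) v) x)"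
    unfolding nabla_inner_partial_deriv k_def[symmetric] r_def[symmetric]
    by (rule Bochner_Integration.integral_sum)
      (intro test_mult_integrable[of _ _ \<Omega>] smooth_partial_deriv smooth_lap_funpow u
        test_partial_deriv test_lap_funpow v)
  also have "\<dots> = (\<Sum>c | length c = r. (-1) ^ r *
      (LINT x|lborel. partial_deriv c (partial_deriv c ((lap ^^ (2 * k)) u)) x * v x))"
    by (rule sum.cong[OF refl], rule 1) simp
  also have "\<dots> = (-1) ^ m * (LINT x|lborel. (lap ^^ m) u x * v x)"
  proof (cases "even m")
    case True
    then have r: "r = 0" by (simp add: r_def)
    then have "m = 2 * k" using m by simp
    with r show ?thesis by simp
  next
    case False
    then have r: "r = Suc 0" by (simp add: r_def mod_2_eq_odd)
    have sm: "smooth ((lap ^^ (2 * k)) u)" by (intro smooth_lap_funpow u)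
    have "(lap ^^ m) u x * v x = (\<Sum>i\<in>UNIV. pd i (pd i ((lap ^^ (2 * k)) u)) x * v x)" for x
      by (simp add: m r lap_def sum_distrib_right)
    then have "(LINT x|lborel. (lap ^^ m) u x * v x) =
       (\<Sum>i\<in>UNIV. LINT x|lborel. pd i (pd i ((lap ^^ (2 * k)) u)) x * v x)"
      using test_mult_integrable[OF _ v] sm by (simp add: smooth_pd Bochner_Integration.integral_sum)
    then show ?thesis using False
      by (simp add: r sum_lists_Suc sum_negf del: length_0_conv) simp
  qed
  finally show ?thesis .
qed

lemma test_eq_0:
  assumes "\<phi> \<in> test_functions \<Omega>" "x \<notin> \<Omega>"
  shows "\<phi> x = 0"
  using assms closure_subset[of "{x. \<phi> x \<noteq> 0}"] by (auto simp: test_functions_def)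

text \<open>Since the derivative of the coordinate x_i is 1, integrating v^2 by parts gives -2 times
  the integral of x_i v (pd i v). With |x_i| at most \<open>R\<close> on \<Omega>, Cauchy-Schwarz
  leaves one factor \<open>l2 lborel v\<close> to cancel.\<close>

lemma poincare:
  assumes v: "v \<in> test_functions \<Omega>" and R: "\<And>x. x \<in> \<Omega> \<Longrightarrow> norm x \<le> R" "R \<ge> 0"
  shows "l2 lborel v \<le> 2 * R * l2 lborel (pd i v)"
proof -
  have s: "smooth v" by (rule test_smooth[OF v])
  have "(LINT x|lborel. x $ i * pd i (\<lambda>x. v x * v x) x) = - (LINT x|lborel. pd i (\<lambda>x. x $ i) x * (v x * v x))"
    by (intro integral_by_parts_pd[where \<Omega>=\<Omega>] smooth_nth test_mult s v)
  moreover have "pd i (\<lambda>x. v x * v x) = (\<lambda>x. v x * pd i v x + pd i v x * v x)"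
    using s by (intro ext pd_mult smooth_differentiable)
  ultimately have "(LINT x|lborel. (v x)\<^sup>2) = - (LINT x|lborel. 2 * ((x $ i * pd i v x) * v x))"
    by (simp add: pd_nth power2_eq_square algebra_simps)
  then have eq: "(LINT x|lborel. (v x)\<^sup>2) = - 2 * (LINT x|lborel. (x $ i * pd i v x) * v x)"
    by (simp add: mult.assoc)
  have z: "pd i v x = 0" if "x \<notin> \<Omega>" for x
    using test_pd[OF v] that by (rule test_eq_0)
  have ae: "l2 lborel (\<lambda>x. x $ i * pd i v x) \<le> R * l2 lborel (pd i v)"
  proof -
    have x_eq: "(LINT x|lborel. (x $ i * pd i v x)\<^sup>2) \<le> (LINT x|lborel. R\<^sup>2 * (pd i v x)\<^sup>2)"
    proof (rule integral_mono)
      have "(\<lambda>x. x $ i * pd i v x) \<in> test_functions \<Omega>"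
        by (intro test_mult smooth_nth test_pd v)
      from test_sqint[OF this] show "integrable lborel (\<lambda>x. (x $ i * pd i v x)\<^sup>2)"
        by (simp add: sqint_def)
      show "integrable lborel (\<lambda>x. R\<^sup>2 * (pd i v x)\<^sup>2)"
        using test_sqint[OF test_pd[OF v, of i]] by (simp add: sqint_def)
      show "(x $ i * pd i v x)\<^sup>2 \<le> R\<^sup>2 * (pd i v x)\<^sup>2" for x
      proof (cases "x \<in> \<Omega>")
        case True
        then have "\<bar>x $ i\<bar>\<^sup>2 \<le> R\<^sup>2"
          using R component_le_norm_cart[of x i] by (intro power_mono) (auto intro: order_trans)
        then show ?thesis by (simp add: power_mult_distrib mult_right_mono)
      qed (simp add: z)
    qed
    then have "l2 lborel (\<lambda>x. x $ i * pd i v x) \<le> sqrt (R\<^sup>2 * (LINT x|lborel. (pd i v x)\<^sup>2))"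
      by (simp add: l2_def)
    then show ?thesis
      using R(2) by (simp add: l2_def real_sqrt_mult)
  qed
  have "(l2 lborel v)\<^sup>2 \<le> 2 * \<bar>LINT x|lborel. (x $ i * pd i v x) * v x\<bar>"
    unfolding l2_power2 eq by linarith
  also have "\<dots> \<le> 2 * (l2 lborel (\<lambda>x. x $ i * pd i v x) * l2 lborel v)"
    by (intro mult_left_mono l2_Cauchy_Schwarz test_sqint[of _ \<Omega>] test_mult smooth_nth test_pd v) simp
  also have "\<dots> \<le> 2 * ((R * l2 lborel (pd i v)) * l2 lborel v)"
    by (intro mult_left_mono mult_right_mono ae) auto
  finally have "l2 lborel v * l2 lborel v \<le> (2 * R * l2 lborel (pd i v)) * l2 lborel v"
    by (simp add: power2_eq_square algebra_simps)
  then show ?thesis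
    using R(2) l2_nonneg[of lborel v] by (cases "l2 lborel v = 0") auto
qed

text \<open>The Poincare inequality in one fixed direction \<open>i0\<close> is enough: prefixing
  \<open>i0\<close> maps the lists of length \<open>k\<close> into those of length
  \<open>Suc k\<close>.\<close>

lemma energy_le_Suc:
  fixes v :: "real^'n \<Rightarrow> real"
  assumes v: "v \<in> test_functions \<Omega>" and R: "\<And>x. x \<in> \<Omega> \<Longrightarrow> norm x \<le> R" "R \<ge> 0"
  shows "energy k v \<le> (2 * R)\<^sup>2 * energy (Suc k) v"
proof -
  fix i0 :: 'n
  have "(LINT x|lborel. (partial_deriv is v x)\<^sup>2) \<le> (2 * R)\<^sup>2 * (LINT x|lborel. (pd i0 (partial_deriv is v) x)\<^sup>2)" for "is"
  proof -
    have "(l2 lborel (partial_deriv is v))\<^sup>2 \<le> (2 * R * l2 lborel (pd i0 (partial_deriv is v)))\<^sup>2"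
      by (intro power_mono poincare[OF test_partial_deriv[OF v] R]) auto
    then show ?thesis by (simp add: l2_power2 power_mult_distrib)
  qed
  then have "energy k v \<le> (2 * R)\<^sup>2 * (\<Sum>is | length is = k. LINT x|lborel. (pd i0 (partial_deriv is v) x)\<^sup>2)"
    unfolding energy_def sum_distrib_left by (intro sum_mono)
  also have "(\<Sum>is | length is = k. LINT x|lborel. (pd i0 (partial_deriv is v) x)\<^sup>2) \<le>
     (\<Sum>i\<in>UNIV. \<Sum>is | length is = k. LINT x|lborel. (pd i (partial_deriv is v) x)\<^sup>2)"
    by (rule member_le_sum) (auto intro!: sum_nonneg)
  finally show ?thesis
    by (simp add: energy_def sum_lists_Suc mult_left_mono)
qed

lemma energy_le_energy:
  assumes v: "v \<in> test_functions \<Omega>" and R: "\<And>x. x \<in> \<Omega> \<Longrightarrow> norm x \<le> R" "R \<ge> 0" and jk: "j \<le> k"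
  shows "energy j v \<le> ((2 * R)\<^sup>2) ^ (k - j) * energy k v"
proof -
  define C where "C = (2 * R)\<^sup>2"
  have C: "0 \<le> C" by (simp add: C_def)
  from jk have "energy j v \<le> C ^ (k - j) * energy k v"
  proof (induction k rule: dec_induct)
    case (step k)
    have "C ^ (k - j) * energy k v \<le> C ^ (k - j) * (C * energy (Suc k) v)"
      using energy_le_Suc[OF v R, of k] C by (intro mult_left_mono) (auto simp: C_def)
    with step show ?case
      by (simp add: Suc_diff_le mult_ac)
  qed simp
  then show ?thesis by (simp add: C_def)
qed

subsection \<open>The fundamental lemma of the calculus of variations\<close>

text \<open>For \<open>p = 0\<close> the profile is exp(-e/t) on the positive axis, which tends to 1
  there as e -> 0. Multiplying over the two face distances in each coordinate gives smooth functions
  tending to the indicator of the open box.\<close>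

lemma box_bumps:
  fixes a b :: "real^'n"
  obtains \<phi> :: "nat \<Rightarrow> real^'n \<Rightarrow> real" where
    "\<And>k. smooth (\<phi> k)" "\<And>k x. x \<notin> cbox a b \<Longrightarrow> \<phi> k x = 0"
    "\<And>k x. 0 \<le> \<phi> k x \<and> \<phi> k x \<le> 1"
    "\<And>x. (\<lambda>k. \<phi> k x) \<longlonglongrightarrow> indicator (box a b) x"
proof
  define \<phi> where "\<phi> k x = (\<Prod>i\<in>UNIV. flat 0 (1 / real (Suc k)) (x $ i - a $ i) *
    flat 0 (1 / real (Suc k)) (b $ i - x $ i))" for k :: nat and x :: "real^'n"
  show "smooth (\<phi> k)" for k
    unfolding \<phi>_def by (intro smooth_prod smooth_mult smooth_flat smooth_diff smooth_nth smooth_const) auto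
  show "\<phi> k x = 0" if x: "x \<notin> cbox a b" for k x
  proof -
    obtain i where "\<not> (a $ i \<le> x $ i \<and> x $ i \<le> b $ i)"
      using x unfolding mem_box_cart by blast
    then have "flat 0 (1 / real (Suc k)) (x $ i - a $ i) * flat 0 (1 / real (Suc k)) (b $ i - x $ i) = 0"
      by (auto simp: flat_def)
    then show ?thesis
      unfolding \<phi>_def by (intro prod_zero) auto
  qed
  have flat01: "0 \<le> flat 0 (1 / real (Suc k)) t \<and> flat 0 (1 / real (Suc k)) t \<le> 1" for k t
    by (auto simp: flat_def)
  show "0 \<le> \<phi> k x \<and> \<phi> k x \<le> 1" for k x
    unfolding \<phi>_def using flat01 by (auto intro!: prod_nonneg prod_le_1 mult_nonneg_nonneg mult_le_one)
  have flat_lim: "(\<lambda>k. flat 0 (1 / real (Suc k)) t) \<longlonglongrightarrow> (if t > 0 then 1 else 0)" for t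
  proof (cases "t > 0")
    case True
    have "(\<lambda>k. 1 / real (Suc k)) \<longlonglongrightarrow> 0" by (rule LIMSEQ_Suc) (rule lim_1_over_n)
    then have "(\<lambda>k. exp (- (1 / real (Suc k)) / t)) \<longlonglongrightarrow> exp (- 0 / t)"
      using True by (intro tendsto_intros) auto
    then show ?thesis using True by (simp add: flat_def)
  qed (simp add: flat_def)
  show "(\<lambda>k. \<phi> k x) \<longlonglongrightarrow> indicator (box a b) x" for x
  proof -
    have "(\<lambda>k. \<phi> k x) \<longlonglongrightarrow> (\<Prod>i\<in>UNIV. (if x $ i - a $ i > 0 then 1 else 0) * (if b $ i - x $ i > 0 then 1 else 0))"
      unfolding \<phi>_def by (intro tendsto_prod tendsto_mult flat_lim)
    also have "(\<Prod>i\<in>UNIV. (if x $ i - a $ i > 0 then 1 else 0) * (if b $ i - x $ i > 0 then 1 else 0)) =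
       (indicator (box a b) x :: real)"
    proof (cases "x \<in> box a b")
      case True
      then show ?thesis by (auto simp: mem_box_cart intro!: prod.neutral)
    next
      case False
      then obtain i where "\<not> (a $ i < x $ i \<and> x $ i < b $ i)"
        unfolding mem_box_cart by blast
      then show ?thesis using False
        by (auto intro!: prod_zero bexI[of _ i])
    qed
    finally show ?thesis .
  qed
qed

lemma box_Int_box_cart:
  fixes a b c d :: "real^'n"
  shows "box a b \<inter> box c d = box (\<chi> i. max (a $ i) (c $ i)) (\<chi> i. min (b $ i) (d $ i))"
  by (auto simp: set_eq_iff mem_box_cart)

text \<open>Open boxes generate the Borel sets and are stable under intersection, so by Dynkin's
  theorem all Borel integrals of \<open>f\<close> vanish, and a density is determined by
  these.\<close>

lemma AE_zero_if_box_integrals_zero: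
  fixes f :: "real^'n \<Rightarrow> real"
  assumes f: "integrable lborel f"
    and z: "\<And>a b. (LINT x|lborel. indicator (box a b) x * f x) = 0"
  shows "AE x in lborel. f x = 0"
proof -
  have int: "integrable lborel (\<lambda>x. indicator A x * f x)" if "A \<in> sets borel" for A
    using integrable_mult_indicator[of A lborel f] f that by simp
  \<comment> \<open>The integral over the whole space comes first, from exhausting boxes: the
    complement step of the Dynkin argument subtracts from it.\<close>
  have f0: "integral\<^sup>L lborel f = 0"
  proof -
    have "(\<lambda>k. LINT x|lborel. indicator (box (\<chi> i. - real k) (\<chi> i. real k)) x * f x) \<longlonglongrightarrow> integral\<^sup>L lborel f"
    proof (rule integral_dominated_convergence[where w="\<lambda>x. \<bar>f x\<bar>"])
      show "AE x in lborel. (\<lambda>k. indicator (box (\<chi> i. - real k) (\<chi> i. real k)) x * f x) \<longlonglongrightarrow> f x"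
      proof (rule AE_I2)
        fix x :: "real^'n"
        obtain N :: nat where N: "norm x < real N" using reals_Archimedean2 by blast
        have "\<forall>\<^sub>F k in sequentially. indicator (box (\<chi> i. - real k) (\<chi> i. real k)) x * f x = f x"
        proof (rule eventually_sequentiallyI[of N])
          fix k assume "k \<ge> N"
          then have "\<bar>x $ i\<bar> < real k" for i
            using N component_le_norm_cart[of x i] by (meson le_less_trans less_le_trans of_nat_mono)
          then have "x \<in> box (\<chi> i. - real k) (\<chi> i. real k)"
            by (auto simp: mem_box_cart abs_less_iff minus_less_iff)
          then show "indicator (box (\<chi> i. - real k) (\<chi> i. real k)) x * f x = f x" by simp
        qed
        then show "(\<lambda>k. indicator (box (\<chi> i. - real k) (\<chi> i. real k)) x * f x) \<longlonglongrightarrow> f x"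
          by (rule tendsto_eventually)
      qed
    qed (use f in \<open>auto simp: indicator_def\<close>)
    then have "(\<lambda>k::nat. 0::real) \<longlonglongrightarrow> integral\<^sup>L lborel f"
      by (simp only: z)
    then show ?thesis
      using LIMSEQ_unique[OF tendsto_const] by metis
  qed
  have gen: "sets (borel :: (real^'n) measure) = sigma_sets UNIV (range (\<lambda>(a, b). box a b))"
    unfolding borel_eq_box by simp
  have "(LINT x|lborel. indicator A x * f x) = 0" if "A \<in> sets borel" for A
  proof (rule sigma_sets_induct_disjoint[where G="range (\<lambda>(a, b). box a b)" and \<Omega>=UNIV and A=A])
    show "Int_stable (range (\<lambda>(a, b). box a b :: (real^'n) set))"
      by (auto simp: Int_stable_def box_Int_box_cart)
    show "A \<in> sigma_sets UNIV (range (\<lambda>(a, b). box a b))"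
      using that by (simp only: gen)
    fix A :: "(real^'n) set"
    assume *: "A \<in> sigma_sets UNIV (range (\<lambda>(a, b). box a b))" "(LINT x|lborel. indicator A x * f x) = 0"
    then have A: "A \<in> sets borel" by (simp only: gen)
    have "(\<lambda>x. indicator (UNIV - A) x * f x) = (\<lambda>x. f x - indicator A x * f x)"
      by (auto simp: fun_eq_iff indicator_def)
    then show "(LINT x|lborel. indicator (UNIV - A) x * f x) = 0"
      using f int[OF A] f0 * by simp
  next
    fix A :: "nat \<Rightarrow> (real^'n) set"
    assume *: "disjoint_family A" "range A \<subseteq> sigma_sets UNIV (range (\<lambda>(a, b). box a b))"
      "\<And>i. (LINT x|lborel. indicator (A i) x * f x) = 0"
    then have A: "A i \<in> sets borel" for i by (simp only: gen) blast
    have "set_lebesgue_integral lborel (\<Union>i. A i) f = (\<Sum>i. set_lebesgue_integral lborel (A i) f)"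
      using * A int[of "\<Union>i. A i"]
      by (intro lebesgue_integral_countable_add) (auto simp: disjoint_family_on_def set_integrable_def)
    then show "(LINT x|lborel. indicator (\<Union>i. A i) x * f x) = 0"
      using * by (simp add: set_lebesgue_integral_def)
  qed (use z in auto)
  then have "set_lebesgue_integral lborel A f = set_lebesgue_integral lborel A (\<lambda>x. 0)"
    if "A \<in> sets lborel" for A
    using that by (simp add: set_lebesgue_integral_def)
  then show ?thesis
    by (intro density_unique_real f) auto
qed

section \<open>Locally integrable functions and weak derivatives\<close>

text \<open>Completeness of Lebesgue measure. Functions built from \<open>weak_deriv\<close> are
  known only up to null sets, and this is how their measurability is obtained.\<close>

lemma borel_measurable_lebesgue_on_AE:
  fixes f g :: "'a::euclidean_space \<Rightarrow> real"
  assumes S: "S \<in> sets lebesgue" and f: "f \<in> borel_measurable (lebesgue_on S)"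
    and ae: "AE x in lebesgue_on S. f x = g x"
  shows "g \<in> borel_measurable (lebesgue_on S)"
proof -
  have "(\<lambda>x. if x \<in> S then f x else 0) \<in> borel_measurable lebesgue"
    using f S by (simp add: borel_measurable_if)
  moreover have "AE x in lebesgue. (if x \<in> S then f x else 0) = (if x \<in> S then g x else 0)"
    using ae S by (simp add: AE_restrict_space_iff)
  ultimately have "(\<lambda>x. if x \<in> S then g x else 0) \<in> borel_measurable lebesgue"
    by (rule borel_measurable_AE)
  then show ?thesis
    using S by (simp add: borel_measurable_if)
qed

lemma integrable_lebesgue_on_subset:
  fixes f :: "'a::euclidean_space \<Rightarrow> real"
  assumes "integrable (lebesgue_on S) f" "S \<in> sets lebesgue" "T \<in> sets lebesgue" "T \<subseteq> S"
  shows "integrable (lebesgue_on T) f"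
proof -
  have "set_integrable lebesgue S f"
    using assms by (simp add: set_integrable_def integrable_restrict_space)
  then have "set_integrable lebesgue T f"
    using assms(3,4) by (rule set_integrable_subset)
  then show ?thesis
    using assms by (simp add: set_integrable_def integrable_restrict_space)
qed

lemma AE_lebesgue_on_mono:
  assumes "AE x in lebesgue_on S. P x" "S \<in> sets lebesgue" "T \<in> sets lebesgue" "T \<subseteq> S"
  shows "AE x in lebesgue_on T. P x"
  using assms by (simp add: AE_restrict_space_iff) (auto elim!: eventually_mono)

lemma compact_sets_lebesgue: "compact K \<Longrightarrow> K \<in> sets lebesgue"
  by (intro fmeasurableD lmeasurable_compact)

locale bounded_domain =
  fixes \<Omega> :: "(real^'n) set"
  assumes open_domain: "open \<Omega>" and bounded_domain: "bounded \<Omega>"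
begin

abbreviation "\<mu> \<equiv> lebesgue_on \<Omega>"

lemma domain_sets [simp, measurable]: "\<Omega> \<in> sets lebesgue"
  using open_domain by simp

sublocale finite_measure \<mu>
  using open_domain bounded_domain by (intro finite_measure_lebesgue_on lmeasurable_open)

lemma integrable_iff: "integrable \<mu> f \<longleftrightarrow> integrable lebesgue (\<lambda>x. indicator \<Omega> x * f x)"
  for f :: "real^'n \<Rightarrow> real"
  by (simp add: integrable_restrict_space)

lemma integral_eq: "(LINT x|\<mu>. f x) = (LINT x|lebesgue. indicator \<Omega> x * f x)"
  for f :: "real^'n \<Rightarrow> real"
  by (simp add: integral_restrict_space)

lemma AE_iff: "(AE x in \<mu>. P x) \<longleftrightarrow> (AE x in lebesgue. x \<in> \<Omega> \<longrightarrow> P x)"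
  by (simp add: AE_restrict_space_iff)

lemma integral_eq_lborel:
  fixes f :: "real^'n \<Rightarrow> real"
  assumes "f \<in> borel_measurable borel" "\<And>x. x \<notin> \<Omega> \<Longrightarrow> f x = 0"
  shows "(LINT x|\<mu>. f x) = (LINT x|lborel. f x)"
proof -
  have "(\<lambda>x. indicator \<Omega> x * f x) = f"
    using assms(2) by (auto simp: fun_eq_iff indicator_def)
  then show ?thesis
    using assms(1) by (simp add: integral_eq integral_completion)
qed

lemma borel_measurable_domain: "f \<in> borel_measurable borel \<Longrightarrow> f \<in> borel_measurable \<mu>"
  by (simp add: measurable_completion measurable_restrict_space1)

lemma smooth_measurable: "smooth f \<Longrightarrow> f \<in> borel_measurable \<mu>"
  by (intro borel_measurable_domain smooth_borel)

lemma smooth_bounded: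
  assumes "smooth f"
  obtains B where "B \<ge> 0" "\<And>x. x \<in> \<Omega> \<Longrightarrow> \<bar>f x\<bar> \<le> B"
proof -
  have "compact (f ` closure \<Omega>)"
    using assms bounded_domain by (intro compact_continuous_image smooth_continuous_on) auto
  then obtain B where "\<And>y. y \<in> f ` closure \<Omega> \<Longrightarrow> \<bar>y\<bar> \<le> B"
    using compact_imp_bounded bounded_iff by (metis real_norm_def)
  then have "\<bar>f x\<bar> \<le> max B 0" if "x \<in> \<Omega>" for x
    using that closure_subset[of \<Omega>] by (fastforce simp: le_max_iff_disj)
  then show ?thesis using that[of "max B 0"] by simp
qed

lemma smooth_sqint:
  assumes "smooth f"
  shows "sqint \<mu> f"
proof -
  obtain B where "\<And>x. x \<in> \<Omega> \<Longrightarrow> \<bar>f x\<bar> \<le> B"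
    using smooth_bounded[OF assms] by blast
  then show ?thesis
    by (intro sqint_bounded[of _ _ B] smooth_measurable assms) (auto intro: finite_measure_axioms)
qed

lemma sqint_locally_integrable: "sqint \<mu> f \<Longrightarrow> locally_integrable \<Omega> f"
  unfolding locally_integrable_def
  by (auto intro: integrable_lebesgue_on_subset[OF sqint_integrable(1)] compact_sets_lebesgue)

lemma countable_cboxes:
  obtains D :: "(real^'n) set set" where "countable D" "\<Union>D = \<Omega>"
    "\<And>X. X \<in> D \<Longrightarrow> X \<subseteq> \<Omega> \<and> (\<exists>a b. X = cbox a b)"
proof -
  obtain D where "countable D" "D \<subseteq> Pow \<Omega>" "\<And>X. X \<in> D \<Longrightarrow> \<exists>a b. X = cbox a b" "\<Union>D = \<Omega>"
    using open_countable_Union_open_cbox[OF open_domain] by metis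
  then show ?thesis
    by (intro that[of D]) auto
qed

text \<open>Local integrability speaks about compact subsets only; countably many closed boxes
  exhaust the open set, and measurability is glued from them.\<close>

lemma locally_integrable_measurable:
  assumes "locally_integrable \<Omega> f"
  shows "f \<in> borel_measurable \<mu>"
proof -
  obtain D where D: "countable D" "\<Union>D = \<Omega>"
    "\<And>X. X \<in> D \<Longrightarrow> X \<subseteq> \<Omega> \<and> (\<exists>a b. X = cbox a b)"
    using countable_cboxes by blast
  show ?thesis
  proof (rule measurable_piecewise_restrict[OF D(1)])
    show "X \<inter> space \<mu> \<in> sets \<mu>" if "X \<in> D" for X
      using D(3)[OF that] by (auto simp: sets_restrict_space)
    show "space \<mu> \<subseteq> \<Union>D" by (simp add: D(2))
    show "f \<in> borel_measurable (restrict_space \<mu> X)" if X: "X \<in> D" for X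
    proof -
      have "X \<subseteq> \<Omega>" "compact X" "X \<in> sets lebesgue" using D(3)[OF X] by auto
      then have "integrable (lebesgue_on X) f"
        using assms by (auto simp: locally_integrable_def)
      moreover have "restrict_space \<mu> X = lebesgue_on X"
        using \<open>X \<subseteq> \<Omega>\<close> \<open>X \<in> sets lebesgue\<close> by (simp add: restrict_restrict_space Int_absorb1)
      ultimately show ?thesis by auto
    qed
  qed
qed

lemma locally_integrable_cong_AE:
  assumes f: "locally_integrable \<Omega> f" and ae: "AE x in \<mu>. f x = g x"
  shows "locally_integrable \<Omega> g"
  unfolding locally_integrable_def
proof (intro allI impI, elim conjE)
  fix K assume K: "compact K" "K \<subseteq> \<Omega>"
  then have Ks: "K \<in> sets lebesgue" by (simp add: compact_sets_lebesgue)
  have fK: "integrable (lebesgue_on K) f" using f K by (auto simp: locally_integrable_def)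
  have aeK: "AE x in lebesgue_on K. f x = g x"
    using AE_lebesgue_on_mono[OF ae domain_sets Ks K(2)] .
  then have "g \<in> borel_measurable (lebesgue_on K)"
    using fK by (intro borel_measurable_lebesgue_on_AE[OF Ks _ aeK]) auto
  then show "integrable (lebesgue_on K) g"
    by (rule integrable_cong_AE_imp[OF fK _ aeK])
qed

lemma locally_integrable_add:
  "locally_integrable \<Omega> f \<Longrightarrow> locally_integrable \<Omega> g \<Longrightarrow> locally_integrable \<Omega> (\<lambda>x. f x + g x)"
  by (auto simp: locally_integrable_def)

lemma locally_integrable_cmult: "locally_integrable \<Omega> f \<Longrightarrow> locally_integrable \<Omega> (\<lambda>x. c * f x)"
  by (auto simp: locally_integrable_def)

lemma locally_integrable_mult_test:
  assumes w: "locally_integrable \<Omega> w" and \<phi>: "\<phi> \<in> test_functions \<Omega>"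
  shows "integrable \<mu> (\<lambda>x. w x * \<phi> x)"
proof -
  obtain K where K: "compact K" "K \<subseteq> \<Omega>" "\<And>x. x \<notin> K \<Longrightarrow> \<phi> x = 0"
    by (rule test_functionsE[OF \<phi>]) metis
  obtain B where B: "\<And>x. \<bar>\<phi> x\<bar> \<le> B"
    using test_bounded[OF \<phi>] by blast
  have Ks: "K \<in> sets lebesgue" using K by (simp add: compact_sets_lebesgue)
  have "integrable (lebesgue_on K) w"
    using w K by (auto simp: locally_integrable_def)
  then have wK: "integrable lebesgue (\<lambda>x. indicator K x * w x)"
    using Ks by (simp add: integrable_restrict_space)
  have "integrable lebesgue (\<lambda>x. (indicator K x * w x) * \<phi> x)"
  proof (rule Bochner_Integration.integrable_bound[of _ "\<lambda>x. B * (indicator K x * w x)"])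
    show "integrable lebesgue (\<lambda>x. B * (indicator K x * w x))" using wK by simp
    show "(\<lambda>x. (indicator K x * w x) * \<phi> x) \<in> borel_measurable lebesgue"
      by (rule borel_measurable_times[OF borel_measurable_integrable[OF wK]])
        (simp add: measurable_completion smooth_borel[OF test_smooth[OF \<phi>]])
    have "\<bar>indicator K x * w x\<bar> * \<bar>\<phi> x\<bar> \<le> \<bar>indicator K x * w x\<bar> * \<bar>B\<bar>" for x
      using B[of x] by (intro mult_left_mono) auto
    then show "AE x in lebesgue. norm ((indicator K x * w x) * \<phi> x) \<le> norm (B * (indicator K x * w x))"
      by (simp add: abs_mult mult_ac)
  qed
  also have "(\<lambda>x. (indicator K x * w x) * \<phi> x) = (\<lambda>x. indicator \<Omega> x * (w x * \<phi> x))"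
    using K by (auto simp: fun_eq_iff indicator_def)
  finally show ?thesis
    by (simp add: integrable_iff)
qed

text \<open>Testing with bumps that tend to the indicator of a box shows that \<open>w\<close> has
  integral zero over every box compactly inside \<Omega>. Box faces are null sets, and countably
  many boxes cover \<Omega>.\<close>

lemma fundamental_lemma:
  assumes w: "locally_integrable \<Omega> w"
    and z: "\<And>\<phi>. \<phi> \<in> test_functions \<Omega> \<Longrightarrow> (LINT x|\<mu>. w x * \<phi> x) = 0"
  shows "AE x in \<mu>. w x = 0"
proof -
  obtain D where D: "countable D" "\<Union>D = \<Omega>"
    "\<And>X. X \<in> D \<Longrightarrow> X \<subseteq> \<Omega> \<and> (\<exists>a b. X = cbox a b)"
    using countable_cboxes by blast
  \<comment> \<open>The argument is local: on a closed box inside \<Omega> the function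
    \<open>w\<close> is integrable, which provides the majorant for dominated convergence.\<close>
  have main: "AE x in lebesgue. x \<in> box c d \<longrightarrow> w x = 0" if cd: "cbox c d \<subseteq> \<Omega>" for c d
  proof -
    have "integrable (lebesgue_on (cbox c d)) w"
      using w cd by (auto simp: locally_integrable_def)
    then have wK: "integrable lebesgue (\<lambda>x. indicator (cbox c d) x * w x)"
      by (simp add: integrable_restrict_space)
    have zero: "(LINT x|lebesgue. indicator (box a b) x * w x) = 0" if ab: "cbox a b \<subseteq> cbox c d" for a b
    proof -
      obtain \<phi> where \<phi>: "\<And>k. smooth (\<phi> k)" "\<And>k x. x \<notin> cbox a b \<Longrightarrow> \<phi> k x = (0::real)"
        "\<And>k x. 0 \<le> \<phi> k x \<and> \<phi> k x \<le> 1"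
        "\<And>x. (\<lambda>k. \<phi> k x) \<longlonglongrightarrow> indicator (box a b) x"
        using box_bumps[of a b] by metis
      have test: "\<phi> k \<in> test_functions \<Omega>" for k
        by (rule test_functionsI[of _ "cbox a b"]) (use \<phi> ab cd in auto)
      have eq: "(\<lambda>x. indicator \<Omega> x * (w x * \<phi> k x)) = (\<lambda>x. indicator (cbox c d) x * w x * \<phi> k x)" for k
        using \<phi>(2) ab cd by (fastforce simp: fun_eq_iff indicator_def)
      have "(\<lambda>k. LINT x|lebesgue. indicator (cbox c d) x * w x * \<phi> k x) \<longlonglongrightarrow>
          (LINT x|lebesgue. indicator (cbox c d) x * w x * indicator (box a b) x)"
      proof (rule integral_dominated_convergence[where w="\<lambda>x. \<bar>indicator (cbox c d) x * w x\<bar>"])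
        show "(\<lambda>x. indicator (cbox c d) x * w x * indicator (box a b) x) \<in> borel_measurable lebesgue"
          by (rule borel_measurable_times[OF borel_measurable_integrable[OF wK]])
            (simp add: borel_measurable_indicator)
        show "(\<lambda>x. indicator (cbox c d) x * w x * \<phi> k x) \<in> borel_measurable lebesgue" for k
          by (rule borel_measurable_times[OF borel_measurable_integrable[OF wK]])
            (simp add: measurable_completion smooth_borel[OF \<phi>(1)])
        show "AE x in lebesgue. (\<lambda>k. indicator (cbox c d) x * w x * \<phi> k x) \<longlonglongrightarrow>
          indicator (cbox c d) x * w x * indicator (box a b) x"
          by (intro AE_I2 tendsto_intros \<phi>(4))
        show "AE x in lebesgue. norm (indicator (cbox c d) x * w x * \<phi> k x) \<le> \<bar>indicator (cbox c d) x * w x\<bar>" for k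
          using \<phi>(3) by (intro AE_I2) (auto simp: abs_mult mult_left_le)
      qed (use wK in auto)
      moreover have "(LINT x|lebesgue. indicator (cbox c d) x * w x * \<phi> k x) = 0" for k
        using z[OF test[of k]] by (simp add: integral_eq eq)
      ultimately have "(\<lambda>k::nat. 0::real) \<longlonglongrightarrow> (LINT x|lebesgue. indicator (cbox c d) x * w x * indicator (box a b) x)"
        by simp
      then have "(LINT x|lebesgue. indicator (cbox c d) x * w x * indicator (box a b) x) = 0"
        using LIMSEQ_unique[OF tendsto_const] by metis
      moreover have "(\<lambda>x. indicator (cbox c d) x * w x * indicator (box a b) x) = (\<lambda>x. indicator (box a b) x * w x)"
        using ab box_subset_cbox[of a b] by (fastforce simp: fun_eq_iff indicator_def)
      ultimately show ?thesis by simp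
    qed
    define f where "f x = indicator (box c d) x * w x" for x
    have "integrable lebesgue (\<lambda>x. indicator (box c d) x *\<^sub>R (indicator (cbox c d) x * w x))"
      using wK by (intro integrable_mult_indicator) auto
    also have "(\<lambda>x. indicator (box c d) x *\<^sub>R (indicator (cbox c d) x * w x)) = f"
      using box_subset_cbox[of c d] by (auto simp: fun_eq_iff indicator_def f_def)
    finally have f_int: "integrable lebesgue f" .
    \<comment> \<open>A Borel representative, so that the criterion for \<open>lborel\<close>
      applies; the result is carried back to the Lebesgue completion afterwards.\<close>
    obtain f' where f': "f' \<in> borel_measurable lborel" "AE x in lborel. f x = f' x"
      using completion_ex_borel_measurable_real[of f lborel] f_int by auto
    have ff': "AE x in lebesgue. f x = f' x"
      using f'(2) by (rule AE_completion)
    have f'_int: "integrable lebesgue f'"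
      by (rule integrable_cong_AE_imp[OF f_int _ ff']) (use f' in \<open>simp add: measurable_completion\<close>)
    have "AE x in lborel. f' x = 0"
    proof (rule AE_zero_if_box_integrals_zero)
      show "integrable lborel f'"
        using f'_int f'(1) by (simp add: integrable_completion)
      show "(LINT x|lborel. indicator (box a b) x * f' x) = 0" for a b
      proof -
        have "(LINT x|lborel. indicator (box a b) x * f' x) = (LINT x|lebesgue. indicator (box a b) x * f' x)"
          using f'(1) by (intro integral_completion[symmetric]) simp
        also have "\<dots> = (LINT x|lebesgue. indicator (box a b) x * f x)"
          using f'_int f_int ff'
          by (intro integral_cong_AE borel_measurable_times) (auto elim: eventually_mono simp: borel_measurable_indicator)
        also have "(\<lambda>x. indicator (box a b) x * f x) = (\<lambda>x. indicator (box a b \<inter> box c d) x * w x)"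
          by (auto simp: fun_eq_iff indicator_def f_def)
        also have "(LINT x|lebesgue. indicator (box a b \<inter> box c d) x * w x) = 0"
        proof (cases "box a b \<inter> box c d = {}")
          case False
          define a' b' where "a' = (\<chi> i. max (a $ i) (c $ i))" and "b' = (\<chi> i. min (b $ i) (d $ i))"
          have "cbox a' b' \<subseteq> cbox c d"
            by (auto simp: mem_box_cart a'_def b'_def)
          from zero[OF this] show ?thesis
            by (simp add: box_Int_box_cart a'_def b'_def)
        qed simp
        finally show ?thesis .
      qed
    qed
    with f'(2) have "AE x in lborel. f x = 0"
      by eventually_elim simp
    then have "AE x in lebesgue. f x = 0"
      by (rule AE_completion)
    then show ?thesis
      by eventually_elim (auto simp: f_def)
  qed
  have "AE x in lebesgue. \<forall>X\<in>D. x \<in> X \<longrightarrow> w x = 0"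
  proof (rule AE_ball_countable'[OF _ D(1)])
    fix X assume "X \<in> D"
    then obtain c d where X: "X = cbox c d" "cbox c d \<subseteq> \<Omega>"
      using D(3) by blast
    have "AE x in lebesgue. x \<notin> cbox c d - box c d"
      by (rule AE_not_in) (metis negligible_frontier_interval negligible_iff_null_sets)
    with main[OF X(2)] show "AE x in lebesgue. x \<in> X \<longrightarrow> w x = 0"
      by eventually_elim (auto simp: X)
  qed
  then show ?thesis
    unfolding AE_iff by eventually_elim (use D(2) in auto)
qed

subsection \<open>Weak derivatives\<close>

abbreviation wd where "wd \<equiv> is_weak_deriv \<Omega>"
abbreviation "D \<equiv> weak_deriv \<Omega>"
abbreviation "test \<equiv> test_functions \<Omega>"

lemma wdI:
  assumes "locally_integrable \<Omega> u" "locally_integrable \<Omega> w"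
    "\<And>\<phi>. \<phi> \<in> test \<Longrightarrow> (LINT x|\<mu>. u x * partial_deriv is \<phi> x) = (-1) ^ length is * (LINT x|\<mu>. w x * \<phi> x)"
  shows "wd is u w"
  using assms by (simp add: is_weak_deriv_def)

lemma wdD:
  assumes "wd is u w"
  shows "locally_integrable \<Omega> u" "locally_integrable \<Omega> w"
    "\<phi> \<in> test \<Longrightarrow> (LINT x|\<mu>. u x * partial_deriv is \<phi> x) = (-1) ^ length is * (LINT x|\<mu>. w x * \<phi> x)"
  using assms by (simp_all add: is_weak_deriv_def)

lemma wd_unique:
  assumes "wd is u w" "wd is u w'"
  shows "AE x in \<mu>. w x = w' x"
proof -
  have "AE x in \<mu>. w x + (-1) * w' x = 0"
  proof (rule fundamental_lemma)
    show "locally_integrable \<Omega> (\<lambda>x. w x + (-1) * w' x)"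
      using assms wdD by (intro locally_integrable_add locally_integrable_cmult) blast+
    fix \<phi> assume \<phi>: "\<phi> \<in> test"
    have "(-1 :: real) ^ length is * (LINT x|\<mu>. w x * \<phi> x) = (-1) ^ length is * (LINT x|\<mu>. w' x * \<phi> x)"
      using wdD(3)[OF assms(1) \<phi>] wdD(3)[OF assms(2) \<phi>] by simp
    moreover have "(\<lambda>x. (w x + (-1) * w' x) * \<phi> x) = (\<lambda>x. w x * \<phi> x - w' x * \<phi> x)"
      by (simp add: fun_eq_iff algebra_simps)
    ultimately show "(LINT x|\<mu>. (w x + (-1) * w' x) * \<phi> x) = 0"
      using locally_integrable_mult_test[OF wdD(2)[OF assms(1)] \<phi>]
        locally_integrable_mult_test[OF wdD(2)[OF assms(2)] \<phi>] by simp
  qed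
  then show ?thesis by eventually_elim simp
qed

lemma wd_D: "wd is u w \<Longrightarrow> wd is u (D is u)"
  unfolding weak_deriv_def by (rule someI[of "wd is u"])

text \<open>The only handle on the chosen representative: it agrees almost everywhere with any known
  weak derivative.\<close>

lemma D_AE: "wd is u w \<Longrightarrow> AE x in \<mu>. D is u x = w x"
  using wd_unique wd_D by blast

lemma wd_add:
  assumes "wd is u w" "wd is u' w'"
  shows "wd is (\<lambda>x. u x + u' x) (\<lambda>x. w x + w' x)"
proof (rule wdI)
  fix \<phi> assume \<phi>: "\<phi> \<in> test"
  note [simp] = locally_integrable_mult_test[OF wdD(1)[OF assms(1)] test_partial_deriv[OF \<phi>]]
    locally_integrable_mult_test[OF wdD(1)[OF assms(2)] test_partial_deriv[OF \<phi>]]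
    locally_integrable_mult_test[OF wdD(2)[OF assms(1)] \<phi>] locally_integrable_mult_test[OF wdD(2)[OF assms(2)] \<phi>]
  show "(LINT x|\<mu>. (u x + u' x) * partial_deriv is \<phi> x) = (-1) ^ length is * (LINT x|\<mu>. (w x + w' x) * \<phi> x)"
    using wdD(3)[OF assms(1) \<phi>] wdD(3)[OF assms(2) \<phi>] by (simp add: distrib_right distrib_left)
qed (intro locally_integrable_add wdD[OF assms(1)] wdD[OF assms(2)])+

lemma wd_cmult:
  assumes "wd is u w"
  shows "wd is (\<lambda>x. c * u x) (\<lambda>x. c * w x)"
proof (rule wdI)
  fix \<phi> assume \<phi>: "\<phi> \<in> test"
  show "(LINT x|\<mu>. c * u x * partial_deriv is \<phi> x) = (-1) ^ length is * (LINT x|\<mu>. c * w x * \<phi> x)"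
    using wdD(3)[OF assms(1) \<phi>] by (simp add: mult.assoc)
qed (intro locally_integrable_cmult wdD[OF assms(1)])+

lemma smooth_locally_integrable: "smooth f \<Longrightarrow> locally_integrable \<Omega> f"
  by (intro sqint_locally_integrable smooth_sqint)

lemma wd_0: "wd is (\<lambda>x. 0) (\<lambda>x. 0)"
  by (rule wdI) (auto intro: smooth_locally_integrable smooth_const)

lemma wd_sum:
  assumes "\<And>i. i \<in> I \<Longrightarrow> wd is (u i) (w i)"
  shows "wd is (\<lambda>x. \<Sum>i\<in>I. u i x) (\<lambda>x. \<Sum>i\<in>I. w i x)"
  using assms by (induction I rule: infinite_finite_induct) (auto intro: wd_0 wd_add)

lemma wd_cong_AE:
  assumes wd: "wd is u w" and ae: "AE x in \<mu>. u x = u' x"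
  shows "wd is u' w"
proof (rule wdI)
  show "locally_integrable \<Omega> u'"
    by (rule locally_integrable_cong_AE[OF wdD(1)[OF wd] ae])
  show "locally_integrable \<Omega> w" by (rule wdD(2)[OF wd])
  fix \<phi> assume \<phi>: "\<phi> \<in> test"
  have "(LINT x|\<mu>. u' x * partial_deriv is \<phi> x) = (LINT x|\<mu>. u x * partial_deriv is \<phi> x)"
  proof (rule integral_cong_AE)
    show "AE x in \<mu>. u' x * partial_deriv is \<phi> x = u x * partial_deriv is \<phi> x"
      using ae by eventually_elim simp
    show "(\<lambda>x. u' x * partial_deriv is \<phi> x) \<in> borel_measurable \<mu>"
      "(\<lambda>x. u x * partial_deriv is \<phi> x) \<in> borel_measurable \<mu>"
      using locally_integrable_mult_test[OF \<open>locally_integrable \<Omega> u'\<close> test_partial_deriv[OF \<phi>]]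
        locally_integrable_mult_test[OF wdD(1)[OF wd] test_partial_deriv[OF \<phi>]] by auto
  qed
  then show "(LINT x|\<mu>. u' x * partial_deriv is \<phi> x) = (-1) ^ length is * (LINT x|\<mu>. w x * \<phi> x)"
    using wdD(3)[OF wd \<phi>] by simp
qed

lemma wd_Nil: "locally_integrable \<Omega> u \<Longrightarrow> wd [] u u"
  by (rule wdI) auto

lemma integral_mult_test_eq_lborel:
  assumes "smooth f" "\<phi> \<in> test"
  shows "(LINT x|\<mu>. f x * \<phi> x) = (LINT x|lborel. f x * \<phi> x)"
  using assms
  by (intro integral_eq_lborel) (auto intro: borel_measurable_times smooth_borel test_smooth test_eq_0)

lemma wd_smooth:
  assumes "smooth f"
  shows "wd is f (partial_deriv is f)"
proof (rule wdI)
  fix \<phi> assume "\<phi> \<in> test"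
  then show "(LINT x|\<mu>. f x * partial_deriv is \<phi> x) = (-1) ^ length is * (LINT x|\<mu>. partial_deriv is f x * \<phi> x)"
    using integral_by_parts[OF assms, of \<phi> \<Omega> "is"] assms
    by (simp add: integral_mult_test_eq_lborel smooth_partial_deriv test_partial_deriv)
qed (intro smooth_locally_integrable smooth_partial_deriv assms)+

text \<open>Differentiating \<open>w\<close> further appends to the list:
  \<open>partial_deriv (js @ is) \<phi>\<close> is the \<open>js\<close>-derivative of the test
  function \<open>partial_deriv is \<phi>\<close>, so \<open>js\<close> is moved onto
  \<open>u\<close> first. The order of the lists is thus respected without commuting weak
  derivatives.\<close>

lemma wd_compose:
  assumes "wd js u w" "wd (js @ is) u w'"
  shows "wd is w w'"
proof (rule wdI)
  fix \<phi> assume \<phi>: "\<phi> \<in> test"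
  have "(LINT x|\<mu>. u x * partial_deriv (js @ is) \<phi> x) = (-1) ^ length js * (LINT x|\<mu>. w x * partial_deriv is \<phi> x)"
    using wdD(3)[OF assms(1) test_partial_deriv[OF \<phi>]] by (simp add: partial_deriv_append)
  with wdD(3)[OF assms(2) \<phi>]
  have "(-1) ^ length js * (LINT x|\<mu>. w x * partial_deriv is \<phi> x) =
      (-1) ^ length js * ((-1) ^ length is * (LINT x|\<mu>. w' x * \<phi> x))"
    by (simp add: power_add)
  then show "(LINT x|\<mu>. w x * partial_deriv is \<phi> x) = (-1) ^ length is * (LINT x|\<mu>. w' x * \<phi> x)"
    by simp
qed (use wdD assms in blast)+

end

section \<open>Sobolev spaces\<close>

lemma finite_lists_length_le_UNIV [simp]: "finite {is :: 'n::finite list. length is \<le> m}"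
  using finite_lists_length_le[of "UNIV :: 'n set" m] by simp

context bounded_domain
begin

abbreviation "H \<equiv> sobolev_space \<Omega>"
abbreviation "H0 \<equiv> sobolev_space0 \<Omega>"
abbreviation "N \<equiv> sobolev_norm \<Omega>"

lemma Lp_space_2: "Lp_space 2 \<Omega> = {f. sqint \<mu> f}"
  by (simp add: Lp_space_def sqint_def)

lemma Lp_norm_2: "Lp_norm 2 \<Omega> f = l2 \<mu> f"
  by (simp add: Lp_norm_def l2_def powr_half_sqrt)

lemma sobolev_norm_eq: "N m u = L2_set (\<lambda>is. l2 \<mu> (D is u)) {is. length is \<le> m}"
  by (simp add: sobolev_norm_def L2_set_def Lp_norm_2)

lemma H_I:
  assumes "sqint \<mu> u" "\<And>is. length is \<le> m \<Longrightarrow> \<exists>w. sqint \<mu> w \<and> wd is u w"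
  shows "u \<in> H m"
  using assms by (auto simp: sobolev_space_def Lp_space_2)

lemma H_sqint: "u \<in> H m \<Longrightarrow> sqint \<mu> u"
  by (simp add: sobolev_space_def Lp_space_2)

lemma H_wd:
  assumes "u \<in> H m" "length is \<le> m"
  shows "wd is u (D is u)"
  using assms wd_D by (auto simp: sobolev_space_def)

lemma wd_measurable: "wd is u w \<Longrightarrow> w \<in> borel_measurable \<mu>"
  by (intro locally_integrable_measurable wdD(2))

lemma sqint_D:
  assumes "wd is u w" "sqint \<mu> w"
  shows "sqint \<mu> (D is u)"
proof (rule sqint_cong_AE[OF assms(2)])
  show "D is u \<in> borel_measurable \<mu>"
    by (rule wd_measurable[OF wd_D[OF assms(1)]])
  show "AE x in \<mu>. w x = D is u x"
    by (rule wd_unique[OF assms(1) wd_D[OF assms(1)]])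
qed

lemma H_D_sqint:
  assumes "u \<in> H m" "length is \<le> m"
  shows "sqint \<mu> (D is u)"
proof -
  obtain w where "sqint \<mu> w" "wd is u w"
    using assms by (auto simp: sobolev_space_def Lp_space_2)
  then show ?thesis by (rule sqint_D[rotated])
qed

lemma H_D_measurable: "u \<in> H m \<Longrightarrow> length is \<le> m \<Longrightarrow> D is u \<in> borel_measurable \<mu>"
  using H_D_sqint by (auto simp: sqint_def)

lemma H_add:
  assumes "u \<in> H m" "v \<in> H m"
  shows "(\<lambda>x. u x + v x) \<in> H m"
proof (rule H_I)
  show "sqint \<mu> (\<lambda>x. u x + v x)"
    by (intro sqint_add H_sqint[of _ m] assms)
  show "\<exists>w. sqint \<mu> w \<and> wd is (\<lambda>x. u x + v x) w" if "length is \<le> m" for "is"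
    by (intro exI[of _ "\<lambda>x. D is u x + D is v x"] conjI wd_add sqint_add H_wd[of _ m] H_D_sqint[of _ m] assms that)
qed

lemma H_cmult:
  assumes "u \<in> H m"
  shows "(\<lambda>x. c * u x) \<in> H m"
proof (rule H_I)
  show "sqint \<mu> (\<lambda>x. c * u x)"
    by (intro sqint_cmult H_sqint[of _ m] assms)
  show "\<exists>w. sqint \<mu> w \<and> wd is (\<lambda>x. c * u x) w" if "length is \<le> m" for "is"
    by (intro exI[of _ "\<lambda>x. c * D is u x"] conjI wd_cmult sqint_cmult H_wd[of _ m] H_D_sqint[of _ m] assms that)
qed

lemma H_diff:
  assumes "u \<in> H m" "v \<in> H m"
  shows "(\<lambda>x. u x - v x) \<in> H m"
  using H_add[OF assms(1) H_cmult[OF assms(2), of "-1"]] by simp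

lemma D_add:
  assumes "u \<in> H m" "v \<in> H m" "length is \<le> m"
  shows "AE x in \<mu>. D is (\<lambda>x. u x + v x) x = D is u x + D is v x"
  by (intro D_AE wd_add H_wd[of _ m] assms)

lemma D_cmult:
  assumes "u \<in> H m" "length is \<le> m"
  shows "AE x in \<mu>. D is (\<lambda>x. c * u x) x = c * D is u x"
  by (intro D_AE wd_cmult H_wd[of _ m] assms)

lemma D_diff:
  assumes "u \<in> H m" "v \<in> H m" "length is \<le> m"
  shows "AE x in \<mu>. D is (\<lambda>x. u x - v x) x = D is u x - D is v x"
proof -
  have "AE x in \<mu>. D is (\<lambda>x. u x + (-1) * v x) x = D is u x + (-1) * D is v x"
    by (intro D_AE wd_add wd_cmult H_wd[of _ m] assms)
  then show ?thesis by simp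
qed

lemma D_Nil:
  assumes "u \<in> H m"
  shows "AE x in \<mu>. D [] u x = u x"
  by (intro D_AE wd_Nil sqint_locally_integrable H_sqint[OF assms])

lemma smooth_H: "smooth f \<Longrightarrow> f \<in> H m"
  by (rule H_I) (auto intro: smooth_sqint smooth_partial_deriv wd_smooth)

lemma D_smooth: "smooth f \<Longrightarrow> AE x in \<mu>. D is f x = partial_deriv is f x"
  by (intro D_AE wd_smooth)

lemma test_H: "\<phi> \<in> test \<Longrightarrow> \<phi> \<in> H m"
  by (intro smooth_H test_smooth)

lemma l2_D_smooth: "smooth f \<Longrightarrow> l2 \<mu> (D is f) = l2 \<mu> (partial_deriv is f)"
  using smooth_H[of f "length is"]
  by (intro l2_cong_AE D_smooth smooth_measurable smooth_partial_deriv H_D_measurable[of _ "length is"]) auto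

lemma N_nonneg [simp]: "0 \<le> N m u"
  by (simp add: sobolev_norm_eq)

lemma l2_D_le_N: "length is \<le> m \<Longrightarrow> l2 \<mu> (D is u) \<le> N m u"
  unfolding sobolev_norm_eq by (rule member_le_L2_set) auto

lemma l2_le_N:
  assumes "u \<in> H m"
  shows "l2 \<mu> u \<le> N m u"
proof -
  have "l2 \<mu> u = l2 \<mu> (D [] u)"
    using D_Nil[OF assms] H_sqint[OF assms] H_D_measurable[OF assms, of "[]"]
    by (intro l2_cong_AE) (auto simp: sqint_def)
  then show ?thesis
    using l2_D_le_N[of "[]" m u] by simp
qed

lemma N_le_sum: "N m u \<le> (\<Sum>is | length is \<le> m. l2 \<mu> (D is u))"
  unfolding sobolev_norm_eq by (rule L2_set_le_sum) auto

lemma N_add: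
  assumes "u \<in> H m" "v \<in> H m"
  shows "N m (\<lambda>x. u x + v x) \<le> N m u + N m v"
proof -
  have "l2 \<mu> (D is (\<lambda>x. u x + v x)) \<le> l2 \<mu> (D is u) + l2 \<mu> (D is v)" if "length is \<le> m" for "is"
  proof -
    have "l2 \<mu> (D is (\<lambda>x. u x + v x)) = l2 \<mu> (\<lambda>x. D is u x + D is v x)"
      using H_D_measurable[OF _ that] assms H_add[OF assms]
      by (intro l2_cong_AE D_add[OF assms that] borel_measurable_add) auto
    also have "\<dots> \<le> l2 \<mu> (D is u) + l2 \<mu> (D is v)"
      by (intro l2_triangle H_D_sqint[of _ m] assms that)
    finally show ?thesis .
  qed
  then have "N m (\<lambda>x. u x + v x) \<le> L2_set (\<lambda>is. l2 \<mu> (D is u) + l2 \<mu> (D is v)) {is. length is \<le> m}"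
    unfolding sobolev_norm_eq by (intro L2_set_mono) auto
  also have "\<dots> \<le> N m u + N m v"
    unfolding sobolev_norm_eq by (rule L2_set_triangle_ineq)
  finally show ?thesis .
qed

lemma N_cmult:
  assumes "u \<in> H m"
  shows "N m (\<lambda>x. c * u x) = \<bar>c\<bar> * N m u"
proof -
  have "l2 \<mu> (D is (\<lambda>x. c * u x)) = \<bar>c\<bar> * l2 \<mu> (D is u)" if "length is \<le> m" for "is"
    unfolding l2_cmult[symmetric] using H_D_measurable[OF _ that] assms H_cmult[OF assms]
    by (intro l2_cong_AE D_cmult[OF assms that] borel_measurable_times) auto
  then have "N m (\<lambda>x. c * u x) = L2_set (\<lambda>is. \<bar>c\<bar> * l2 \<mu> (D is u)) {is. length is \<le> m}"
    unfolding sobolev_norm_eq by (intro L2_set_cong) auto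
  then show ?thesis
    by (simp add: sobolev_norm_eq L2_set_right_distrib)
qed

lemma N_diff_commute:
  assumes "u \<in> H m" "v \<in> H m"
  shows "N m (\<lambda>x. u x - v x) = N m (\<lambda>x. v x - u x)"
  using N_cmult[OF H_diff[OF assms], of "-1"] by simp

lemma N_diff_triangle:
  assumes "u \<in> H m" "v \<in> H m" "w \<in> H m"
  shows "N m (\<lambda>x. u x - w x) \<le> N m (\<lambda>x. u x - v x) + N m (\<lambda>x. v x - w x)"
  using N_add[OF H_diff[OF assms(1,2)] H_diff[OF assms(2,3)]] by simp

lemma N_le_add_diff:
  assumes "u \<in> H m" "v \<in> H m"
  shows "N m u \<le> N m v + N m (\<lambda>x. u x - v x)"
  using N_add[OF assms(2) H_diff[OF assms]] by simp

lemma H0_H: "u \<in> H0 m \<Longrightarrow> u \<in> H m"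
  by (simp add: sobolev_space0_def)

lemma H0_approx:
  assumes "u \<in> H0 m"
  obtains \<phi> where "\<And>k::nat. \<phi> k \<in> test" "(\<lambda>k. N m (\<lambda>x. u x - \<phi> k x)) \<longlonglongrightarrow> 0"
proof -
  have "\<exists>\<phi>\<in>test. N m (\<lambda>x. u x - \<phi> x) < 1 / real (Suc k)" for k
  proof -
    have "1 / real (Suc k) > 0" by simp
    then show ?thesis using assms unfolding sobolev_space0_def by blast
  qed
  then obtain \<phi> where \<phi>: "\<And>k. \<phi> k \<in> test" "\<And>k. N m (\<lambda>x. u x - \<phi> k x) < 1 / real (Suc k)"
    by metis
  have "(\<lambda>k. N m (\<lambda>x. u x - \<phi> k x)) \<longlonglongrightarrow> 0"
  proof (rule tendsto_sandwich[OF _ _ tendsto_const])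
    show "(\<lambda>k. 1 / real (Suc k)) \<longlonglongrightarrow> 0"
      by (rule LIMSEQ_Suc) (rule lim_1_over_n)
  qed (use less_imp_le[OF \<phi>(2)] in auto)
  with \<phi>(1) show ?thesis by (rule that)
qed

lemma H0_closed:
  assumes "u \<in> H m" "\<And>\<epsilon>. \<epsilon> > 0 \<Longrightarrow> \<exists>v\<in>H0 m. N m (\<lambda>x. u x - v x) < \<epsilon>"
  shows "u \<in> H0 m"
  unfolding sobolev_space0_def
proof (intro CollectI conjI allI impI)
  fix \<epsilon> :: real assume "\<epsilon> > 0"
  then obtain v where v: "v \<in> H0 m" "N m (\<lambda>x. u x - v x) < \<epsilon> / 2"
    using assms(2)[of "\<epsilon> / 2"] by auto
  moreover obtain \<phi> where \<phi>: "\<phi> \<in> test" "N m (\<lambda>x. v x - \<phi> x) < \<epsilon> / 2"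
    using v(1) \<open>\<epsilon> > 0\<close> half_gt_zero unfolding sobolev_space0_def by blast
  ultimately have "N m (\<lambda>x. u x - \<phi> x) < \<epsilon>"
    using N_diff_triangle[OF assms(1) H0_H[OF v(1)] test_H[OF \<phi>(1)]] by simp
  then show "\<exists>\<phi>\<in>test. N m (\<lambda>x. u x - \<phi> x) < \<epsilon>"
    using \<phi>(1) by blast
qed (fact assms(1))

lemma N_0: "N m (\<lambda>x. 0) = 0"
  using N_cmult[of "\<lambda>x. 0" m 0] by (simp add: smooth_H smooth_const)

lemma test_H0:
  assumes "\<phi> \<in> test"
  shows "\<phi> \<in> H0 m"
  unfolding sobolev_space0_def using assms by (auto simp: test_H N_0 intro!: bexI[of _ \<phi>])

lemma H0_add:
  assumes "u \<in> H0 m" "v \<in> H0 m"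
  shows "(\<lambda>x. u x + v x) \<in> H0 m"
proof -
  have H: "u \<in> H m" "v \<in> H m" using assms by (auto intro: H0_H)
  show ?thesis
    unfolding sobolev_space0_def
  proof (intro CollectI conjI allI impI H_add H)
    fix \<epsilon> :: real assume e: "\<epsilon> > 0"
    then obtain \<phi> where \<phi>: "\<phi> \<in> test" "N m (\<lambda>x. u x - \<phi> x) < \<epsilon> / 2"
      using assms(1) half_gt_zero unfolding sobolev_space0_def by blast
    obtain \<psi> where \<psi>: "\<psi> \<in> test" "N m (\<lambda>x. v x - \<psi> x) < \<epsilon> / 2"
      using assms(2) e half_gt_zero unfolding sobolev_space0_def by blast
    have "N m (\<lambda>x. (u x - \<phi> x) + (v x - \<psi> x)) \<le> N m (\<lambda>x. u x - \<phi> x) + N m (\<lambda>x. v x - \<psi> x)"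
      by (intro N_add H_diff H test_H \<phi> \<psi>)
    also have "(\<lambda>x. (u x - \<phi> x) + (v x - \<psi> x)) = (\<lambda>x. u x + v x - (\<phi> x + \<psi> x))"
      by auto
    finally show "\<exists>\<phi>\<in>test. N m (\<lambda>x. u x + v x - \<phi> x) < \<epsilon>"
      using \<phi> \<psi> by (intro bexI[of _ "\<lambda>x. \<phi> x + \<psi> x"] test_add) auto
  qed
qed

lemma H0_cmult:
  assumes "u \<in> H0 m"
  shows "(\<lambda>x. c * u x) \<in> H0 m"
proof -
  have H: "u \<in> H m" using assms by (rule H0_H)
  show ?thesis
    unfolding sobolev_space0_def
  proof (intro CollectI conjI allI impI H_cmult H)
    fix \<epsilon> :: real assume "\<epsilon> > 0"
    then have "\<epsilon> / (\<bar>c\<bar> + 1) > 0" by (simp add: field_simps)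
    then obtain \<phi> where \<phi>: "\<phi> \<in> test" "N m (\<lambda>x. u x - \<phi> x) < \<epsilon> / (\<bar>c\<bar> + 1)"
      using assms unfolding sobolev_space0_def by blast
    have "N m (\<lambda>x. c * (u x - \<phi> x)) = \<bar>c\<bar> * N m (\<lambda>x. u x - \<phi> x)"
      by (intro N_cmult H_diff H test_H \<phi>)
    also have "\<dots> \<le> (\<bar>c\<bar> + 1) * N m (\<lambda>x. u x - \<phi> x)"
      by (intro mult_right_mono) auto
    also have "\<dots> < \<epsilon>"
      using \<phi>(2) by (simp add: field_simps)
    finally show "\<exists>\<phi>\<in>test. N m (\<lambda>x. c * u x - \<phi> x) < \<epsilon>"
      using \<phi>(1) by (intro bexI[of _ "\<lambda>x. c * \<phi> x"] test_cmult) (auto simp: right_diff_distrib)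
  qed
qed

lemma H0_diff:
  assumes "u \<in> H0 m" "v \<in> H0 m"
  shows "(\<lambda>x. u x - v x) \<in> H0 m"
  using H0_add[OF assms(1) H0_cmult[OF assms(2), of "-1"]] by simp

section \<open>Completeness of the Sobolev spaces\<close>

lemma l2_tendsto_integral_mult:
  assumes w: "sqint \<mu> g" and f: "\<And>k. sqint \<mu> (f k)" and h: "sqint \<mu> h"
    and lim: "(\<lambda>k. l2 \<mu> (\<lambda>x. f k x - g x)) \<longlonglongrightarrow> 0"
  shows "(\<lambda>k. LINT x|\<mu>. f k x * h x) \<longlonglongrightarrow> (LINT x|\<mu>. g x * h x)"
proof (rule LIM_zero_cancel, rule Lim_null_comparison)
  show "\<forall>\<^sub>F k in sequentially. norm ((LINT x|\<mu>. f k x * h x) - (LINT x|\<mu>. g x * h x)) \<le>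
      l2 \<mu> (\<lambda>x. f k x - g x) * l2 \<mu> h"
  proof (intro always_eventually allI)
    fix k
    have "(LINT x|\<mu>. f k x * h x) - (LINT x|\<mu>. g x * h x) = (LINT x|\<mu>. (f k x - g x) * h x)"
      using sqint_mult_integrable[OF f h] sqint_mult_integrable[OF w h] by (simp add: left_diff_distrib)
    then show "norm ((LINT x|\<mu>. f k x * h x) - (LINT x|\<mu>. g x * h x)) \<le> l2 \<mu> (\<lambda>x. f k x - g x) * l2 \<mu> h"
      using l2_Cauchy_Schwarz[OF sqint_diff[OF f w] h, of k] by simp
  qed
  show "(\<lambda>k. l2 \<mu> (\<lambda>x. f k x - g x) * l2 \<mu> h) \<longlonglongrightarrow> 0"
    using tendsto_mult_right[OF lim, of "l2 \<mu> h"] by simp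
qed

text \<open>Each weak derivative converges in L^2. The defining identity of a weak derivative passes
  to the limit against a fixed test function, so the limits are the weak derivatives of the limit
  function.\<close>

lemma H_complete:
  assumes u: "\<And>k::nat. u k \<in> H m"
    and cauchy: "\<And>e. e > 0 \<Longrightarrow> \<exists>M. \<forall>j\<ge>M. \<forall>k\<ge>M. N m (\<lambda>x. u j x - u k x) < e"
  obtains v where "v \<in> H m" "(\<lambda>k. N m (\<lambda>x. u k x - v x)) \<longlonglongrightarrow> 0"
proof -
  have l2_diff: "l2 \<mu> (D is (\<lambda>x. u j x - v x)) = l2 \<mu> (\<lambda>x. D is (u j) x - D is v x)"
    if "length is \<le> m" "v \<in> H m" for "is" j v
    using H_D_measurable[OF _ that(1)] u that H_diff
    by (intro l2_cong_AE D_diff[OF _ _ that(1)] borel_measurable_diff) auto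
  have "\<exists>g. sqint \<mu> g \<and> (\<lambda>k. l2 \<mu> (\<lambda>x. D is (u k) x - g x)) \<longlonglongrightarrow> 0" if "length is \<le> m" for "is"
  proof (rule l2_complete)
    show "sqint \<mu> (D is (u k))" for k
      by (rule H_D_sqint[OF u that])
    fix e :: real assume "e > 0"
    then obtain M where "\<forall>j\<ge>M. \<forall>k\<ge>M. N m (\<lambda>x. u j x - u k x) < e"
      using cauchy by blast
    then have "\<forall>j\<ge>M. \<forall>k\<ge>M. l2 \<mu> (\<lambda>x. D is (u j) x - D is (u k) x) < e"
      using l2_diff[OF that u] l2_D_le_N[OF that] by (metis order_le_less_trans)
    then show "\<exists>M. \<forall>j\<ge>M. \<forall>k\<ge>M. l2 \<mu> (\<lambda>x. D is (u j) x - D is (u k) x) < e" by blast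
  qed
  then have ex: "\<And>is. length is \<le> m \<Longrightarrow> \<exists>g. sqint \<mu> g \<and> (\<lambda>k. l2 \<mu> (\<lambda>x. D is (u k) x - g x)) \<longlonglongrightarrow> 0" .
  define g where "g is = (SOME g. sqint \<mu> g \<and> (\<lambda>k. l2 \<mu> (\<lambda>x. D is (u k) x - g x)) \<longlonglongrightarrow> 0)" for "is"
  have g: "sqint \<mu> (g is)" "(\<lambda>k. l2 \<mu> (\<lambda>x. D is (u k) x - g is x)) \<longlonglongrightarrow> 0" if "length is \<le> m" for "is"
    using someI_ex[OF ex[OF that]] by (auto simp: g_def)
  define v where "v = g []"
  have wd: "wd is v (g is)" if l: "length is \<le> m" for "is"
  proof (rule wdI)
    show "locally_integrable \<Omega> v" "locally_integrable \<Omega> (g is)"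
      using g(1)[of "[]"] g(1)[OF l] by (auto simp: v_def intro: sqint_locally_integrable)
    fix \<phi> assume \<phi>: "\<phi> \<in> test"
    have s: "sqint \<mu> \<phi>" "sqint \<mu> (partial_deriv is \<phi>)"
      by (intro smooth_sqint smooth_partial_deriv test_smooth[OF \<phi>])+
    have 1: "(\<lambda>k. LINT x|\<mu>. D [] (u k) x * partial_deriv is \<phi> x) \<longlonglongrightarrow> (LINT x|\<mu>. v x * partial_deriv is \<phi> x)"
      unfolding v_def by (intro l2_tendsto_integral_mult g s H_D_sqint[OF u]) auto
    have 2: "(\<lambda>k. (-1) ^ length is * (LINT x|\<mu>. D is (u k) x * \<phi> x)) \<longlonglongrightarrow>
        (-1) ^ length is * (LINT x|\<mu>. g is x * \<phi> x)"
      by (intro tendsto_mult_left l2_tendsto_integral_mult g s H_D_sqint[OF u] l)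
    \<comment> \<open>The limit is taken along the representative \<open>D [] (u k)\<close>, which
      equals \<open>u k\<close> only almost everywhere; composing with the empty list transfers the
      identity to it.\<close>
    have eq: "(LINT x|\<mu>. D [] (u k) x * partial_deriv is \<phi> x) = (-1) ^ length is * (LINT x|\<mu>. D is (u k) x * \<phi> x)" for k
      using wdD(3)[OF wd_compose[of "[]" "u k" "D [] (u k)" "is" "D is (u k)"] \<phi>]
        H_wd[OF u] l by simp
    show "(LINT x|\<mu>. v x * partial_deriv is \<phi> x) = (-1) ^ length is * (LINT x|\<mu>. g is x * \<phi> x)"
      by (rule LIMSEQ_unique[OF 1[unfolded eq] 2])
  qed
  have v: "v \<in> H m"
    by (rule H_I) (use wd g v_def in auto)
  have "(\<lambda>k. N m (\<lambda>x. u k x - v x)) \<longlonglongrightarrow> 0"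
  proof (rule tendsto_sandwich[OF _ _ tendsto_const])
    have "l2 \<mu> (D is (\<lambda>x. u k x - v x)) = l2 \<mu> (\<lambda>x. D is (u k) x - g is x)" if l: "length is \<le> m" for "is" k
      unfolding l2_diff[OF l v]
    proof (rule l2_cong_AE)
      show "AE x in \<mu>. D is (u k) x - D is v x = D is (u k) x - g is x"
        using D_AE[OF wd[OF l]] by eventually_elim simp
    qed (use H_D_measurable[OF u l] H_D_measurable[OF v l] g(1)[OF l] in \<open>auto simp: sqint_def\<close>)
    then show "\<forall>\<^sub>F k in sequentially. N m (\<lambda>x. u k x - v x) \<le> (\<Sum>is | length is \<le> m. l2 \<mu> (\<lambda>x. D is (u k) x - g is x))"
      using N_le_sum[of m] by (intro always_eventually allI) (metis (no_types, lifting) mem_Collect_eq sum.cong)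
    show "(\<lambda>k. \<Sum>is | length is \<le> m. l2 \<mu> (\<lambda>x. D is (u k) x - g is x)) \<longlonglongrightarrow> 0"
      using tendsto_sum[of "{is. length is \<le> m}" "\<lambda>is k. l2 \<mu> (\<lambda>x. D is (u k) x - g is x)" "\<lambda>_. 0"] g(2) by simp
  qed auto
  with v show ?thesis by (rule that)
qed

lemma H0_complete:
  assumes u: "\<And>k::nat. u k \<in> H0 m"
    and cauchy: "\<And>e. e > 0 \<Longrightarrow> \<exists>M. \<forall>j\<ge>M. \<forall>k\<ge>M. N m (\<lambda>x. u j x - u k x) < e"
  obtains v where "v \<in> H0 m" "(\<lambda>k. N m (\<lambda>x. u k x - v x)) \<longlonglongrightarrow> 0"
proof -
  obtain v where v: "v \<in> H m" "(\<lambda>k. N m (\<lambda>x. u k x - v x)) \<longlonglongrightarrow> 0"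
    using H_complete[OF H0_H[OF u] cauchy] by blast
  have "v \<in> H0 m"
  proof (rule H0_closed[OF v(1)])
    fix e :: real assume "e > 0"
    then obtain k where "N m (\<lambda>x. u k x - v x) < e"
      using LIMSEQ_D[OF v(2)] by fastforce
    then show "\<exists>w\<in>H0 m. N m (\<lambda>x. v x - w x) < e"
      using u N_diff_commute[OF v(1) H0_H[OF u]] by (intro bexI[of _ "u k"]) auto
  qed
  then show ?thesis using v(2) by (rule that)
qed

text \<open>Reduces membership to L^2 convergence of classical derivatives, where the chosen
  representatives no longer appear.\<close>

lemma smooth_H0_I:
  assumes f: "smooth f" and \<phi>: "\<And>k::nat. \<phi> k \<in> test"
    and lim: "\<And>is. length is \<le> m \<Longrightarrow> (\<lambda>k. l2 \<mu> (\<lambda>x. partial_deriv is f x - partial_deriv is (\<phi> k) x)) \<longlonglongrightarrow> 0"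
  shows "f \<in> H0 m"
proof (rule H0_closed)
  show "f \<in> H m" by (rule smooth_H[OF f])
  fix e :: real assume "e > 0"
  have s: "smooth (\<lambda>x. f x - \<phi> k x)" for k
    by (intro smooth_diff f test_smooth[OF \<phi>])
  have "(\<lambda>k. \<Sum>is | length is \<le> m. l2 \<mu> (\<lambda>x. partial_deriv is f x - partial_deriv is (\<phi> k) x)) \<longlonglongrightarrow> 0"
    using tendsto_sum[of "{is. length is \<le> m}" "\<lambda>is k. l2 \<mu> (\<lambda>x. partial_deriv is f x - partial_deriv is (\<phi> k) x)" "\<lambda>_. 0"]
      lim by simp
  then obtain k where k: "(\<Sum>is | length is \<le> m. l2 \<mu> (\<lambda>x. partial_deriv is f x - partial_deriv is (\<phi> k) x)) < e"
    using LIMSEQ_D[OF _ \<open>e > 0\<close>] by (metis (no_types, lifting) abs_ge_self diff_zero le_less_trans order_refl real_norm_def)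
  have "N m (\<lambda>x. f x - \<phi> k x) \<le> (\<Sum>is | length is \<le> m. l2 \<mu> (D is (\<lambda>x. f x - \<phi> k x)))"
    by (rule N_le_sum)
  also have "\<dots> < e"
    using k by (simp add: l2_D_smooth[OF s] partial_deriv_diff[OF f test_smooth[OF \<phi>]])
  finally show "\<exists>v\<in>H0 m. N m (\<lambda>x. f x - v x) < e"
    using test_H0[OF \<phi>] by blast
qed

end

section \<open>The polyharmonic form\<close>

text \<open>Turns the directions of \<open>k\<close> Laplacians into the list of the
  \<open>2 * k\<close> derivatives. The new pair goes to the end because a further weak derivative
  is appended there, see \<open>wd_compose\<close>.\<close>

fun dbl :: "'n list \<Rightarrow> 'n list" where
  "dbl [] = []"
| "dbl (i # ls) = dbl ls @ [i, i]"

lemma length_dbl [simp]: "length (dbl ls) = 2 * length ls"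
  by (induction ls) auto

lemma sum_partial_deriv_dbl:
  assumes f: "smooth f"
  shows "(\<Sum>ls | length ls = k. partial_deriv (dbl ls) f x) = (lap ^^ k) f x"
proof -
  have "(\<lambda>x. \<Sum>ls | length ls = k. partial_deriv (dbl ls) f x) = (lap ^^ k) f"
  proof (induction k)
    case (Suc k)
    have "(\<Sum>ls | length ls = Suc k. partial_deriv (dbl ls) f x) =
        (\<Sum>i\<in>UNIV. \<Sum>ls | length ls = k. partial_deriv [i, i] (partial_deriv (dbl ls) f) x)" for x
      using f by (simp only: sum_lists_Suc dbl.simps partial_deriv_append
          partial_deriv_commute[of f _ "[_, _]"])
    also have "\<dots> x = (\<Sum>i\<in>UNIV. partial_deriv [i, i] (\<lambda>x. \<Sum>ls | length ls = k. partial_deriv (dbl ls) f x) x)" for x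
      using f by (subst partial_deriv_sum) (auto intro: smooth_partial_deriv)
    also have "\<dots> x = lap ((lap ^^ k) f) x" for x
      by (simp only: Suc.IH lap_eq[of "(lap ^^ k) f"])
    finally show ?case by auto
  qed simp
  then show ?thesis by metis
qed

context bounded_domain
begin

text \<open>The \<open>c\<close>-derivative of the \<open>k\<close>-fold Laplacian, written with
  weak derivatives of \<open>u\<close> itself. In contrast, \<open>(laplacian D ^^ k) u\<close>
  nests choices, each made for a function that is itself a sum of chosen representatives.\<close>

definition wlap :: "nat \<Rightarrow> 'n list \<Rightarrow> (real^'n \<Rightarrow> real) \<Rightarrow> real^'n \<Rightarrow> real" where
  "wlap k c u x = (\<Sum>ls | length ls = k. D (dbl ls @ c) u x)"

lemma wlap_wd:
  assumes "u \<in> H m" "2 * k + length c \<le> m"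
  shows "wd c (wlap k [] u) (wlap k c u)"
  unfolding wlap_def[abs_def]
proof (rule wd_sum)
  fix ls :: "'n list" assume "ls \<in> {ls. length ls = k}"
  then have "length (dbl ls) \<le> m" "length (dbl ls @ c) \<le> m"
    using assms(2) by auto
  from wd_compose[OF H_wd[OF assms(1) this(1)] H_wd[OF assms(1) this(2)]]
  show "wd c (D (dbl ls @ []) u) (D (dbl ls @ c) u)" by simp
qed

lemma wlap_sqint:
  assumes "u \<in> H m" "2 * k + length c \<le> m"
  shows "sqint \<mu> (wlap k c u)"
  unfolding wlap_def[abs_def] using assms by (intro sqint_sum H_D_sqint[of _ m]) auto

lemma wlap_measurable: "u \<in> H m \<Longrightarrow> 2 * k + length c \<le> m \<Longrightarrow> wlap k c u \<in> borel_measurable \<mu>"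
  using wlap_sqint by (auto simp: sqint_def)

lemma wlap_add:
  assumes "u \<in> H m" "v \<in> H m" "2 * k + length c \<le> m"
  shows "AE x in \<mu>. wlap k c (\<lambda>x. u x + v x) x = wlap k c u x + wlap k c v x"
proof -
  have "AE x in \<mu>. \<forall>ls\<in>{ls. length ls = k}. D (dbl ls @ c) (\<lambda>x. u x + v x) x = D (dbl ls @ c) u x + D (dbl ls @ c) v x"
    using assms by (intro AE_finite_allI D_add[of _ m]) auto
  then show ?thesis
    by eventually_elim (simp add: wlap_def sum.distrib)
qed

lemma wlap_cmult:
  assumes "u \<in> H m" "2 * k + length c \<le> m"
  shows "AE x in \<mu>. wlap k c (\<lambda>x. a * u x) x = a * wlap k c u x"
proof -
  have "AE x in \<mu>. \<forall>ls\<in>{ls. length ls = k}. D (dbl ls @ c) (\<lambda>x. a * u x) x = a * D (dbl ls @ c) u x"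
    using assms by (intro AE_finite_allI D_cmult[of _ m]) auto
  then show ?thesis
    by eventually_elim (simp add: wlap_def sum_distrib_left)
qed

lemma wlap_smooth:
  assumes "smooth f"
  shows "AE x in \<mu>. wlap k c f x = partial_deriv c ((lap ^^ k) f) x"
proof -
  have "AE x in \<mu>. \<forall>ls\<in>{ls. length ls = k}. D (dbl ls @ c) f x = partial_deriv (dbl ls) (partial_deriv c f) x"
    unfolding partial_deriv_append[symmetric] by (intro AE_finite_allI D_smooth assms) auto
  then show ?thesis
    by eventually_elim
      (simp add: wlap_def sum_partial_deriv_dbl smooth_partial_deriv partial_deriv_lap_funpow assms)
qed

lemma l2_wlap_le:
  assumes "u \<in> H m" "2 * k + length c \<le> m"
  shows "l2 \<mu> (wlap k c u) \<le> real (card {ls :: 'n list. length ls = k}) * N m u"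
proof -
  have "l2 \<mu> (wlap k c u) \<le> (\<Sum>ls | length ls = k. l2 \<mu> (D (dbl ls @ c) u))"
    unfolding wlap_def[abs_def] using assms by (intro l2_sum_le H_D_sqint[of _ m]) auto
  also have "\<dots> \<le> (\<Sum>ls :: 'n list | length ls = k. N m u)"
    using assms by (intro sum_mono l2_D_le_N) auto
  finally show ?thesis by simp
qed

text \<open>Inductively the nested Laplacian agrees almost everywhere with
  \<open>wlap k [] u\<close>. A weak derivative depends only on the class of the function, so its
  second derivatives are \<open>wlap k [i, i] u\<close>, whose sum over \<open>i\<close> is the next
  stage.\<close>

lemma laplacian_weak:
  assumes u: "u \<in> H m" and k: "2 * k \<le> m"
  shows "AE x in \<mu>. (laplacian D ^^ k) u x = wlap k [] u x"
  using k
proof (induction k)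
  case 0
  show ?case
    using D_Nil[OF u] by eventually_elim (simp add: wlap_def)
next
  case (Suc k)
  let ?f = "(laplacian D ^^ k) u"
  have ae: "AE x in \<mu>. wlap k [] u x = ?f x"
    using Suc by (auto elim: eventually_mono)
  have "AE x in \<mu>. D [i, i] ?f x = wlap k [i, i] u x" for i
    using Suc.prems by (intro D_AE wd_cong_AE[OF _ ae] wlap_wd[OF u]) auto
  then have "AE x in \<mu>. \<forall>i\<in>UNIV. D [i, i] ?f x = wlap k [i, i] u x"
    by (intro AE_finite_allI) auto
  then show ?case
    by eventually_elim (simp add: laplacian_def[of D ?f] wlap_def sum_lists_Suc)
qed

lemma nabla_inner_weak:
  assumes u: "u \<in> H m" and v: "v \<in> H m"
  shows "AE x in \<mu>. nabla_inner D m u v x =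
    (\<Sum>c | length c = m mod 2. wlap (m div 2) c u x * wlap (m div 2) c v x)"
proof (cases "even m")
  case True
  show ?thesis
    using laplacian_weak[OF u, of "m div 2"] laplacian_weak[OF v, of "m div 2"] True
    by (auto simp: nabla_inner_def elim: eventually_elim2)
next
  case False
  let ?k = "m div 2"
  have *: "AE x in \<mu>. \<forall>i\<in>UNIV. D [i] ((laplacian D ^^ ?k) w) x = wlap ?k [i] w x" if w: "w \<in> H m" for w
  proof (intro AE_finite_allI D_AE)
    fix i :: 'n
    have "2 * ?k + length [i] \<le> m" using False by (auto elim: oddE)
    moreover have "AE x in \<mu>. wlap ?k [] w x = (laplacian D ^^ ?k) w x"
      using laplacian_weak[OF w, of ?k] by (auto elim: eventually_mono)
    ultimately show "wd [i] ((laplacian D ^^ ?k) w) (wlap ?k [i] w)"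
      using wd_cong_AE wlap_wd[OF w] by blast
  qed simp
  have m2: "m mod 2 = Suc 0" using False by presburger
  show ?thesis
    using *[OF u] *[OF v]
    by eventually_elim
      (simp add: nabla_inner_def False m2 sum_lists_Suc gradient_def inner_vec_def del: length_0_conv; simp)
qed

text \<open>The principal part of the form. Unlike the integral of \<open>nabla_inner\<close> it is
  visibly made of square-integrable factors that are additive in \<open>u\<close> up to null
  sets.\<close>

definition B :: "nat \<Rightarrow> (real^'n \<Rightarrow> real) \<Rightarrow> (real^'n \<Rightarrow> real) \<Rightarrow> real" where
  "B m u v = (\<Sum>c | length c = m mod 2. LINT x|\<mu>. wlap (m div 2) c u x * wlap (m div 2) c v x)"

lemma div_mod_le: "c \<in> {c. length c = m mod 2} \<Longrightarrow> 2 * (m div 2) + length c \<le> m"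
  by simp

lemma polyharmonic_op_eq:
  assumes u: "u \<in> H m" and v: "v \<in> H m"
    and A: "A \<in> borel_measurable \<mu>" "\<And>x. x \<in> \<Omega> \<Longrightarrow> \<bar>A x\<bar> \<le> M"
  shows "polyharmonic_op \<Omega> m A u v = B m u v + (LINT x|\<mu>. A x * u x * v x)"
proof -
  let ?k = "m div 2"
  define S where "S x = (\<Sum>c | length c = m mod 2. wlap ?k c u x * wlap ?k c v x)" for x
  have w: "sqint \<mu> (wlap ?k c u)" "sqint \<mu> (wlap ?k c v)" if "length c = m mod 2" for c
    using wlap_sqint[OF u] wlap_sqint[OF v] div_mod_le[of c m] that by auto
  have S_int: "integrable \<mu> S"
    unfolding S_def by (intro Bochner_Integration.integrable_sum sqint_mult_integrable w) auto
  have Au: "sqint \<mu> (\<lambda>x. A x * u x)"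
    by (rule sqint_bounded_mult[OF H_sqint[OF u] A(1)]) (use A(2) in auto)
  have Auv: "integrable \<mu> (\<lambda>x. A x * u x * v x)"
    by (rule sqint_mult_integrable[OF Au H_sqint[OF v]])
  have ae: "AE x in \<mu>. S x = nabla_inner D m u v x"
    using nabla_inner_weak[OF u v] unfolding S_def by eventually_elim simp
  \<comment> \<open>\<open>nabla_inner\<close> of weak derivatives inherits measurability from
    \<open>S\<close>, with which it agrees almost everywhere.\<close>
  then have meas: "nabla_inner D m u v \<in> borel_measurable \<mu>"
    using S_int by (intro borel_measurable_lebesgue_on_AE[OF domain_sets _ ae]) auto
  have "polyharmonic_op \<Omega> m A u v = (LINT x|\<mu>. S x + A x * u x * v x)"
    unfolding polyharmonic_op_def
  proof (rule integral_cong_AE)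
    show "AE x in \<mu>. nabla_inner D m u v x + A x * u x * v x = S x + A x * u x * v x"
      using ae by eventually_elim simp
  qed (use meas S_int Auv in auto)
  also have "\<dots> = integral\<^sup>L \<mu> S + (LINT x|\<mu>. A x * u x * v x)"
    using S_int Auv by simp
  also have "integral\<^sup>L \<mu> S = B m u v"
    unfolding S_def B_def by (intro Bochner_Integration.integral_sum sqint_mult_integrable w) auto
  finally show ?thesis .
qed

lemma B_sym: "B m u v = B m v u"
  by (simp add: B_def mult.commute)

lemma B_add:
  assumes u: "u \<in> H m" and u': "u' \<in> H m" and v: "v \<in> H m"
  shows "B m (\<lambda>x. u x + u' x) v = B m u v + B m u' v"
  unfolding B_def sum.distrib[symmetric]
proof (rule sum.cong[OF refl])
  fix c :: "'n list" assume c: "c \<in> {c. length c = m mod 2}"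
  let ?k = "m div 2"
  note le = div_mod_le[OF c]
  note int = sqint_mult_integrable[OF wlap_sqint[OF _ le] wlap_sqint[OF v le]]
  have "(LINT x|\<mu>. wlap ?k c (\<lambda>x. u x + u' x) x * wlap ?k c v x) =
      (LINT x|\<mu>. wlap ?k c u x * wlap ?k c v x + wlap ?k c u' x * wlap ?k c v x)"
  proof (rule integral_cong_AE)
    show "AE x in \<mu>. wlap ?k c (\<lambda>x. u x + u' x) x * wlap ?k c v x =
        wlap ?k c u x * wlap ?k c v x + wlap ?k c u' x * wlap ?k c v x"
      using wlap_add[OF u u' le] by eventually_elim (simp add: distrib_right)
  qed (use int[OF u] int[OF u'] int[OF H_add[OF u u']] in auto)
  also have "\<dots> = (LINT x|\<mu>. wlap ?k c u x * wlap ?k c v x) + (LINT x|\<mu>. wlap ?k c u' x * wlap ?k c v x)"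
    using int[OF u] int[OF u'] by simp
  finally show "(LINT x|\<mu>. wlap ?k c (\<lambda>x. u x + u' x) x * wlap ?k c v x) =
    (LINT x|\<mu>. wlap ?k c u x * wlap ?k c v x) + (LINT x|\<mu>. wlap ?k c u' x * wlap ?k c v x)" .
qed

lemma B_cmult:
  assumes u: "u \<in> H m" and v: "v \<in> H m"
  shows "B m (\<lambda>x. a * u x) v = a * B m u v"
  unfolding B_def sum_distrib_left
proof (rule sum.cong[OF refl])
  fix c :: "'n list" assume c: "c \<in> {c. length c = m mod 2}"
  let ?k = "m div 2"
  note le = div_mod_le[OF c]
  note int = sqint_mult_integrable[OF wlap_sqint[OF _ le] wlap_sqint[OF v le]]
  have "(LINT x|\<mu>. wlap ?k c (\<lambda>x. a * u x) x * wlap ?k c v x) =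
      (LINT x|\<mu>. a * (wlap ?k c u x * wlap ?k c v x))"
  proof (rule integral_cong_AE)
    show "AE x in \<mu>. wlap ?k c (\<lambda>x. a * u x) x * wlap ?k c v x = a * (wlap ?k c u x * wlap ?k c v x)"
      using wlap_cmult[OF u le, of a] by eventually_elim simp
  qed (use int[OF u] int[OF H_cmult[OF u]] in auto)
  then show "(LINT x|\<mu>. wlap ?k c (\<lambda>x. a * u x) x * wlap ?k c v x) =
    a * (LINT x|\<mu>. wlap ?k c u x * wlap ?k c v x)" by simp
qed

lemma B_bound:
  obtains C where "C \<ge> 0" "\<And>u v. u \<in> H m \<Longrightarrow> v \<in> H m \<Longrightarrow> \<bar>B m u v\<bar> \<le> C * N m u * N m v"
proof
  define K where "K = real (card {ls :: 'n list. length ls = m div 2})"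
  define L where "L = real (card {c :: 'n list. length c = m mod 2})"
  show "0 \<le> L * (K * K)" by (simp add: K_def L_def)
  fix u v assume u: "u \<in> H m" and v: "v \<in> H m"
  have "\<bar>LINT x|\<mu>. wlap (m div 2) c u x * wlap (m div 2) c v x\<bar> \<le> (K * N m u) * (K * N m v)"
    if c: "c \<in> {c. length c = m mod 2}" for c
  proof -
    note le = div_mod_le[OF c]
    have "\<bar>LINT x|\<mu>. wlap (m div 2) c u x * wlap (m div 2) c v x\<bar> \<le>
        l2 \<mu> (wlap (m div 2) c u) * l2 \<mu> (wlap (m div 2) c v)"
      by (intro l2_Cauchy_Schwarz wlap_sqint[OF _ le] u v)
    also have "\<dots> \<le> (K * N m u) * (K * N m v)"
      unfolding K_def by (intro mult_mono l2_wlap_le[OF _ le] u v) auto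
    finally show ?thesis .
  qed
  then have "(\<Sum>c :: 'n list | length c = m mod 2. \<bar>LINT x|\<mu>. wlap (m div 2) c u x * wlap (m div 2) c v x\<bar>) \<le>
     (\<Sum>c :: 'n list | length c = m mod 2. (K * N m u) * (K * N m v))"
    by (intro sum_mono) blast
  also have "\<dots> = L * (K * K) * N m u * N m v" by (simp add: L_def)
  finally show "\<bar>B m u v\<bar> \<le> L * (K * K) * N m u * N m v"
    unfolding B_def by (rule order_trans[OF sum_abs])
qed

text \<open>Weak derivatives become classical ones, and the compact support of \<open>\<phi>\<close>
  extends the integral from \<Omega> to the whole space, where the integrations by parts were
  done.\<close>

lemma B_smooth_test:
  assumes u: "smooth u" and \<phi>: "\<phi> \<in> test"
  shows "B m u \<phi> = (LINT x|lborel. nabla_inner partial_deriv m u \<phi> x)"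
proof -
  let ?k = "m div 2"
  have test: "partial_deriv c ((lap ^^ ?k) \<phi>) \<in> test" for c
    by (intro test_partial_deriv test_lap_funpow \<phi>)
  have sm: "smooth (partial_deriv c ((lap ^^ ?k) u))" for c
    by (intro smooth_partial_deriv smooth_lap_funpow u)
  have "(LINT x|\<mu>. wlap ?k c u x * wlap ?k c \<phi> x) =
     (LINT x|lborel. partial_deriv c ((lap ^^ ?k) u) x * partial_deriv c ((lap ^^ ?k) \<phi>) x)"
    if c: "c \<in> {c. length c = m mod 2}" for c
  proof -
    note le = div_mod_le[OF c]
    have "(LINT x|\<mu>. wlap ?k c u x * wlap ?k c \<phi> x) =
        (LINT x|\<mu>. partial_deriv c ((lap ^^ ?k) u) x * partial_deriv c ((lap ^^ ?k) \<phi>) x)"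
    proof (rule integral_cong_AE)
      show "AE x in \<mu>. wlap ?k c u x * wlap ?k c \<phi> x =
          partial_deriv c ((lap ^^ ?k) u) x * partial_deriv c ((lap ^^ ?k) \<phi>) x"
        using wlap_smooth[OF u, of ?k c] wlap_smooth[OF test_smooth[OF \<phi>], of ?k c]
        by eventually_elim simp
      show "(\<lambda>x. wlap ?k c u x * wlap ?k c \<phi> x) \<in> borel_measurable \<mu>"
        by (intro borel_measurable_times wlap_measurable[OF _ le] smooth_H u test_smooth[OF \<phi>])
      show "(\<lambda>x. partial_deriv c ((lap ^^ ?k) u) x * partial_deriv c ((lap ^^ ?k) \<phi>) x) \<in> borel_measurable \<mu>"
        by (intro borel_measurable_times smooth_measurable sm test_smooth[OF test])
    qed
    then show ?thesis
      by (simp add: integral_mult_test_eq_lborel[OF sm test])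
  qed
  then have "B m u \<phi> = (\<Sum>c | length c = m mod 2.
      LINT x|lborel. partial_deriv c ((lap ^^ ?k) u) x * partial_deriv c ((lap ^^ ?k) \<phi>) x)"
    unfolding B_def by (rule sum.cong[OF refl])
  also have "\<dots> = (LINT x|lborel. nabla_inner partial_deriv m u \<phi> x)"
    unfolding nabla_inner_partial_deriv
    by (rule Bochner_Integration.integral_sum[symmetric]) (rule test_mult_integrable[OF sm test])
  finally show ?thesis .
qed

lemma B_test: "\<phi> \<in> test \<Longrightarrow> B m \<phi> \<phi> = energy m \<phi>"
  by (simp add: B_smooth_test test_smooth energy_nabla_inner)

text \<open>Every term of the Sobolev norm of order below \<open>m\<close> is raised to order
  \<open>m\<close> by iterating the Poincare inequality.\<close>

lemma N_le_energy:
  obtains C where "C > 0" "\<And>\<phi>. \<phi> \<in> test \<Longrightarrow> (N m \<phi>)\<^sup>2 \<le> C * energy m \<phi>"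
proof -
  obtain R where R: "R > 0" "\<And>x. x \<in> \<Omega> \<Longrightarrow> norm x \<le> R"
    using bounded_domain bounded_pos by metis
  \<comment> \<open>At least 1, so that one power \<open>Q ^ m\<close> dominates the factor (2R)^2
    raised to \<open>m - length is\<close> for all orders at once.\<close>
  define Q where "Q = max 1 ((2 * R)\<^sup>2)"
  define L where "L = real (card {is :: 'n list. length is \<le> m})"
  have "0 < L"
    unfolding L_def of_nat_0_less_iff card_gt_0_iff by (auto intro: exI[of _ "[]"])
  then have pos: "0 < L * Q ^ m" by (intro mult_pos_pos zero_less_power) (simp_all add: Q_def)
  have "(N m \<phi>)\<^sup>2 \<le> L * Q ^ m * energy m \<phi>" if \<phi>: "\<phi> \<in> test" for \<phi>
  proof -
    have "(l2 \<mu> (D is \<phi>))\<^sup>2 \<le> Q ^ m * energy m \<phi>" if l: "length is \<le> m" for "is"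
    proof -
      have "(l2 \<mu> (D is \<phi>))\<^sup>2 = (LINT x|\<mu>. partial_deriv is \<phi> x * partial_deriv is \<phi> x)"
        by (simp add: l2_D_smooth[OF test_smooth[OF \<phi>]] l2_power2 flip: power2_eq_square)
      also have "\<dots> = (LINT x|lborel. partial_deriv is \<phi> x * partial_deriv is \<phi> x)"
        by (intro integral_mult_test_eq_lborel smooth_partial_deriv test_smooth[OF \<phi>] test_partial_deriv \<phi>)
      also have "\<dots> = (LINT x|lborel. (partial_deriv is \<phi> x)\<^sup>2)"
        by (simp add: power2_eq_square)
      also have "\<dots> \<le> energy (length is) \<phi>"
        unfolding energy_def by (rule member_le_sum) auto
      also have "\<dots> \<le> ((2 * R)\<^sup>2) ^ (m - length is) * energy m \<phi>"
        by (rule energy_le_energy[OF \<phi> R(2)]) (use R l in auto)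
      also have "\<dots> \<le> Q ^ m * energy m \<phi>"
      proof (intro mult_right_mono energy_nonneg)
        have "((2 * R)\<^sup>2) ^ (m - length is) \<le> Q ^ (m - length is)"
          by (intro power_mono) (auto simp: Q_def)
        also have "\<dots> \<le> Q ^ m"
          by (intro power_increasing) (auto simp: Q_def)
        finally show "((2 * R)\<^sup>2) ^ (m - length is) \<le> Q ^ m" .
      qed
      finally show ?thesis .
    qed
    then have "(\<Sum>is :: 'n list | length is \<le> m. (l2 \<mu> (D is \<phi>))\<^sup>2) \<le> (\<Sum>is :: 'n list | length is \<le> m. Q ^ m * energy m \<phi>)"
      by (intro sum_mono) auto
    then show ?thesis
      by (simp add: sobolev_norm_eq L2_set_def sum_nonneg L_def)
  qed
  with pos show ?thesis by (rule that)
qed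

text \<open>Continuity of a bounded functional along an approximation of \<open>u\<close>; it will
  be a bilinear form with one argument frozen.\<close>

lemma tendsto_bilinear:
  assumes lin: "\<And>v. v \<in> H m \<Longrightarrow> F u - F v = F (\<lambda>x. u x - v x)"
    and b: "\<And>v. v \<in> H m \<Longrightarrow> \<bar>F v\<bar> \<le> K * N m v"
    and u: "u \<in> H m" and \<phi>: "\<And>k::nat. \<phi> k \<in> H m" "(\<lambda>k. N m (\<lambda>x. u x - \<phi> k x)) \<longlonglongrightarrow> 0"
  shows "(\<lambda>k. F (\<phi> k)) \<longlonglongrightarrow> F u"
proof (rule LIM_zero_cancel, rule Lim_null_comparison)
  show "\<forall>\<^sub>F k in sequentially. norm (F (\<phi> k) - F u) \<le> K * N m (\<lambda>x. u x - \<phi> k x)"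
    using b[OF H_diff[OF u \<phi>(1)]] lin[OF \<phi>(1)] by (simp add: abs_minus_commute)
  show "(\<lambda>k. K * N m (\<lambda>x. u x - \<phi> k x)) \<longlonglongrightarrow> 0"
    using tendsto_mult_left[OF \<phi>(2), of K] by simp
qed

lemma B_diff:
  assumes u: "u \<in> H m" and u': "u' \<in> H m" and v: "v \<in> H m"
  shows "B m (\<lambda>x. u x - u' x) v = B m u v - B m u' v"
  using B_add[OF u H_cmult[OF u'] v, of "-1"] B_cmult[OF u' v, of "-1"] by simp

text \<open>On test functions the form is the energy, which controls the norm. Both sides are
  continuous in the Sobolev norm, so density carries the estimate to the closure.\<close>

lemma B_coercive:
  obtains c where "c > 0" "\<And>u. u \<in> H0 m \<Longrightarrow> c * (N m u)\<^sup>2 \<le> B m u u"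
proof -
  obtain C where C: "C > 0" "\<And>\<phi>. \<phi> \<in> test \<Longrightarrow> (N m \<phi>)\<^sup>2 \<le> C * energy m \<phi>"
    using N_le_energy[of m] by blast
  obtain K where K: "K \<ge> 0" "\<And>u v. u \<in> H m \<Longrightarrow> v \<in> H m \<Longrightarrow> \<bar>B m u v\<bar> \<le> K * N m u * N m v"
    using B_bound[of m] by blast
  have "(N m u)\<^sup>2 \<le> C * B m u u" if u0: "u \<in> H0 m" for u
  proof -
    have u: "u \<in> H m" by (rule H0_H[OF u0])
    obtain \<phi> where \<phi>: "\<And>k::nat. \<phi> k \<in> test" "(\<lambda>k. N m (\<lambda>x. u x - \<phi> k x)) \<longlonglongrightarrow> 0"
      using H0_approx[OF u0] by blast
    have \<phi>H: "\<phi> k \<in> H m" for k by (rule test_H[OF \<phi>(1)])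
    have N_lim: "(\<lambda>k. N m (\<phi> k)) \<longlonglongrightarrow> N m u"
    proof (rule LIM_zero_cancel, rule Lim_null_comparison[OF _ \<phi>(2)])
      have "\<bar>N m (\<phi> k) - N m u\<bar> \<le> N m (\<lambda>x. u x - \<phi> k x)" for k
        using N_le_add_diff[OF u \<phi>H, of k] N_le_add_diff[OF \<phi>H u, of k] N_diff_commute[OF u \<phi>H, of k]
        by (simp add: abs_le_iff)
      then show "\<forall>\<^sub>F k in sequentially. norm (N m (\<phi> k) - N m u) \<le> N m (\<lambda>x. u x - \<phi> k x)"
        by simp
    qed
    have B_lim: "(\<lambda>k. B m (\<phi> k) (\<phi> k)) \<longlonglongrightarrow> B m u u"
    proof (rule LIM_zero_cancel, rule Lim_null_comparison)
      have "\<bar>B m (\<phi> k) (\<phi> k) - B m u u\<bar> \<le> K * N m (\<lambda>x. u x - \<phi> k x) * N m (\<phi> k) + K * N m (\<lambda>x. u x - \<phi> k x) * N m u" for k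
      proof -
        have "B m (\<phi> k) (\<phi> k) - B m u u = - B m (\<lambda>x. u x - \<phi> k x) (\<phi> k) - B m (\<lambda>x. u x - \<phi> k x) u"
          using B_sym[of m "\<phi> k" u] by (simp add: B_diff u \<phi>H)
        then show ?thesis
          using K(2)[OF H_diff[OF u \<phi>H] \<phi>H, of k k] K(2)[OF H_diff[OF u \<phi>H] u, of k] by linarith
      qed
      then show "\<forall>\<^sub>F k in sequentially. norm (B m (\<phi> k) (\<phi> k) - B m u u) \<le>
          K * N m (\<lambda>x. u x - \<phi> k x) * N m (\<phi> k) + K * N m (\<lambda>x. u x - \<phi> k x) * N m u"
        by simp
      have "(\<lambda>k. K * N m (\<lambda>x. u x - \<phi> k x) * N m (\<phi> k) + K * N m (\<lambda>x. u x - \<phi> k x) * N m u) \<longlonglongrightarrow>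
          K * 0 * N m u + K * 0 * N m u"
        by (intro tendsto_intros \<phi>(2) N_lim)
      then show "(\<lambda>k. K * N m (\<lambda>x. u x - \<phi> k x) * N m (\<phi> k) + K * N m (\<lambda>x. u x - \<phi> k x) * N m u) \<longlonglongrightarrow> 0"
        by simp
    qed
    have "(\<lambda>k. (N m (\<phi> k))\<^sup>2) \<longlonglongrightarrow> (N m u)\<^sup>2" "(\<lambda>k. C * B m (\<phi> k) (\<phi> k)) \<longlonglongrightarrow> C * B m u u"
      by (intro tendsto_intros N_lim B_lim)+
    then show ?thesis
      using C(2)[OF \<phi>(1)] by (intro LIMSEQ_le) (auto simp: B_test[OF \<phi>(1)])
  qed
  then have "(1 / C) * (N m u)\<^sup>2 \<le> B m u u" if "u \<in> H0 m" for u
    using that C(1) by (simp add: field_simps)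
  then show ?thesis
    using C(1) by (intro that[of "1 / C"]) auto
qed

end

section \<open>The isomorphism theorem\<close>

text \<open>A minimizing sequence for \<open>v \<mapsto> a(v, v) - 2 f(v)\<close> is Cauchy by the parallelogram law.\<close>

lemma riesz_symmetric_form:
  fixes V :: "('x \<Rightarrow> real) set" and a :: "('x \<Rightarrow> real) \<Rightarrow> ('x \<Rightarrow> real) \<Rightarrow> real"
  assumes V_0: "(\<lambda>x. 0) \<in> V"
    and V_add: "\<And>u v. u \<in> V \<Longrightarrow> v \<in> V \<Longrightarrow> (\<lambda>x. u x + v x) \<in> V"
    and V_cmult: "\<And>c u. u \<in> V \<Longrightarrow> (\<lambda>x. c * u x) \<in> V"
    and a_sym: "\<And>u v. u \<in> V \<Longrightarrow> v \<in> V \<Longrightarrow> a u v = a v u"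
    and a_add: "\<And>u v w. u \<in> V \<Longrightarrow> v \<in> V \<Longrightarrow> w \<in> V \<Longrightarrow> a (\<lambda>x. u x + v x) w = a u w + a v w"
    and a_cmult: "\<And>c u w. u \<in> V \<Longrightarrow> w \<in> V \<Longrightarrow> a (\<lambda>x. c * u x) w = c * a u w"
    and a_nonneg: "\<And>u. u \<in> V \<Longrightarrow> 0 \<le> a u u"
    and complete: "\<And>u :: nat \<Rightarrow> 'x \<Rightarrow> real. (\<And>k. u k \<in> V) \<Longrightarrow>
      (\<And>e. e > 0 \<Longrightarrow> \<exists>M. \<forall>j\<ge>M. \<forall>k\<ge>M. a (\<lambda>x. u j x - u k x) (\<lambda>x. u j x - u k x) < e) \<Longrightarrow>
      \<exists>v\<in>V. (\<lambda>k. a (\<lambda>x. u k x - v x) (\<lambda>x. u k x - v x)) \<longlonglongrightarrow> 0"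
    and f_add: "\<And>u v. u \<in> V \<Longrightarrow> v \<in> V \<Longrightarrow> f (\<lambda>x. u x + v x) = f u + f v"
    and f_cmult: "\<And>c u. u \<in> V \<Longrightarrow> f (\<lambda>x. c * u x) = c * f u"
    and f_bound: "\<And>u. u \<in> V \<Longrightarrow> \<bar>f u\<bar> \<le> K * sqrt (a u u)"
  shows "\<exists>u\<in>V. \<forall>v\<in>V. a u v = f v"
proof -
  have V_lin: "(\<lambda>x. s * u x + t * v x) \<in> V" if "u \<in> V" "v \<in> V" for s t u v
    by (intro V_add V_cmult that)
  have V_diff: "(\<lambda>x. u x - v x) \<in> V" if "u \<in> V" "v \<in> V" for u v
    using V_lin[OF that, of 1 "-1"] by simp
  have a_lin: "a (\<lambda>x. s * u x + t * v x) w = s * a u w + t * a v w"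
    if "u \<in> V" "v \<in> V" "w \<in> V" for s t u v w
    using that by (simp add: a_add a_cmult V_cmult)
  have a_lin2: "a (\<lambda>x. s * u x + t * v x) (\<lambda>x. s * u x + t * v x) = a u u * s\<^sup>2 + 2 * s * t * a u v + a v v * t\<^sup>2"
    if uv: "u \<in> V" "v \<in> V" for s t u v
  proof -
    have "a w (\<lambda>x. s * u x + t * v x) = s * a w u + t * a w v" if "w \<in> V" for w
      using a_lin[OF uv that] a_sym[OF that] uv V_lin[OF uv] by metis
    then show ?thesis
      using uv a_sym[OF uv] by (simp add: a_lin V_lin algebra_simps power2_eq_square)
  qed
  have CS: "\<bar>a u v\<bar> \<le> sqrt (a u u) * sqrt (a v v)" if "u \<in> V" "v \<in> V" for u v
    by (rule quadratic_form_discriminant) (use a_nonneg[OF V_lin[OF that]] a_lin2[OF that] in simp)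
  have f_lin: "f (\<lambda>x. s * u x + t * v x) = s * f u + t * f v" if "u \<in> V" "v \<in> V" for s t u v
    using that by (simp add: f_add f_cmult V_cmult)
  define J where "J v = a v v - 2 * f v" for v
  have J_lower: "- K\<^sup>2 \<le> J v" if "v \<in> V" for v
  proof -
    have "a v v = (sqrt (a v v))\<^sup>2" using a_nonneg[OF that] by simp
    moreover have "0 \<le> (sqrt (a v v) - K)\<^sup>2" by simp
    ultimately show ?thesis
      using f_bound[OF that] by (simp add: J_def power2_diff mult_ac)
  qed
  define I where "I = (INF v\<in>V. J v)"
  have bdd: "bdd_below (J ` V)" by (rule bdd_belowI2) (rule J_lower)
  have I_le: "I \<le> J v" if "v \<in> V" for v
    unfolding I_def by (rule cINF_lower[OF bdd that])
  have "\<exists>v\<in>V. J v < I + 1 / real (Suc k)" for k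
  proof -
    have "(INF v\<in>V. J v) < I + 1 / real (Suc k)" by (simp add: I_def)
    then show ?thesis using cINF_less_iff[OF _ bdd] V_0 by blast
  qed
  then obtain u where u: "\<And>k. u k \<in> V" "\<And>k. J (u k) < I + 1 / real (Suc k)" by metis
  \<comment> \<open>The parallelogram law as plain arithmetic: \<open>A\<close>, \<open>B\<close>,
    \<open>C\<close> are the form values of the pair and \<open>p\<close>, \<open>q\<close> the
    values of \<open>f\<close>. The midpoint has \<open>J\<close> at least \<open>I\<close>, while
    the two points exceed \<open>I\<close> by less than \<open>d\<close> and
    \<open>e\<close>.\<close>
  have arith: "A - 2 * B + C \<le> 2 * d + 2 * e"
    if "I \<le> (A + 2 * B + C) / 4 - p - q" "A - 2 * p < I + d" "C - 2 * q < I + e"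
    for A B C d e p q :: real
    using that by (simp add: field_simps)
  have arith2: "\<bar>X\<bar> \<le> (1 + c) / 2 * h" if "0 < h + 2 * X + h * c" "0 < h - 2 * X + h * c"
    for X c h :: real
    using that by (intro abs_leI) (simp_all add: field_simps)
  have par: "a (\<lambda>x. u j x - u k x) (\<lambda>x. u j x - u k x) \<le> 2 * (1 / real (Suc j)) + 2 * (1 / real (Suc k))" for j k
  proof -
    have "a (\<lambda>x. 1 * u j x + (-1) * u k x) (\<lambda>x. 1 * u j x + (-1) * u k x) = a (u j) (u j) - 2 * a (u j) (u k) + a (u k) (u k)"
      by (subst a_lin2) (auto simp: u)
    then have p1: "a (\<lambda>x. u j x - u k x) (\<lambda>x. u j x - u k x) = a (u j) (u j) - 2 * a (u j) (u k) + a (u k) (u k)"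
      by simp
    have p2: "J (\<lambda>x. (1/2) * u j x + (1/2) * u k x) =
        (a (u j) (u j) + 2 * a (u j) (u k) + a (u k) (u k)) / 4 - f (u j) - f (u k)"
      unfolding J_def
      by (subst a_lin2, rule u, rule u, subst f_lin, rule u, rule u) (simp add: power2_eq_square field_simps)
    show ?thesis
      unfolding p1
      by (rule arith[OF I_le[OF V_lin[OF u(1) u(1)], of "1/2" j "1/2" k, unfolded p2]
          u(2)[of j, unfolded J_def] u(2)[of k, unfolded J_def]])
  qed
  have lim_Suc: "(\<lambda>k. c / real (Suc k)) \<longlonglongrightarrow> 0" for c :: real
    by (rule LIMSEQ_Suc) (rule lim_const_over_n)
  have "\<exists>M. \<forall>j\<ge>M. \<forall>k\<ge>M. a (\<lambda>x. u j x - u k x) (\<lambda>x. u j x - u k x) < e" if e: "e > 0" for e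
  proof -
    obtain M where M: "\<And>k. k \<ge> M \<Longrightarrow> 2 * (1 / real (Suc k)) < e / 2"
      using LIMSEQ_D[OF lim_Suc, of "e / 2" 2] e by fastforce
    show ?thesis
    proof (intro exI[of _ M] allI impI)
      fix j k assume "j \<ge> M" "k \<ge> M"
      then show "a (\<lambda>x. u j x - u k x) (\<lambda>x. u j x - u k x) < e"
        using par[of j k] M[of j] M[of k] by linarith
    qed
  qed
  from complete[OF u(1) this] obtain w where w: "w \<in> V" "(\<lambda>k. a (\<lambda>x. u k x - w x) (\<lambda>x. u k x - w x)) \<longlonglongrightarrow> 0"
    by blast
  have "a w v = f v" if v: "v \<in> V" for v
  proof -
    \<comment> \<open>A quantitative Euler-Lagrange equation: \<open>u k\<close> is within h^2 of
      the infimum, so moving it by \<open>h\<close> or \<open>- h\<close> along \<open>v\<close>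
      cannot gain more than h^2. Dividing by \<open>h\<close> bounds the residual by a multiple of
      \<open>h\<close>.\<close>
    have bound: "\<bar>a (u k) v - f v\<bar> \<le> (1 + a v v) / 2 * sqrt (1 / real (Suc k))" for k
    proof -
      define h where "h = sqrt (1 / real (Suc k))"
      have h: "h > 0" "h * h = 1 / real (Suc k)" by (auto simp: h_def)
      have "0 < h * h + 2 * t * (a (u k) v - f v) + t\<^sup>2 * a v v" for t
      proof -
        have "J (\<lambda>x. 1 * u k x + t * v x) = J (u k) + 2 * t * (a (u k) v - f v) + t\<^sup>2 * a v v"
          unfolding J_def
          by (subst a_lin2, rule u, rule v, subst f_lin, rule u, rule v) (simp add: algebra_simps)
        then show ?thesis
          using I_le[OF V_lin[OF u(1) v], of 1 k t] u(2)[of k] h(2) by simp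
      qed
      from this[of h] this[of "-h"]
      have "0 < h * (h + 2 * (a (u k) v - f v) + h * a v v)" "0 < h * (h - 2 * (a (u k) v - f v) + h * a v v)"
        by (simp_all add: algebra_simps power2_eq_square)
      then have "0 < h + 2 * (a (u k) v - f v) + h * a v v" "0 < h - 2 * (a (u k) v - f v) + h * a v v"
        using h(1) by (simp_all add: zero_less_mult_iff)
      then show ?thesis
        unfolding h_def[symmetric] by (rule arith2)
    qed
    have bound2: "\<bar>a (u k) v - a w v\<bar> \<le> sqrt (a (\<lambda>x. u k x - w x) (\<lambda>x. u k x - w x)) * sqrt (a v v)" for k
      using CS[OF V_diff[OF u(1) w(1)] v, of k] a_lin[OF u(1) w(1) v, of 1 k "-1"] by simp
    have "(\<lambda>k. a (u k) v - f v) \<longlonglongrightarrow> 0"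
    proof (rule Lim_null_comparison)
      show "(\<lambda>k. (1 + a v v) / 2 * sqrt (1 / real (Suc k))) \<longlonglongrightarrow> 0"
        using tendsto_mult_right_zero[OF tendsto_real_sqrt[OF lim_Suc[of 1], simplified], of "(1 + a v v) / 2"] by simp
    qed (use bound in auto)
    moreover have "(\<lambda>k. a (u k) v - a w v) \<longlonglongrightarrow> 0"
    proof (rule Lim_null_comparison)
      show "(\<lambda>k. sqrt (a (\<lambda>x. u k x - w x) (\<lambda>x. u k x - w x)) * sqrt (a v v)) \<longlonglongrightarrow> 0"
        using tendsto_mult_left_zero[OF tendsto_real_sqrt[OF w(2), simplified]] by simp
    qed (use bound2 in auto)
    ultimately have "(\<lambda>k. (a (u k) v - f v) - (a (u k) v - a w v)) \<longlonglongrightarrow> 0 - 0"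
      by (rule tendsto_diff)
    then have "(\<lambda>k::nat. a w v - f v) \<longlonglongrightarrow> 0" by simp
    then show ?thesis
      using LIMSEQ_unique[OF tendsto_const] by fastforce
  qed
  with w(1) show ?thesis by blast
qed

context bounded_domain
begin

lemma H0_0: "(\<lambda>x. 0) \<in> H0 m"
  by (rule test_H0[OF test_0])

text \<open>A bounded nonnegative potential adds a bounded, symmetric and nonnegative term to the
  coercive form, so the Riesz argument gives surjectivity and coercivity gives injectivity and the
  bound on the inverse.\<close>

lemma polyharmonic_op_isomorphism:
  assumes A: "A \<in> borel_measurable \<mu>" "\<And>x. x \<in> \<Omega> \<Longrightarrow> 0 \<le> A x" "\<And>x. x \<in> \<Omega> \<Longrightarrow> A x \<le> M"
  shows "sobolev_isomorphism \<Omega> m (polyharmonic_op \<Omega> m A)"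
proof -
  let ?T = "polyharmonic_op \<Omega> m A"
  \<comment> \<open>The maximum also covers an empty \<Omega>, where nothing prevents
    \<open>M\<close> from being negative.\<close>
  define M' where "M' = max M 0"
  have AM: "\<bar>A x\<bar> \<le> M'" if "x \<in> \<Omega>" for x
    using A(2,3)[OF that] by (simp add: M'_def)
  define P where "P u v = (LINT x|\<mu>. A x * u x * v x)" for u v
  have T: "?T u v = B m u v + P u v" if "u \<in> H m" "v \<in> H m" for u v
    unfolding P_def by (rule polyharmonic_op_eq[OF that A(1) AM])
  have Au: "sqint \<mu> (\<lambda>x. A x * u x)" if "u \<in> H m" for u
    by (rule sqint_bounded_mult[OF H_sqint[OF that] A(1)]) (use AM in auto)
  have P_int: "integrable \<mu> (\<lambda>x. A x * u x * v x)" if "u \<in> H m" "v \<in> H m" for u v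
    by (rule sqint_mult_integrable[OF Au[OF that(1)] H_sqint[OF that(2)]])
  have P_sym: "P u v = P v u" for u v
    by (simp add: P_def mult_ac)
  have P_add: "P (\<lambda>x. u x + u' x) v = P u v + P u' v" if "u \<in> H m" "u' \<in> H m" "v \<in> H m" for u u' v
    using P_int[OF that(1,3)] P_int[OF that(2,3)] by (simp add: P_def distrib_left distrib_right)
  have P_cmult: "P (\<lambda>x. c * u x) v = c * P u v" for c u v
    by (simp add: P_def mult.left_commute mult.assoc)
  have P_nonneg: "0 \<le> P u u" for u
    unfolding P_def using A(2) by (intro integral_nonneg_AE AE_I2) (auto simp: mult.assoc)
  have P_bound: "\<bar>P u v\<bar> \<le> M' * N m u * N m v" if "u \<in> H m" "v \<in> H m" for u v
  proof -
    have "\<bar>P u v\<bar> \<le> l2 \<mu> (\<lambda>x. A x * u x) * l2 \<mu> v"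
      unfolding P_def by (rule l2_Cauchy_Schwarz[OF Au[OF that(1)] H_sqint[OF that(2)]])
    also have "\<dots> \<le> (M' * l2 \<mu> u) * l2 \<mu> v"
      by (intro mult_right_mono l2_bounded_mult H_sqint[OF that(1)] A(1)) (use AM in \<open>auto simp: M'_def\<close>)
    also have "\<dots> \<le> (M' * N m u) * N m v"
      by (intro mult_mono mult_left_mono l2_le_N that) (auto simp: M'_def)
    finally show ?thesis .
  qed
  have T_sym: "?T u v = ?T v u" if "u \<in> H m" "v \<in> H m" for u v
    using that by (simp add: T B_sym P_sym)
  have T_add: "?T (\<lambda>x. u x + u' x) v = ?T u v + ?T u' v" if "u \<in> H m" "u' \<in> H m" "v \<in> H m" for u u' v
    using that by (simp add: T H_add B_add P_add)
  have T_cmult: "?T (\<lambda>x. c * u x) v = c * ?T u v" if "u \<in> H m" "v \<in> H m" for c u v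
    using that by (simp add: T H_cmult B_cmult P_cmult distrib_left)
  obtain K where K: "K \<ge> 0" "\<And>u v. u \<in> H m \<Longrightarrow> v \<in> H m \<Longrightarrow> \<bar>B m u v\<bar> \<le> K * N m u * N m v"
    using B_bound[of m] by blast
  define K' where "K' = K + M'"
  have K'0: "K' \<ge> 0" using K(1) by (simp add: K'_def M'_def)
  have T_bound: "\<bar>?T u v\<bar> \<le> K' * N m u * N m v" if "u \<in> H m" "v \<in> H m" for u v
    using K(2)[OF that] P_bound[OF that] unfolding T[OF that] K'_def distrib_right by linarith
  obtain c where c: "c > 0" "\<And>u. u \<in> H0 m \<Longrightarrow> c * (N m u)\<^sup>2 \<le> B m u u"
    using B_coercive[of m] by blast
  have T_coercive: "c * (N m u)\<^sup>2 \<le> ?T u u" if "u \<in> H0 m" for u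
    using c(2)[OF that] P_nonneg[of u] H0_H[OF that] by (simp add: T)
  have N_le_T: "N m u \<le> sqrt (?T u u) / sqrt c" if "u \<in> H0 m" for u
  proof -
    have "(N m u)\<^sup>2 \<le> ?T u u / c"
      using T_coercive[OF that] c(1) by (simp add: field_simps)
    then have "N m u \<le> sqrt (?T u u / c)" by (rule real_le_rsqrt)
    then show ?thesis by (simp add: real_sqrt_divide)
  qed
  have dual: "?T u \<in> sobolev_dual \<Omega> m" if u: "u \<in> H0 m" for u
    unfolding sobolev_dual_def
  proof (intro CollectI conjI ballI allI exI[of _ "K' * N m u"])
    fix v v' assume v: "v \<in> H0 m" "v' \<in> H0 m"
    note H = H0_H[OF u] H0_H[OF v(1)] H0_H[OF v(2)]
    show "?T u (\<lambda>x. v x + v' x) = ?T u v + ?T u v'"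
      using T_add[OF H(2,3,1)] T_sym[OF H(1) H_add[OF H(2,3)]] T_sym[OF H(1,2)] T_sym[OF H(1,3)] by simp
  next
    fix a v assume v: "v \<in> H0 m"
    note H = H0_H[OF u] H0_H[OF v]
    show "?T u (\<lambda>x. a * v x) = a * ?T u v"
      using T_cmult[OF H(2,1)] T_sym[OF H(1) H_cmult[OF H(2)]] T_sym[OF H] by simp
  next
    fix v assume "v \<in> H0 m"
    then show "\<bar>?T u v\<bar> \<le> K' * N m u * N m v"
      by (intro T_bound H0_H u)
  qed
  \<comment> \<open>\<open>sobolev_dual_norm\<close> is a supremum of reals; it dominates its
    members only once the family is known to be bounded above.\<close>
  have bdd: "bdd_above ((\<lambda>v. \<bar>f v\<bar>) ` {v \<in> H0 m. N m v \<le> 1})" if f: "f \<in> sobolev_dual \<Omega> m" for f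
  proof -
    obtain L where "\<forall>v\<in>H0 m. \<bar>f v\<bar> \<le> L * N m v"
      using f unfolding sobolev_dual_def by blast
    then have L: "\<And>v. v \<in> H0 m \<Longrightarrow> \<bar>f v\<bar> \<le> L * N m v" by blast
    show ?thesis
    proof (rule bdd_aboveI2[of _ _ "\<bar>L\<bar>"])
      fix v assume "v \<in> {v \<in> H0 m. N m v \<le> 1}"
      then have "\<bar>f v\<bar> \<le> L * N m v" "N m v \<le> 1" using L by auto
      moreover have "L * N m v \<le> \<bar>L\<bar> * 1"
        using \<open>N m v \<le> 1\<close> by (intro mult_mono) auto
      ultimately show "\<bar>f v\<bar> \<le> \<bar>L\<bar>" by simp
    qed
  qed
  show ?thesis
    unfolding sobolev_isomorphism_def
  proof (intro conjI)
    show "\<forall>u\<in>H0 m. ?T u \<in> sobolev_dual \<Omega> m" using dual by blast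
    show "\<forall>u\<in>H0 m. \<forall>u'\<in>H0 m. dual_eq \<Omega> m (?T (\<lambda>x. u x + u' x)) (\<lambda>v. ?T u v + ?T u' v)"
      using T_add by (simp add: dual_eq_def H0_H)
    show "\<forall>a. \<forall>u\<in>H0 m. dual_eq \<Omega> m (?T (\<lambda>x. a * u x)) (\<lambda>v. a * ?T u v)"
      using T_cmult by (simp add: dual_eq_def H0_H)
    show "\<forall>f\<in>sobolev_dual \<Omega> m. \<exists>u\<in>H0 m. dual_eq \<Omega> m (?T u) f"
    proof
      fix f assume f: "f \<in> sobolev_dual \<Omega> m"
      obtain L where "\<forall>v\<in>H0 m. \<bar>f v\<bar> \<le> L * N m v"
        using f unfolding sobolev_dual_def by blast
      then have L: "\<And>v. v \<in> H0 m \<Longrightarrow> \<bar>f v\<bar> \<le> L * N m v" by blast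
      have "\<exists>u\<in>H0 m. \<forall>v\<in>H0 m. ?T u v = f v"
      proof (rule riesz_symmetric_form[where K="\<bar>L\<bar> / sqrt c"])
        show "0 \<le> ?T u u" if "u \<in> H0 m" for u
          using T_coercive[OF that] c(1) by (meson mult_nonneg_nonneg order_trans zero_le_power2 less_imp_le)
        show "\<bar>f u\<bar> \<le> \<bar>L\<bar> / sqrt c * sqrt (?T u u)" if u: "u \<in> H0 m" for u
        proof -
          have "\<bar>f u\<bar> \<le> \<bar>L\<bar> * N m u"
            using L[OF u] mult_right_mono[OF abs_ge_self N_nonneg, of L m u] by linarith
          also have "\<dots> \<le> \<bar>L\<bar> * (sqrt (?T u u) / sqrt c)"
            by (intro mult_left_mono N_le_T u) simp
          finally show ?thesis by simp
        qed
        show "\<exists>v\<in>H0 m. (\<lambda>k. ?T (\<lambda>x. u k x - v x) (\<lambda>x. u k x - v x)) \<longlonglongrightarrow> 0"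
          if u: "\<And>k. u k \<in> H0 m"
            and cauchy: "\<And>e. e > 0 \<Longrightarrow> \<exists>M. \<forall>j\<ge>M. \<forall>k\<ge>M. ?T (\<lambda>x. u j x - u k x) (\<lambda>x. u j x - u k x) < e"
          for u :: "nat \<Rightarrow> real^'n \<Rightarrow> real"
        proof -
          \<comment> \<open>Coercivity turns Cauchy sequences of the form into Cauchy sequences of
            the Sobolev norm, and boundedness of the form turns the limit back.\<close>
          have N_cauchy: "\<exists>M. \<forall>j\<ge>M. \<forall>k\<ge>M. N m (\<lambda>x. u j x - u k x) < e" if e: "e > 0" for e
          proof -
            have "c * e\<^sup>2 > 0" using e c(1) by simp
            then obtain M where M: "\<And>j k. j \<ge> M \<Longrightarrow> k \<ge> M \<Longrightarrow> ?T (\<lambda>x. u j x - u k x) (\<lambda>x. u j x - u k x) < c * e\<^sup>2"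
              using cauchy by blast
            show ?thesis
            proof (intro exI[of _ M] allI impI)
              fix j k assume "j \<ge> M" "k \<ge> M"
              then have "c * (N m (\<lambda>x. u j x - u k x))\<^sup>2 < c * e\<^sup>2"
                using M[of j k] T_coercive[OF H0_diff[OF u u], of j k] by linarith
              then have "(N m (\<lambda>x. u j x - u k x))\<^sup>2 < e\<^sup>2" using c(1) by simp
              then show "N m (\<lambda>x. u j x - u k x) < e"
                by (rule power2_less_imp_less) (use e in auto)
            qed
          qed
          obtain v where v: "v \<in> H0 m" "(\<lambda>k. N m (\<lambda>x. u k x - v x)) \<longlonglongrightarrow> 0"
            by (rule H0_complete[of u m, OF u N_cauchy]) blast
          have "(\<lambda>k. ?T (\<lambda>x. u k x - v x) (\<lambda>x. u k x - v x)) \<longlonglongrightarrow> 0"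
          proof (rule Lim_null_comparison)
            show "\<forall>\<^sub>F k in sequentially. norm (?T (\<lambda>x. u k x - v x) (\<lambda>x. u k x - v x)) \<le>
                K' * N m (\<lambda>x. u k x - v x) * N m (\<lambda>x. u k x - v x)"
              using T_bound[OF H0_H[OF H0_diff[OF u v(1)]] H0_H[OF H0_diff[OF u v(1)]]] by simp
            have "(\<lambda>k. K' * N m (\<lambda>x. u k x - v x) * N m (\<lambda>x. u k x - v x)) \<longlonglongrightarrow> K' * 0 * 0"
              by (intro tendsto_intros v(2))
            then show "(\<lambda>k. K' * N m (\<lambda>x. u k x - v x) * N m (\<lambda>x. u k x - v x)) \<longlonglongrightarrow> 0" by simp
          qed
          with v(1) show ?thesis by blast
        qed
        show "?T u v = ?T v u" if "u \<in> H0 m" "v \<in> H0 m" for u v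
          by (intro T_sym H0_H that)
        show "?T (\<lambda>x. u x + v x) w = ?T u w + ?T v w" if "u \<in> H0 m" "v \<in> H0 m" "w \<in> H0 m" for u v w
          by (intro T_add H0_H that)
        show "?T (\<lambda>x. a * u x) w = a * ?T u w" if "u \<in> H0 m" "w \<in> H0 m" for a u w
          by (intro T_cmult H0_H that)
      qed (use f in \<open>auto simp: sobolev_dual_def H0_0 H0_add H0_cmult\<close>)
      then show "\<exists>u\<in>H0 m. dual_eq \<Omega> m (?T u) f"
        by (simp add: dual_eq_def)
    qed
    show "\<forall>u\<in>H0 m. \<forall>u'\<in>H0 m. dual_eq \<Omega> m (?T u) (?T u') \<longrightarrow> (AE x in \<mu>. u x = u' x)"
    proof (intro ballI impI)
      fix u u' assume u: "u \<in> H0 m" and u': "u' \<in> H0 m" and eq: "dual_eq \<Omega> m (?T u) (?T u')"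
      define w where "w = (\<lambda>x. u x + (-1) * u' x)"
      have w: "w \<in> H0 m" unfolding w_def by (intro H0_add H0_cmult u u')
      have "?T w w = ?T u w + (-1) * ?T u' w"
        using T_add[OF H0_H[OF u] H0_H[OF H0_cmult[OF u', of "-1"]] H0_H[OF w]]
          T_cmult[OF H0_H[OF u'] H0_H[OF w], of "-1"] by (simp add: w_def)
      also have "\<dots> = 0"
        using eq w by (simp add: dual_eq_def)
      finally have "N m w = 0"
        using N_le_T[OF w] N_nonneg[of m w] by simp
      then have "l2 \<mu> w = 0"
        using l2_le_N[OF H0_H[OF w]] l2_nonneg[of \<mu> w] by simp
      then have "(LINT x|\<mu>. (w x)\<^sup>2) = 0" by (simp add: l2_def)
      then have "AE x in \<mu>. (w x)\<^sup>2 = 0"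
        using H_sqint[OF H0_H[OF w]] by (subst (asm) integral_nonneg_eq_0_iff_AE) (auto simp: sqint_def)
      then show "AE x in \<mu>. u x = u' x"
        by eventually_elim (simp add: w_def)
    qed
    show "\<exists>C. \<forall>u\<in>H0 m. sobolev_dual_norm \<Omega> m (?T u) \<le> C * N m u"
    proof (intro exI[of _ K'] ballI)
      fix u assume u: "u \<in> H0 m"
      show "sobolev_dual_norm \<Omega> m (?T u) \<le> K' * N m u"
        unfolding sobolev_dual_norm_def
      proof (rule cSUP_least)
        show "{v \<in> H0 m. N m v \<le> 1} \<noteq> {}" using H0_0[of m] N_0[of m] by auto
        fix v assume "v \<in> {v \<in> H0 m. N m v \<le> 1}"
        then have v: "v \<in> H0 m" "N m v \<le> 1" by auto
        have "K' * N m u * N m v \<le> K' * N m u * 1"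
          using v(2) K'0 by (intro mult_left_mono) auto
        then show "\<bar>?T u v\<bar> \<le> K' * N m u"
          using T_bound[OF H0_H[OF u] H0_H[OF v(1)]] by simp
      qed
    qed
    show "\<exists>C. \<forall>u\<in>H0 m. N m u \<le> C * sobolev_dual_norm \<Omega> m (?T u)"
    proof (intro exI[of _ "1 / c"] ballI)
      fix u assume u: "u \<in> H0 m"
      have upper: "\<bar>?T u v\<bar> \<le> sobolev_dual_norm \<Omega> m (?T u)" if "v \<in> H0 m" "N m v \<le> 1" for v
        unfolding sobolev_dual_norm_def by (rule cSUP_upper[OF _ bdd[OF dual[OF u]]]) (use that in auto)
      show "N m u \<le> 1 / c * sobolev_dual_norm \<Omega> m (?T u)"
      proof (cases "N m u = 0")
        case True
        then show ?thesis
          using upper[OF H0_0] c(1) by (simp add: N_0)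
      next
        case False
        then have pos: "N m u > 0" using N_nonneg[of m u] by linarith
        \<comment> \<open>Testing \<open>?T u\<close> with the normalized \<open>u\<close> bounds
          its dual norm below by \<open>?T u u / N m u\<close>, which coercivity makes at least
          \<open>c * N m u\<close>.\<close>
        have v: "(\<lambda>x. 1 / N m u * u x) \<in> H0 m" by (rule H0_cmult[OF u])
        have "N m (\<lambda>x. 1 / N m u * u x) \<le> 1"
          using pos by (simp only: N_cmult[OF H0_H[OF u]]) simp
        from upper[OF v this] have "\<bar>?T (\<lambda>x. 1 / N m u * u x) u\<bar> \<le> sobolev_dual_norm \<Omega> m (?T u)"
          by (simp only: T_sym[OF H0_H[OF u] H0_H[OF v]])
        then have "\<bar>?T u u\<bar> / N m u \<le> sobolev_dual_norm \<Omega> m (?T u)"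
          by (simp only: T_cmult[OF H0_H[OF u] H0_H[OF u]]) simp
        moreover have "?T u u / N m u \<le> \<bar>?T u u\<bar> / N m u"
          by (intro divide_right_mono) auto
        moreover have "c * N m u \<le> ?T u u / N m u"
          using T_coercive[OF u] pos by (simp add: field_simps power2_eq_square)
        ultimately have "c * N m u \<le> sobolev_dual_norm \<Omega> m (?T u)" by linarith
        then show ?thesis using c(1) by (simp add: field_simps)
      qed
    qed
  qed
qed

text \<open>For smooth \<open>u\<close> the operator is a genuine function paired with
  \<open>v\<close>. The identity holds for test functions by parts and extends to the whole closure
  by continuity in \<open>v\<close>, which brings pointwise sign information into play.\<close>

lemma polyharmonic_op_smooth:
  assumes u: "smooth u" and v: "v \<in> H0 m"
    and A: "A \<in> borel_measurable \<mu>" "\<And>x. x \<in> \<Omega> \<Longrightarrow> \<bar>A x\<bar> \<le> M"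
  shows "polyharmonic_op \<Omega> m A u v = (LINT x|\<mu>. ((-1) ^ m * (lap ^^ m) u x + A x * u x) * v x)"
proof -
  let ?g = "\<lambda>x. (-1) ^ m * (lap ^^ m) u x"
  have uH: "u \<in> H m" by (rule smooth_H[OF u])
  have vH: "v \<in> H m" by (rule H0_H[OF v])
  have g: "smooth ?g" by (intro smooth_cmult smooth_lap_funpow u)
  obtain K where K: "\<And>u v. u \<in> H m \<Longrightarrow> v \<in> H m \<Longrightarrow> \<bar>B m u v\<bar> \<le> K * N m u * N m v"
    using B_bound[of m] by blast
  obtain \<phi> where \<phi>: "\<And>k::nat. \<phi> k \<in> test" "(\<lambda>k. N m (\<lambda>x. v x - \<phi> k x)) \<longlonglongrightarrow> 0"
    using H0_approx[OF v] by blast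
  note \<phi>H = test_H[OF \<phi>(1)]
  have lim1: "(\<lambda>k. B m u (\<phi> k)) \<longlonglongrightarrow> B m u v"
    by (rule tendsto_bilinear[where K="K * N m u", OF _ K[OF uH] vH \<phi>H \<phi>(2)])
      (simp add: B_sym[of m u] B_diff[OF vH _ uH])
  have lim2: "(\<lambda>k. LINT x|\<mu>. ?g x * \<phi> k x) \<longlonglongrightarrow> (LINT x|\<mu>. ?g x * v x)"
  proof (rule tendsto_bilinear[where K="l2 \<mu> ?g" and F="\<lambda>w. LINT x|\<mu>. ?g x * w x", OF _ _ vH \<phi>H \<phi>(2)])
    fix w assume w: "w \<in> H m"
    show "(LINT x|\<mu>. ?g x * v x) - (LINT x|\<mu>. ?g x * w x) = (LINT x|\<mu>. ?g x * (v x - w x))"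
      using sqint_mult_integrable[OF smooth_sqint[OF g] H_sqint[OF vH]]
        sqint_mult_integrable[OF smooth_sqint[OF g] H_sqint[OF w]]
      by (simp add: right_diff_distrib)
    have "\<bar>LINT x|\<mu>. ?g x * w x\<bar> \<le> l2 \<mu> ?g * l2 \<mu> w"
      by (rule l2_Cauchy_Schwarz[OF smooth_sqint[OF g] H_sqint[OF w]])
    also have "\<dots> \<le> l2 \<mu> ?g * N m w"
      by (intro mult_left_mono l2_le_N w) simp
    finally show "\<bar>LINT x|\<mu>. ?g x * w x\<bar> \<le> l2 \<mu> ?g * N m w" .
  qed
  have eq: "B m u (\<phi> k) = (LINT x|\<mu>. ?g x * \<phi> k x)" for k
    unfolding integral_mult_test_eq_lborel[OF g \<phi>(1)] B_smooth_test[OF u \<phi>(1)]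
      integral_nabla_inner_by_parts[OF u \<phi>(1)]
    by (simp add: mult.assoc)
  have B_eq: "B m u v = (LINT x|\<mu>. ?g x * v x)"
    by (rule LIMSEQ_unique[OF lim1[unfolded eq] lim2])
  have "integrable \<mu> (\<lambda>x. ?g x * v x)"
    by (rule sqint_mult_integrable[OF smooth_sqint[OF g] H_sqint[OF vH]])
  moreover have "integrable \<mu> (\<lambda>x. A x * u x * v x)"
    by (rule sqint_mult_integrable[OF sqint_bounded_mult[OF smooth_sqint[OF u] A(1)] H_sqint[OF vH]])
      (use A(2) in auto)
  moreover have "polyharmonic_op \<Omega> m A u v = B m u v + (LINT x|\<mu>. A x * u x * v x)"
    by (rule polyharmonic_op_eq[OF uH vH A])
  ultimately show ?thesis
    by (simp add: B_eq distrib_right)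
qed

text \<open>The nonnegative right-hand side is the image of \<open>u\<close> itself. By continuity
  \<open>u\<close> is negative on a nonempty open set, which is not a null set.\<close>

lemma not_inverse_positivity_preserving:
  assumes u: "smooth u" "u \<in> H0 m"
    and A: "A \<in> borel_measurable \<mu>" "\<And>x. x \<in> \<Omega> \<Longrightarrow> 0 \<le> A x" "\<And>x. x \<in> \<Omega> \<Longrightarrow> A x \<le> M"
    and nonneg: "\<And>x. x \<in> \<Omega> \<Longrightarrow> 0 \<le> (-1) ^ m * (lap ^^ m) u x + A x * u x"
    and neg: "y \<in> \<Omega>" "u y < 0"
  shows "\<not> inverse_positivity_preserving \<Omega> m (polyharmonic_op \<Omega> m A)"
proof
  let ?T = "polyharmonic_op \<Omega> m A"
  assume *: "inverse_positivity_preserving \<Omega> m ?T"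
  have "?T u \<in> sobolev_dual \<Omega> m"
    using polyharmonic_op_isomorphism[OF A, of m] u(2) by (simp add: sobolev_isomorphism_def)
  moreover have "dual_nonneg \<Omega> m (?T u)"
    unfolding dual_nonneg_def
  proof (intro ballI impI)
    fix v assume v: "v \<in> H0 m" "AE x in \<mu>. 0 \<le> v x"
    have AM: "\<bar>A x\<bar> \<le> M" if "x \<in> \<Omega>" for x
      using A(2,3)[OF that] by simp
    have "0 \<le> (LINT x|\<mu>. ((-1) ^ m * (lap ^^ m) u x + A x * u x) * v x)"
    proof (rule integral_nonneg_AE)
      have "AE x in \<mu>. x \<in> \<Omega>" by (rule AE_I2) simp
      with v(2) show "AE x in \<mu>. 0 \<le> ((-1) ^ m * (lap ^^ m) u x + A x * u x) * v x"
        by eventually_elim (intro mult_nonneg_nonneg nonneg)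
    qed
    then show "0 \<le> ?T u v"
      by (simp only: polyharmonic_op_smooth[OF u(1) v(1) A(1) AM])
  qed
  ultimately have ae: "AE x in \<mu>. 0 \<le> u x"
    using * u(2) unfolding inverse_positivity_preserving_def dual_eq_def by blast
  define U where "U = \<Omega> \<inter> u -` {..<0}"
  have U: "open U"
    unfolding U_def by (intro open_Int open_domain open_vimage open_lessThan smooth_continuous_on u)
  moreover have "U \<noteq> {}" using neg by (auto simp: U_def)
  ultimately have "\<not> negligible U"
    using open_not_negligible by blast
  moreover have "negligible U"
  proof -
    have "AE x in lebesgue. x \<notin> U"
      using ae unfolding AE_iff by eventually_elim (auto simp: U_def)
    moreover have "U \<in> sets lebesgue" using U by simp
    ultimately show ?thesis
      by (simp add: negligible_iff_null_sets AE_iff_null_sets)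
  qed
  ultimately show False by blast
qed

end

section \<open>The Gagliardo--Nirenberg--Sobolev inequality\<close>

text \<open>Powers of extended reals with \<open>x\<^sup>0 = 1\<close> for every \<open>x\<close>, unlike \<^const>\<open>powr\<close>: the exponent of \<open>f\<close> in
  the grid-line inequality below is \<open>0\<close> in the case of interest.\<close>

definition epow :: "ennreal \<Rightarrow> real \<Rightarrow> ennreal" where
  "epow x p = (if p = 0 then 1 else if x = top then top else ennreal (enn2real x powr p))"

lemma epow_0 [simp]: "epow x 0 = 1"
  by (simp add: epow_def)

lemma epow_1 [simp]: "epow x 1 = x"
  by (cases x) (auto simp: epow_def)

lemma epow_zero: "p \<noteq> 0 \<Longrightarrow> epow 0 p = 0"
  by (simp add: epow_def)

lemma epow_top: "p \<noteq> 0 \<Longrightarrow> epow top p = top"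
  by (simp add: epow_def)

lemma epow_ennreal: "0 \<le> x \<Longrightarrow> p \<noteq> 0 \<Longrightarrow> epow (ennreal x) p = ennreal (x powr p)"
  by (simp add: epow_def)

lemma epow_measurable [measurable (raw)]:
  "f \<in> borel_measurable M \<Longrightarrow> (\<lambda>x. epow (f x) p) \<in> borel_measurable M"
  unfolding epow_def by (cases "p = 0") auto

lemma epow_mult:
  assumes "0 \<le> p"
  shows "epow (x * y) p = epow x p * epow y p"
proof (cases "p = 0")
  case False
  then have p: "p \<noteq> 0" "p > 0" using assms by auto
  consider "x = 0" | "y = 0" | "x \<noteq> 0" "y \<noteq> 0" "x = top \<or> y = top" | "x \<noteq> top" "y \<noteq> top"
    by blast
  then show ?thesis
  proof cases
    case 3
    have nz: "epow z p \<noteq> 0" if "z \<noteq> 0" for z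
      using that p by (cases z) (auto simp: epow_ennreal epow_top ennreal_eq_0_iff powr_def)
    from 3(3) show ?thesis
    proof
      assume "x = top"
      then show ?thesis
        using nz[OF 3(2)] 3(2) p by (simp add: epow_top ennreal_top_mult)
    next
      assume "y = top"
      then show ?thesis
        using nz[OF 3(1)] 3(1) p by (simp add: epow_top ennreal_mult_top)
    qed
  next
    case 4
    then show ?thesis
      using p by (cases x; cases y) (auto simp: epow_ennreal powr_mult simp flip: ennreal_mult)
  qed (use p in \<open>auto simp: epow_zero\<close>)
qed simp

lemma epow_add:
  assumes "0 \<le> p" "0 \<le> q"
  shows "epow x (p + q) = epow x p * epow x q"
proof (cases "p = 0 \<or> q = 0")
  case False
  then have "p \<noteq> 0" "q \<noteq> 0" "p + q \<noteq> 0" using assms by auto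
  then show ?thesis
    by (cases x) (auto simp: epow_ennreal epow_top powr_add ennreal_mult)
qed auto

lemma epow_epow:
  assumes "0 \<le> p" "0 \<le> q"
  shows "epow (epow x p) q = epow x (p * q)"
proof (cases "p = 0 \<or> q = 0")
  case True
  have "epow 1 q = 1" by (simp add: epow_def)
  with True show ?thesis by auto
next
  case False
  then have "p \<noteq> 0" "q \<noteq> 0" "p * q \<noteq> 0" by auto
  then show ?thesis
    by (cases x) (auto simp: epow_ennreal epow_top powr_powr)
qed

lemma epow_mono:
  assumes "0 \<le> p" "x \<le> y"
  shows "epow x p \<le> epow y p"
proof (cases "p = 0")
  case False
  show ?thesis
  proof (cases "y = top")
    case True
    then show ?thesis using False by (simp add: epow_top)
  next
    case y: False
    then have "x \<noteq> top" using assms by (auto simp: top_unique)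
    with y show ?thesis
      using assms False by (cases x; cases y) (auto simp: epow_ennreal intro!: ennreal_leI powr_mono2)
  qed
qed simp

lemma epow_prod:
  assumes "0 \<le> p"
  shows "epow (\<Prod>i\<in>I. f i) p = (\<Prod>i\<in>I. epow (f i) p)"
proof -
  have "epow 1 p = 1" by (simp add: epow_def)
  then show ?thesis
    by (induction I rule: infinite_finite_induct) (auto simp: epow_mult[OF assms])
qed

lemma epow_eq_0_iff: "0 < p \<Longrightarrow> epow x p = 0 \<longleftrightarrow> x = 0"
  by (cases x) (auto simp: epow_ennreal epow_top ennreal_eq_0_iff powr_def)

text \<open>With weights in place of conjugate exponents, both extreme weights are allowed.
  Integrals equal to 0 or infinity are split off; otherwise Young's inequality is
  integrated.\<close>

lemma holder_nn_integral_2: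
  assumes [measurable]: "f \<in> borel_measurable M" "g \<in> borel_measurable M"
    and ab: "0 \<le> a" "0 \<le> b" "a + b = 1"
  shows "(\<integral>\<^sup>+x. epow (f x) a * epow (g x) b \<partial>M) \<le> epow (\<integral>\<^sup>+x. f x \<partial>M) a * epow (\<integral>\<^sup>+x. g x \<partial>M) b"
proof -
  consider "a = 0" | "b = 0" | "a > 0" "b > 0" using ab by linarith
  then show ?thesis
  proof cases
    case 3
    let ?F = "\<integral>\<^sup>+x. f x \<partial>M" and ?G = "\<integral>\<^sup>+x. g x \<partial>M"
    consider "?F = 0 \<or> ?G = 0" | "?F \<noteq> 0" "?G \<noteq> 0" "?F = top \<or> ?G = top"
      | "?F \<noteq> 0" "?G \<noteq> 0" "?F \<noteq> top" "?G \<noteq> top" by blast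
    then show ?thesis
    proof cases
      case 1
      then have "AE x in M. f x = 0 \<or> g x = 0"
        by (auto simp: nn_integral_0_iff_AE elim: eventually_mono)
      then have "AE x in M. epow (f x) a * epow (g x) b = 0"
        by eventually_elim (use 3 in \<open>auto simp: epow_zero\<close>)
      then have "(\<integral>\<^sup>+x. epow (f x) a * epow (g x) b \<partial>M) = 0"
        by (subst nn_integral_0_iff_AE) auto
      then show ?thesis by simp
    next
      case 2
      then have "epow ?F a * epow ?G b = top"
        using 3 by (auto simp: epow_top ennreal_top_mult ennreal_mult_top epow_eq_0_iff)
      then show ?thesis by simp
    next
      case fin: 3
      obtain F where F: "?F = ennreal F" "F > 0"
        using fin by (cases ?F) (auto simp: ennreal_eq_0_iff not_le)
      obtain G where G: "?G = ennreal G" "G > 0"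
        using fin by (cases ?G) (auto simp: ennreal_eq_0_iff not_le)
      \<comment> \<open>\<open>Z\<close> is the claimed bound; \<open>A\<close> and \<open>C\<close>
        are the coefficients of Young's inequality after normalizing both integrals to 1, so the
        integrated right-hand side is Z (a + b) = Z.\<close>
      define Z where "Z = F powr a * G powr b"
      define A C where "A = a / F" and "C = b / G"
      have AC: "A > 0" "C > 0" using 3 F G by (auto simp: A_def C_def)
      have Z: "Z > 0" using F G by (simp add: Z_def)
      have young: "epow u a * epow v b \<le> ennreal Z * (ennreal A * u + ennreal C * v)" for u v
      proof -
        consider "u = 0 \<or> v = 0" | "u \<noteq> 0" "v \<noteq> 0" "u = top \<or> v = top" | r s where "u = ennreal r" "v = ennreal s" "r > 0" "s > 0"
          by (cases u; cases v) (auto simp: ennreal_eq_0_iff not_le less_le)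
        then show ?thesis
        proof cases
          case 1
          then show ?thesis using 3 by (auto simp: epow_zero)
        next
          case 2
          have "ennreal A \<noteq> 0" "ennreal C \<noteq> 0" "ennreal Z \<noteq> 0"
            using AC Z by (auto simp: ennreal_eq_0_iff not_le)
          with 2 have "ennreal Z * (ennreal A * u + ennreal C * v) = top"
            by (auto simp: ennreal_mult_top)
          then show ?thesis by simp
        next
          case (3 r s)
          have "(r / F) powr a * (s / G) powr b \<le> a * (r / F) + b * (s / G)"
            using ab F G 3 by (intro Youngs_inequality_0) auto
          then have "Z * ((r / F) powr a * (s / G) powr b) \<le> Z * (a * (r / F) + b * (s / G))"
            using Z by (intro mult_left_mono) auto
          also have "Z * ((r / F) powr a * (s / G) powr b) = r powr a * s powr b"
            using F G 3 by (simp add: Z_def powr_divide)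
          finally have "ennreal (r powr a * s powr b) \<le> ennreal (Z * (A * r + C * s))"
            by (intro ennreal_leI) (simp add: A_def C_def field_simps)
          then show ?thesis
            using 3 \<open>a > 0\<close> \<open>b > 0\<close> AC Z by (simp add: epow_ennreal ennreal_mult ennreal_plus)
        qed
      qed
      have "(\<integral>\<^sup>+x. epow (f x) a * epow (g x) b \<partial>M) \<le> (\<integral>\<^sup>+x. ennreal Z * (ennreal A * f x + ennreal C * g x) \<partial>M)"
        by (intro nn_integral_mono young)
      also have "\<dots> = ennreal Z * (ennreal A * ?F + ennreal C * ?G)"
        by (simp add: nn_integral_cmult nn_integral_add)
      also have "\<dots> = ennreal (Z * (A * F + C * G))"
        using AC F G Z by (simp add: ennreal_mult ennreal_plus)
      also have "\<dots> = ennreal Z"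
        using F G ab by (simp add: A_def C_def)
      also have "\<dots> = epow ?F a * epow ?G b"
        using 3 F G by (simp add: Z_def epow_ennreal ennreal_mult)
      finally show ?thesis .
    qed
  qed (use ab in auto)
qed

lemma holder_nn_integral:
  assumes "finite I" "\<And>i. i \<in> I \<Longrightarrow> f i \<in> borel_measurable M" "\<And>i. i \<in> I \<Longrightarrow> 0 \<le> p i" "(\<Sum>i\<in>I. p i) = 1"
  shows "(\<integral>\<^sup>+x. (\<Prod>i\<in>I. epow (f i x) (p i)) \<partial>M) \<le> (\<Prod>i\<in>I. epow (\<integral>\<^sup>+x. f i x \<partial>M) (p i))"
  using assms
proof (induction I arbitrary: p rule: finite_induct)
  case (insert j I)
  \<comment> \<open>Induction on the number of factors: the remaining weights sum to
    \<open>s\<close> and are rescaled by 1/s to sum to 1. If \<open>s = 0\<close>, all remaining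
    factors are trivial.\<close>
  define s where "s = 1 - p j"
  have s: "(\<Sum>i\<in>I. p i) = s" using insert by (simp add: s_def)
  then have s0: "0 \<le> s" using insert.prems(2) by (metis insertCI sum_nonneg)
  have [measurable]: "f i \<in> borel_measurable M" if "i \<in> insert j I" for i
    using insert.prems(1) that by blast
  show ?case
  proof (cases "s = 0")
    case True
    then have "\<forall>i\<in>I. p i = 0"
      using s insert.prems(2) insert.hyps(1) sum_nonneg_eq_0_iff[of I p] by auto
    then have "p i = 0" if "i \<in> I" for i
      using that by blast
    moreover have "p j = 1" using True by (simp add: s_def)
    ultimately show ?thesis using insert.hyps by simp
  next
    case False
    define h where "h x = (\<Prod>i\<in>I. epow (f i x) (p i / s))" for x
    have h_meas [measurable]: "h \<in> borel_measurable M"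
      unfolding h_def by (intro borel_measurable_prod_ennreal epow_measurable insert.prems) auto
    have pp: "epow (\<Prod>i\<in>I. epow (c i) (p i / s)) s = (\<Prod>i\<in>I. epow (c i) (p i))" for c
      using insert.prems(2) s0 False by (subst epow_prod) (auto simp: epow_epow intro!: prod.cong)
    have "(\<integral>\<^sup>+x. (\<Prod>i\<in>insert j I. epow (f i x) (p i)) \<partial>M) = (\<integral>\<^sup>+x. epow (f j x) (p j) * epow (h x) s \<partial>M)"
      unfolding h_def pp using insert.hyps by simp
    also have "\<dots> \<le> epow (\<integral>\<^sup>+x. f j x \<partial>M) (p j) * epow (\<integral>\<^sup>+x. h x \<partial>M) s"
      using insert.prems(2) s0 by (intro holder_nn_integral_2) (auto simp: s_def)
    also have "\<dots> \<le> epow (\<integral>\<^sup>+x. f j x \<partial>M) (p j) * epow (\<Prod>i\<in>I. epow (\<integral>\<^sup>+x. f i x \<partial>M) (p i / s)) s"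
      unfolding h_def using insert.prems s0 False s
      by (intro mult_left_mono epow_mono insert.IH) (auto simp flip: sum_divide_distrib)
    also have "\<dots> = (\<Prod>i\<in>insert j I. epow (\<integral>\<^sup>+x. f i x \<partial>M) (p i))"
      unfolding pp using insert.hyps by simp
    finally show ?thesis .
  qed
qed simp

interpretation lborel_product: product_sigma_finite "\<lambda>_ :: 'i. lborel :: real measure"
  by unfold_locales

text \<open>The grid-line inequality of van Doorn and Macbeth; for \<open>p = 1 / (card I - 1)\<close> it is the
  Loomis--Whitney step in the Gagliardo--Nirenberg--Sobolev inequality.\<close>

lemma grid_lines:
  fixes f :: "('i \<Rightarrow> real) \<Rightarrow> ennreal"
  assumes "finite I" "f \<in> borel_measurable (\<Pi>\<^sub>M i\<in>I. lborel)" "0 \<le> p" "(real (card I) - 1) * p \<le> 1"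
  shows "(\<integral>\<^sup>+x. epow (f x) (1 - (real (card I) - 1) * p) *
      (\<Prod>i\<in>I. epow (\<integral>\<^sup>+t. f (x(i := t)) \<partial>lborel) p) \<partial>(\<Pi>\<^sub>M i\<in>I. lborel))
    \<le> epow (\<integral>\<^sup>+x. f x \<partial>(\<Pi>\<^sub>M i\<in>I. lborel)) (1 + p)"
  using assms
proof (induction I arbitrary: f rule: finite_induct)
  case empty
  then show ?case
    by (simp add: lborel_product.nn_integral_empty)
next
  case (insert j I)
  let ?M = "\<lambda>I. (\<Pi>\<^sub>M i\<in>I. lborel) :: ('i \<Rightarrow> real) measure"
  define k where "k = real (card I)"
  have k: "real (card (insert j I)) - 1 = k" using insert.hyps by (simp add: k_def)
  have kp: "k * p \<le> 1" using insert.prems k by simp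
  note [measurable] = insert.prems(1)
  have upd [measurable]: "(\<lambda>z. (F z)(i := h z)) \<in> N \<rightarrow>\<^sub>M ?M (insert i J)"
    if "F \<in> N \<rightarrow>\<^sub>M ?M J" "h \<in> borel_measurable N" for F h N J i
    using that by (intro measurable_fun_upd[of _ J]) auto
  define F where "F x = (\<integral>\<^sup>+t. f (x(j := t)) \<partial>lborel)" for x
  have f_upd: "(\<lambda>(x, t). f (x(j := t))) \<in> borel_measurable (?M I \<Otimes>\<^sub>M lborel)"
    unfolding split_beta' by (rule measurable_compose[OF _ insert.prems(1)]) (intro upd; simp)
  have F_meas [measurable]: "F \<in> borel_measurable (?M I)"
    unfolding F_def using lborel.borel_measurable_nn_integral[OF f_upd] by simp
  have line_meas: "(\<lambda>x. \<integral>\<^sup>+t. f (x(i := t)) \<partial>lborel) \<in> borel_measurable (?M (insert j I))"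
    if "i \<in> insert j I" for i
  proof -
    have "(\<lambda>(x, t). f (x(i := t))) \<in> borel_measurable (?M (insert j I) \<Otimes>\<^sub>M lborel)"
      unfolding split_beta'
      by (rule measurable_compose[OF _ insert.prems(1)])
        (rule measurable_fun_upd[of _ "insert j I"], use that in auto)
    then show ?thesis
      using lborel.borel_measurable_nn_integral by simp
  qed
  \<comment> \<open>One coordinate is integrated out. The line integral in direction
    \<open>j\<close> is \<open>F x\<close>, constant along that line, and comes out with exponent
    \<open>p\<close>; Hoelder contributes \<open>F x\<close> with exponent 1 - k p. The sum 1 - (k -
    1) p is the exponent that the induction hypothesis expects.\<close>
  have inner: "(\<integral>\<^sup>+t. epow (f (x(j := t))) (1 - k * p) *
      (\<Prod>i\<in>insert j I. epow (\<integral>\<^sup>+s. f ((x(j := t))(i := s)) \<partial>lborel) p) \<partial>lborel)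
    \<le> epow (F x) (1 - (k - 1) * p) * (\<Prod>i\<in>I. epow (\<integral>\<^sup>+s. F (x(i := s)) \<partial>lborel) p)"
    if x: "x \<in> space (?M I)" for x
  proof -
    define G where "G i t = (\<integral>\<^sup>+s. f (x(i := s, j := t)) \<partial>lborel)" for i t
    have pair: "(\<lambda>(t, s). f (x(i := s, j := t))) \<in> borel_measurable (lborel \<Otimes>\<^sub>M lborel)" if "i \<in> I" for i
      unfolding split_beta'
    proof (rule measurable_compose[OF _ insert.prems(1)], rule upd)
      show "(\<lambda>z. x(i := snd z)) \<in> (lborel \<Otimes>\<^sub>M lborel) \<rightarrow>\<^sub>M ?M I"
        by (rule measurable_fun_upd[of _ I]) (use that x in auto)
    qed simp
    have G_meas [measurable]: "G i \<in> borel_measurable lborel" if "i \<in> I" for i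
      unfolding G_def using lborel.borel_measurable_nn_integral[OF pair[OF that]] by simp
    have fx_meas [measurable]: "(\<lambda>t. f (x(j := t))) \<in> borel_measurable lborel"
      by (rule measurable_compose[OF _ insert.prems(1)], rule upd) (use x in auto)
    have G_int: "(\<integral>\<^sup>+t. G i t \<partial>lborel) = (\<integral>\<^sup>+s. F (x(i := s)) \<partial>lborel)" if "i \<in> I" for i
      unfolding G_def F_def using lborel_pair.Fubini'[OF pair[OF that]] by simp
    have "(\<integral>\<^sup>+t. epow (f (x(j := t))) (1 - k * p) *
        (\<Prod>i\<in>insert j I. epow (\<integral>\<^sup>+s. f ((x(j := t))(i := s)) \<partial>lborel) p) \<partial>lborel) =
      (\<integral>\<^sup>+t. epow (F x) p * (epow (f (x(j := t))) (1 - k * p) * (\<Prod>i\<in>I. epow (G i t) p)) \<partial>lborel)"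
    proof (rule nn_integral_cong)
      fix t
      have "(x(j := t))(i := s) = x(i := s, j := t)" if "i \<in> I" for i s
        by (rule fun_upd_twist) (use that insert.hyps in auto)
      then have "(\<Prod>i\<in>I. epow (\<integral>\<^sup>+s. f ((x(j := t))(i := s)) \<partial>lborel) p) = (\<Prod>i\<in>I. epow (G i t) p)"
        by (intro prod.cong) (auto simp: G_def)
      then show "epow (f (x(j := t))) (1 - k * p) *
        (\<Prod>i\<in>insert j I. epow (\<integral>\<^sup>+s. f ((x(j := t))(i := s)) \<partial>lborel) p) =
        epow (F x) p * (epow (f (x(j := t))) (1 - k * p) * (\<Prod>i\<in>I. epow (G i t) p))"
        using insert.hyps by (simp add: F_def mult_ac)
    qed
    also have "\<dots> = epow (F x) p * (\<integral>\<^sup>+t. epow (f (x(j := t))) (1 - k * p) * (\<Prod>i\<in>I. epow (G i t) p) \<partial>lborel)"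
      by (rule nn_integral_cmult) measurable
    also have "\<dots> \<le> epow (F x) p * (epow (F x) (1 - k * p) * (\<Prod>i\<in>I. epow (\<integral>\<^sup>+s. F (x(i := s)) \<partial>lborel) p))"
    proof (rule mult_left_mono)
      \<comment> \<open>Hoelder over \<open>insert j I\<close>: the index \<open>j\<close> carries
        \<open>f\<close> with weight 1 - k p, and each of the \<open>k\<close> other indices a line
        integral with weight \<open>p\<close>, total 1.\<close>
      define g where "g i t = (if i = j then f (x(j := t)) else G i t)" for i t
      define q where "q i = (if i = j then 1 - k * p else p)" for i
      have "(\<integral>\<^sup>+t. (\<Prod>i\<in>insert j I. epow (g i t) (q i)) \<partial>lborel) \<le> (\<Prod>i\<in>insert j I. epow (\<integral>\<^sup>+t. g i t \<partial>lborel) (q i))"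
      proof (rule holder_nn_integral)
        show "g i \<in> borel_measurable lborel" if "i \<in> insert j I" for i
          using that insert.hyps by (auto simp: g_def[abs_def])
        have "(\<Sum>i\<in>I. q i) = (\<Sum>i\<in>I. p)"
          using insert.hyps by (intro sum.cong) (auto simp: q_def)
        then show "(\<Sum>i\<in>insert j I. q i) = 1"
          using insert.hyps by (simp add: q_def k_def)
      qed (use insert.hyps insert.prems kp in \<open>auto simp: q_def\<close>)
      also have "(\<lambda>t. \<Prod>i\<in>insert j I. epow (g i t) (q i)) = (\<lambda>t. epow (f (x(j := t))) (1 - k * p) * (\<Prod>i\<in>I. epow (G i t) p))"
      proof
        fix t
        have "(\<Prod>i\<in>I. epow (g i t) (q i)) = (\<Prod>i\<in>I. epow (G i t) p)"
          using insert.hyps by (intro prod.cong) (auto simp: g_def q_def)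
        then show "(\<Prod>i\<in>insert j I. epow (g i t) (q i)) = epow (f (x(j := t))) (1 - k * p) * (\<Prod>i\<in>I. epow (G i t) p)"
          using insert.hyps by (simp add: g_def q_def)
      qed
      also have "(\<Prod>i\<in>insert j I. epow (\<integral>\<^sup>+t. g i t \<partial>lborel) (q i)) =
          epow (F x) (1 - k * p) * (\<Prod>i\<in>I. epow (\<integral>\<^sup>+s. F (x(i := s)) \<partial>lborel) p)"
      proof -
        have "(\<Prod>i\<in>I. epow (\<integral>\<^sup>+t. g i t \<partial>lborel) (q i)) = (\<Prod>i\<in>I. epow (\<integral>\<^sup>+s. F (x(i := s)) \<partial>lborel) p)"
          using insert.hyps by (intro prod.cong) (auto simp: g_def q_def G_int)
        then show ?thesis
          using insert.hyps by (simp add: g_def q_def F_def)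
      qed
      finally show "(\<integral>\<^sup>+t. epow (f (x(j := t))) (1 - k * p) * (\<Prod>i\<in>I. epow (G i t) p) \<partial>lborel) \<le>
        epow (F x) (1 - k * p) * (\<Prod>i\<in>I. epow (\<integral>\<^sup>+s. F (x(i := s)) \<partial>lborel) p)" .
    qed simp
    also have "\<dots> = epow (F x) (1 - (k - 1) * p) * (\<Prod>i\<in>I. epow (\<integral>\<^sup>+s. F (x(i := s)) \<partial>lborel) p)"
    proof -
      have "epow (F x) (p + (1 - k * p)) = epow (F x) p * epow (F x) (1 - k * p)"
        using insert.prems kp by (intro epow_add) auto
      moreover have "p + (1 - k * p) = 1 - (k - 1) * p" by (simp add: algebra_simps)
      ultimately show ?thesis by (simp add: mult.assoc)
    qed
    finally show ?thesis .
  qed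
  have "(\<integral>\<^sup>+x. epow (f x) (1 - k * p) * (\<Prod>i\<in>insert j I. epow (\<integral>\<^sup>+s. f (x(i := s)) \<partial>lborel) p) \<partial>?M (insert j I)) =
    (\<integral>\<^sup>+x. (\<integral>\<^sup>+t. epow (f (x(j := t))) (1 - k * p) *
      (\<Prod>i\<in>insert j I. epow (\<integral>\<^sup>+s. f ((x(j := t))(i := s)) \<partial>lborel) p) \<partial>lborel) \<partial>?M I)"
    using insert.hyps
    by (intro lborel_product.product_nn_integral_insert borel_measurable_times_ennreal epow_measurable
        borel_measurable_prod_ennreal line_meas insert.prems(1)) auto
  also have "\<dots> \<le> (\<integral>\<^sup>+x. epow (F x) (1 - (k - 1) * p) * (\<Prod>i\<in>I. epow (\<integral>\<^sup>+s. F (x(i := s)) \<partial>lborel) p) \<partial>?M I)"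
    by (intro nn_integral_mono inner)
  also have "\<dots> \<le> epow (\<integral>\<^sup>+x. F x \<partial>?M I) (1 + p)"
    unfolding k_def using insert.prems kp
    by (intro insert.IH F_meas) (auto simp: k_def algebra_simps)
  also have "(\<integral>\<^sup>+x. F x \<partial>?M I) = (\<integral>\<^sup>+x. f x \<partial>?M (insert j I))"
    unfolding F_def using insert.hyps insert.prems
    by (intro lborel_product.product_nn_integral_insert[symmetric]) auto
  finally show ?case by (simp only: k)
qed

text \<open>Multiplying the bounds in all coordinate directions bounds \<open>u\<close> by a product
  of line integrals of \<open>g\<close>, which is the left side of \<open>grid_lines\<close>. Later
  \<open>u\<close> is a power of |v| and \<open>g\<close> dominates its derivatives.\<close>

lemma gagliardo_nirenberg_1:
  fixes u :: "'a::euclidean_space \<Rightarrow> ennreal"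
  assumes [measurable]: "u \<in> borel_measurable borel" "g \<in> borel_measurable borel"
    and bound: "\<And>x b. b \<in> Basis \<Longrightarrow> u x \<le> (\<integral>\<^sup>+t. g (x + t *\<^sub>R b) \<partial>lborel)"
    and dim: "DIM('a) \<ge> 2"
  shows "(\<integral>\<^sup>+x. epow (u x) (real DIM('a) / (real DIM('a) - 1)) \<partial>lborel)
    \<le> epow (\<integral>\<^sup>+x. g x \<partial>lborel) (real DIM('a) / (real DIM('a) - 1))"
proof -
  define n where "n = real DIM('a)"
  have n: "n \<ge> 2" using dim by (simp add: n_def)
  \<comment> \<open>This value makes (n - 1) p = 1, so the factor of \<open>g\<close> outside the
    line integrals has exponent 0.\<close>
  define p where "p = 1 / (n - 1)"
  have p: "p > 0" "(n - 1) * p = 1" "1 + p = n / (n - 1)" "n * p = n / (n - 1)"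
    using n by (auto simp: p_def field_simps)
  define X where "X f = (\<Sum>b\<in>Basis. f b *\<^sub>R b)" for f :: "'a \<Rightarrow> real"
  let ?P = "(\<Pi>\<^sub>M b\<in>Basis. lborel) :: ('a \<Rightarrow> real) measure"
  have X_meas [measurable]: "X \<in> ?P \<rightarrow>\<^sub>M borel"
    unfolding X_def by measurable
  have int: "(\<integral>\<^sup>+x. h x \<partial>lborel) = (\<integral>\<^sup>+f. h (X f) \<partial>?P)" if [measurable]: "h \<in> borel_measurable borel" for h :: "'a \<Rightarrow> ennreal"
    by (subst lborel_eq) (simp add: nn_integral_distr X_def[symmetric])
  have X_upd: "X (f(b := t)) = X f + (t - f b) *\<^sub>R b" if "b \<in> Basis" for f b t
  proof -
    have "X (f(b := t)) = t *\<^sub>R b + (\<Sum>c\<in>Basis - {b}. f c *\<^sub>R c)"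
      unfolding X_def using that by (subst sum.remove[of _ b]) (auto intro!: sum.cong)
    moreover have "X f = f b *\<^sub>R b + (\<Sum>c\<in>Basis - {b}. f c *\<^sub>R c)"
      unfolding X_def using that by (subst sum.remove[of _ b]) auto
    ultimately show ?thesis by (simp add: algebra_simps)
  qed
  have line: "(\<integral>\<^sup>+t. g (X (f(b := t))) \<partial>lborel) = (\<integral>\<^sup>+t. g (X f + t *\<^sub>R b) \<partial>lborel)" if "b \<in> Basis" for f b
  proof -
    have "(\<integral>\<^sup>+t. g (X f + t *\<^sub>R b) \<partial>lborel) = (\<integral>\<^sup>+t. g (X f + (- f b + 1 * t) *\<^sub>R b) \<partial>lborel)"
      by (subst nn_integral_real_affine[where c=1 and t="- f b"]) auto
    then show ?thesis
      by (simp add: X_upd[OF that] algebra_simps)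
  qed
  have "(\<integral>\<^sup>+x. epow (u x) (n / (n - 1)) \<partial>lborel) = (\<integral>\<^sup>+f. epow (u (X f)) (n * p) \<partial>?P)"
    by (subst int) (simp_all add: p)
  also have "\<dots> \<le> (\<integral>\<^sup>+f. epow (g (X f)) (1 - (real (card (Basis :: 'a set)) - 1) * p) *
      (\<Prod>b\<in>Basis. epow (\<integral>\<^sup>+t. g (X (f(b := t))) \<partial>lborel) p) \<partial>?P)"
  proof (rule nn_integral_mono)
    fix f
    have "epow (u (X f)) (n * p) = (\<Prod>b\<in>(Basis :: 'a set). epow (u (X f)) p)"
    proof -
      have "epow z (real k * p) = epow z p ^ k" for z k
        using p(1) by (induction k) (auto simp: distrib_right epow_add)
      then show ?thesis by (simp add: n_def)
    qed
    also have "\<dots> \<le> (\<Prod>b\<in>Basis. epow (\<integral>\<^sup>+t. g (X (f(b := t))) \<partial>lborel) p)"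
      using bound p(1) by (intro prod_mono_ennreal epow_mono) (auto simp: line)
    finally show "epow (u (X f)) (n * p) \<le> epow (g (X f)) (1 - (real (card (Basis :: 'a set)) - 1) * p) *
      (\<Prod>b\<in>Basis. epow (\<integral>\<^sup>+t. g (X (f(b := t))) \<partial>lborel) p)"
      using p(2) by (simp add: n_def)
  qed
  also have "\<dots> \<le> epow (\<integral>\<^sup>+f. g (X f) \<partial>?P) (1 + p)"
    using p by (intro grid_lines) (auto simp: n_def)
  also have "\<dots> = epow (\<integral>\<^sup>+x. g x \<partial>lborel) (n / (n - 1))"
    by (simp add: int p)
  finally show ?thesis by (simp add: n_def)
qed

section \<open>The Sobolev inequality for derivatives of higher order\<close>

lemma abs_powr_has_derivative:
  assumes c: "c > 1"
  shows "((\<lambda>t. \<bar>t\<bar> powr c) has_real_derivative (c * \<bar>t\<bar> powr (c - 1) * sgn t)) (at t)"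
proof -
  consider "t > 0" | "t < 0" | "t = 0" by linarith
  then show ?thesis
  proof cases
    case 1
    have "((\<lambda>t. t powr c) has_real_derivative (c * t powr (c - 1))) (at t)"
      using 1 by (rule has_real_derivative_powr)
    then have "((\<lambda>t. \<bar>t\<bar> powr c) has_real_derivative (c * t powr (c - 1))) (at t)"
      by (rule has_field_derivative_transform_within_open[of _ _ _ "{0<..}"]) (use 1 in auto)
    then show ?thesis using 1 by simp
  next
    case 2
    have "((\<lambda>t. (- t) powr c) has_real_derivative (c * (- t) powr (c - 1) * (- 1))) (at t)"
      using 2 by (auto intro!: derivative_eq_intros)
    then have "((\<lambda>t. \<bar>t\<bar> powr c) has_real_derivative (c * (- t) powr (c - 1) * (- 1))) (at t)"
      by (rule has_field_derivative_transform_within_open[of _ _ _ "{..<0}"]) (use 2 in auto)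
    then show ?thesis using 2 by simp
  next
    case 3
    have "((\<lambda>h::real. h powr (c - 1)) \<longlongrightarrow> 0) (at_right 0)"
      using c by real_asymp
    moreover have "\<forall>\<^sub>F h in at_right 0. h powr (c - 1) = \<bar>h\<bar> powr c / h"
      by (simp add: eventually_at_filter powr_diff)
    ultimately have "((\<lambda>h::real. \<bar>h\<bar> powr c / h) \<longlongrightarrow> 0) (at_right 0)"
      by (rule Lim_transform_eventually)
    moreover have "((\<lambda>h::real. \<bar>h\<bar> powr c / h) \<longlongrightarrow> 0) (at_left 0)"
    proof (rule Lim_transform_eventually)
      show "((\<lambda>h::real. - ((- h) powr (c - 1))) \<longlongrightarrow> 0) (at_left 0)"
        using c by real_asymp
      show "\<forall>\<^sub>F h in at_left 0. - ((- h) powr (c - 1)) = \<bar>h\<bar> powr c / h"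
        by (simp add: eventually_at_filter powr_diff)
    qed
    ultimately have "((\<lambda>h::real. \<bar>h\<bar> powr c / h) \<longlongrightarrow> 0) (at 0)"
      by (simp add: filterlim_split_at)
    then show ?thesis
      using 3 c by (simp add: DERIV_def)
  qed
qed

lemma isCont_abs_powr_sgn:
  assumes c: "c > 0"
  shows "isCont (\<lambda>t::real. \<bar>t\<bar> powr c * sgn t) t"
proof (cases "t = 0")
  case False
  then show ?thesis
    using c by (intro continuous_intros) (auto simp: sgn_if)
next
  case True
  have "((\<lambda>t::real. \<bar>t\<bar> powr c * sgn t) \<longlongrightarrow> 0) (at 0)"
  proof (rule Lim_null_comparison)
    show "\<forall>\<^sub>F t in at 0. norm (\<bar>t\<bar> powr c * sgn t) \<le> \<bar>t\<bar> powr c"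
      by (simp add: abs_mult abs_sgn_eq)
    have "((\<lambda>t::real. \<bar>t\<bar>) \<longlongrightarrow> \<bar>0\<bar>) (at 0)"
      by (intro tendsto_intros)
    then have "((\<lambda>t::real. \<bar>t\<bar> powr c) \<longlongrightarrow> \<bar>0\<bar> powr c) (at 0)"
      by (rule tendsto_powr'[OF _ tendsto_const]) (use c in auto)
    then show "((\<lambda>t::real. \<bar>t\<bar> powr c) \<longlongrightarrow> 0) (at 0)" using c by simp
  qed
  then show ?thesis using True by (simp add: isCont_def)
qed

lemma continuous_abs_powr: "0 < c \<Longrightarrow> continuous_on UNIV f \<Longrightarrow> continuous_on UNIV (\<lambda>x. \<bar>f x :: real\<bar> powr c)"
  by (intro continuous_on_powr' continuous_intros) auto

lemma test_continuous: "v \<in> test_functions U \<Longrightarrow> continuous_on A v"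
  by (intro smooth_continuous_on test_smooth)

lemma test_powr_integrable:
  assumes v: "v \<in> test_functions U" and r: "r > 0"
  shows "integrable lborel (\<lambda>x. \<bar>v x\<bar> powr r)"
proof -
  obtain K where K: "smooth v" "compact K" "K \<subseteq> U" "\<And>x. x \<notin> K \<Longrightarrow> v x = 0"
    using test_functionsE[OF v] by blast
  show ?thesis
  proof (rule continuous_compact_support_integrable[OF _ K(2)])
    show "continuous_on UNIV (\<lambda>x. \<bar>v x\<bar> powr r)"
      by (intro continuous_abs_powr r smooth_continuous_on K(1))
  qed (use K(4) in simp)
qed

text \<open>The fundamental theorem of calculus on the line through \<open>x\<close>, started at a
  point beyond the support. For \<open>c > 1\<close> the power |v|^c is continuously differentiable
  even where \<open>v\<close> vanishes.\<close>

lemma abs_powr_le_line_integral: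
  fixes v :: "real^'n \<Rightarrow> real" and i :: 'n
  assumes v: "v \<in> test_functions UNIV" and c: "c > 1"
  shows "ennreal (\<bar>v x\<bar> powr c) \<le>
    (\<integral>\<^sup>+t. ennreal (c * \<bar>v (x + t *\<^sub>R axis i 1)\<bar> powr (c - 1) * \<bar>pd i v (x + t *\<^sub>R axis i 1)\<bar>) \<partial>lborel)"
proof -
  obtain K where K: "smooth v" "compact K" "\<And>x. x \<notin> K \<Longrightarrow> v x = 0"
    by (rule test_functionsE[OF v]) metis
  obtain R where R: "\<And>x. x \<in> K \<Longrightarrow> norm x \<le> R"
    using K(2) compact_imp_bounded bounded_iff by metis
  \<comment> \<open>Long enough that moving back by \<open>L\<close> from \<open>x\<close> leaves
    the ball of radius \<open>R\<close> containing the support.\<close>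
  define L where "L = norm x + \<bar>R\<bar> + 1"
  have L: "L \<ge> 0" by (simp add: L_def)
  have v0: "v (x + (- L) *\<^sub>R axis i 1) = 0"
  proof (rule K(3), rule notI)
    assume "x + (- L) *\<^sub>R axis i 1 \<in> K"
    then have "norm (x + (- L) *\<^sub>R axis i 1) \<le> R" by (rule R)
    moreover have "norm ((- L) *\<^sub>R (axis i 1 :: real^'n)) \<le> norm (x + (- L) *\<^sub>R axis i 1) + norm x"
      by (metis add_diff_cancel_left' norm_triangle_ineq4)
    ultimately have "L \<le> R + norm x" using L by simp
    then show False by (simp add: L_def)
  qed
  define w where "w t = v (x + t *\<^sub>R axis i 1)" for t
  define w' where "w' t = pd i v (x + t *\<^sub>R axis i 1)" for t
  have w: "(w has_real_derivative w' t) (at t)" for t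
    unfolding w_def w'_def by (rule has_real_derivative_along_axis[OF K(1)])
  define h where "h t = (c * (\<bar>w t\<bar> powr (c - 1) * sgn (w t))) * w' t" for t
  have w'_cont: "isCont w' t" for t
  proof -
    have "((\<lambda>t. w' t) has_real_derivative pd i (pd i v) (x + t *\<^sub>R axis i 1)) (at t)"
      unfolding w'_def by (rule has_real_derivative_along_axis[OF smooth_pd[OF K(1)]])
    then show ?thesis by (rule DERIV_isCont)
  qed
  have h_cont: "isCont h t" for t
    unfolding h_def
    by (intro isCont_mult isCont_o2[OF DERIV_isCont[OF w] isCont_abs_powr_sgn] w'_cont continuous_const)
      (use c in auto)
  have deriv: "((\<lambda>t. \<bar>w t\<bar> powr c) has_real_derivative h t) (at t)" for t
    using DERIV_chain2[OF abs_powr_has_derivative[OF c] w, of t] by (simp add: h_def mult_ac)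
  have "(\<integral>t. h t * indicator {- L..0} t \<partial>lborel) = \<bar>w 0\<bar> powr c - \<bar>w (- L)\<bar> powr c"
    using L by (intro integral_FTC_Icc_real deriv h_cont) auto
  also have "\<dots> = \<bar>v x\<bar> powr c"
    using v0 c by (simp add: w_def)
  finally have eq: "(\<integral>t. h t * indicator {- L..0} t \<partial>lborel) = \<bar>v x\<bar> powr c" .
  have int: "integrable lborel (\<lambda>t. h t * indicator {- L..0} t)"
    using borel_integrable_atLeastAtMost[of "- L" 0 h] h_cont by (simp add: mult.commute)
  have "ennreal (\<bar>v x\<bar> powr c) = ennreal (norm (\<integral>t. h t * indicator {- L..0} t \<partial>lborel))"
    by (simp add: eq)
  also have "\<dots> \<le> (\<integral>\<^sup>+t. ennreal (norm (h t * indicator {- L..0} t)) \<partial>lborel)"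
    by (rule integral_norm_bound_ennreal[OF int])
  also have "\<dots> \<le> (\<integral>\<^sup>+t. ennreal (c * \<bar>w t\<bar> powr (c - 1) * \<bar>w' t\<bar>) \<partial>lborel)"
  proof (intro nn_integral_mono ennreal_leI)
    fix t
    have "norm (h t * indicator {- L..0} t) \<le> \<bar>h t\<bar>"
      by (auto simp: indicator_def)
    also have "\<dots> \<le> c * \<bar>w t\<bar> powr (c - 1) * \<bar>w' t\<bar>"
      using c by (auto simp: h_def abs_mult sgn_if intro!: mult_nonneg_nonneg)
    finally show "norm (h t * indicator {- L..0} t) \<le> c * \<bar>w t\<bar> powr (c - 1) * \<bar>w' t\<bar>" .
  qed
  finally show ?thesis by (simp add: w_def w'_def)
qed

definition powr_int :: "real \<Rightarrow> (real^'n \<Rightarrow> real) \<Rightarrow> real" where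
  "powr_int r v = (LINT x|lborel. \<bar>v x\<bar> powr r)"

lemma powr_int_nonneg [simp]: "0 \<le> powr_int r v"
  by (simp add: powr_int_def)

lemma powr_sum_le:
  fixes a :: "'i \<Rightarrow> real"
  assumes S: "finite S" "S \<noteq> {}" and a: "\<And>i. i \<in> S \<Longrightarrow> 0 \<le> a i" and q: "0 < q"
  shows "(\<Sum>i\<in>S. a i) powr q \<le> real (card S) powr q * (\<Sum>i\<in>S. a i powr q)"
proof -
  define M where "M = Max (a ` S)"
  have "M \<in> a ` S" unfolding M_def using S by (intro Max_in) auto
  then obtain j where j: "j \<in> S" "M = a j" by auto
  have le: "a i \<le> M" if "i \<in> S" for i
    unfolding M_def using S that by (intro Max_ge) auto
  have "(\<Sum>i\<in>S. a i) \<le> real (card S) * M"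
    using sum_bounded_above[of S a M] le by simp
  then have "(\<Sum>i\<in>S. a i) powr q \<le> (real (card S) * M) powr q"
    using a q by (intro powr_mono2) (auto intro: sum_nonneg)
  also have "\<dots> = real (card S) powr q * M powr q"
    using a[OF j(1)] j by (simp add: powr_mult)
  also have "\<dots> \<le> real (card S) powr q * (\<Sum>i\<in>S. a i powr q)"
    unfolding j(2) using S j(1) by (intro mult_left_mono member_le_sum) auto
  finally show ?thesis .
qed

text \<open>The L^1 inequality is applied to |v|^c, and Hoelder separates |v|^(c-1) from the
  gradient. The power of the integral of |v|^r that appears on the right is then absorbed.\<close>

lemma sobolev_step:
  assumes p: "1 < p" "p < real CARD('n)" and n: "CARD('n) \<ge> 2"
    and r: "r = real CARD('n) * p / (real CARD('n) - p)"
  shows "\<exists>C\<ge>0. \<forall>v\<in>test_functions (UNIV :: (real^'n) set).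
    powr_int r v powr (1 / r) \<le> C * (\<Sum>i\<in>UNIV. powr_int p (pd i v) powr (1 / p))"
proof -
  define n where "n = real CARD('n)"
  have n2: "n \<ge> 2" "p < n" using n p by (auto simp: n_def)
  then have nz: "n - 1 \<noteq> 0" "n - p \<noteq> 0" "n \<noteq> 0" by auto
  \<comment> \<open>Chosen so that c n / (n - 1) = r and (c - 1) p / (p - 1) = r: both sides then
    contain the same integral of |v|^r.\<close>
  define c where "c = p * (n - 1) / (n - p)"
  have r': "r = n * p / (n - p)" using r by (simp add: n_def)
  have rpos: "r > 0" using n2 p by (simp add: r')
  have "(p - 1) * n > 0" using p n2 by simp
  then have c: "c > 1" using n2 by (simp add: c_def field_simps)
  have cr: "c * (n / (n - 1)) = r" using nz by (simp add: c_def r')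
  have c1: "c - 1 = r * (1 - 1 / p)"
    using n2 p by (simp add: c_def r' field_simps)
  have rinv: "(n - 1) / n - (1 - 1 / p) = 1 / r"
    using n2 p by (simp add: r' field_simps)
  define C where "C = c * (n * n powr (1 / p))"
  have "powr_int r v powr (1 / r) \<le> C * (\<Sum>i\<in>UNIV. powr_int p (pd i v) powr (1 / p))"
    if v: "v \<in> test_functions (UNIV :: (real^'n) set)" for v
  proof -
    define s where "s x = (\<Sum>i\<in>UNIV. \<bar>pd i v x\<bar>)" for x
    define X where "X = powr_int r v"
    define Y where "Y = (LINT x|lborel. s x powr p)"
    have sm: "smooth v" by (rule test_smooth[OF v])
    have [measurable]: "v \<in> borel_measurable borel" by (rule smooth_borel[OF sm])
    have [measurable]: "pd i v \<in> borel_measurable borel" for i by (rule smooth_borel[OF smooth_pd[OF sm]])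
    have s_meas [measurable]: "s \<in> borel_measurable borel" unfolding s_def by measurable
    have s0: "s x \<ge> 0" for x by (simp add: s_def sum_nonneg)
    have sp_le: "s x powr p \<le> n powr p * (\<Sum>i\<in>UNIV. \<bar>pd i v x\<bar> powr p)" for x
      unfolding s_def n_def using p by (intro powr_sum_le) auto
    have pd_int: "integrable lborel (\<lambda>x. \<bar>pd i v x\<bar> powr p)" for i
      by (rule test_powr_integrable[OF test_pd[OF v]]) (use p in simp)
    have bnd_int: "integrable lborel (\<lambda>x. n powr p * (\<Sum>i\<in>UNIV. \<bar>pd i v x\<bar> powr p))"
      using pd_int by simp
    have sp_int: "integrable lborel (\<lambda>x. s x powr p)"
      by (rule Bochner_Integration.integrable_bound[OF bnd_int])
        (use sp_le in \<open>auto simp: sum_nonneg\<close>)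
    have Y_le: "Y \<le> n powr p * (\<Sum>i\<in>UNIV. powr_int p (pd i v))"
    proof -
      have "Y \<le> (LINT x|lborel. n powr p * (\<Sum>i\<in>UNIV. \<bar>pd i v x\<bar> powr p))"
        unfolding Y_def by (intro integral_mono sp_int bnd_int sp_le)
      also have "\<dots> = n powr p * (\<Sum>i\<in>UNIV. powr_int p (pd i v))"
        using pd_int by (simp add: powr_int_def)
      finally show ?thesis .
    qed
    have Y0: "Y \<ge> 0" by (simp add: Y_def)
    have vr_int: "integrable lborel (\<lambda>x. \<bar>v x\<bar> powr r)"
      by (rule test_powr_integrable[OF v rpos])
    have X_nn: "(\<integral>\<^sup>+x. ennreal (\<bar>v x\<bar> powr r) \<partial>lborel) = ennreal X"
      unfolding X_def powr_int_def by (rule nn_integral_eq_integral[OF vr_int]) simp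
    have Y_nn: "(\<integral>\<^sup>+x. ennreal (s x powr p) \<partial>lborel) = ennreal Y"
      unfolding Y_def by (rule nn_integral_eq_integral[OF sp_int]) simp
    define g where "g x = ennreal (c * \<bar>v x\<bar> powr (c - 1) * s x)" for x
    have g_meas [measurable]: "g \<in> borel_measurable borel" unfolding g_def by measurable
    have GNS: "(\<integral>\<^sup>+x. epow (ennreal (\<bar>v x\<bar> powr c)) (n / (n - 1)) \<partial>lborel) \<le>
        epow (\<integral>\<^sup>+x. g x \<partial>lborel) (n / (n - 1))"
    proof -
      have "DIM(real^'n) \<ge> 2" using n by simp
      moreover have "ennreal (\<bar>v x\<bar> powr c) \<le> (\<integral>\<^sup>+t. g (x + t *\<^sub>R b) \<partial>lborel)" if b: "b \<in> Basis" for x b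
      proof -
        obtain i where i: "b = axis i 1" using b by (auto simp: Basis_vec_def)
        have "(\<integral>\<^sup>+t. ennreal (c * \<bar>v (x + t *\<^sub>R axis i 1)\<bar> powr (c - 1) * \<bar>pd i v (x + t *\<^sub>R axis i 1)\<bar>) \<partial>lborel)
           \<le> (\<integral>\<^sup>+t. g (x + t *\<^sub>R b) \<partial>lborel)"
          unfolding g_def i using c
          by (intro nn_integral_mono ennreal_leI mult_left_mono) (auto simp: s_def intro!: member_le_sum)
        with abs_powr_le_line_integral[OF v c, of x i] show ?thesis by (rule order_trans)
      qed
      ultimately show ?thesis
        using gagliardo_nirenberg_1[of "\<lambda>x. ennreal (\<bar>v x\<bar> powr c)" g] by (simp add: n_def)
    qed
    have lhs: "(\<integral>\<^sup>+x. epow (ennreal (\<bar>v x\<bar> powr c)) (n / (n - 1)) \<partial>lborel) = ennreal X"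
      using n2 cr by (subst X_nn[symmetric], intro nn_integral_cong) (simp add: epow_ennreal powr_powr)
    have hol: "(\<integral>\<^sup>+x. g x \<partial>lborel) \<le> ennreal c * (epow (ennreal X) (1 - 1 / p) * epow (ennreal Y) (1 / p))"
    proof -
      have "(\<integral>\<^sup>+x. g x \<partial>lborel) = (\<integral>\<^sup>+x. ennreal c * (epow (ennreal (\<bar>v x\<bar> powr r)) (1 - 1 / p) * epow (ennreal (s x powr p)) (1 / p)) \<partial>lborel)"
      proof (rule nn_integral_cong)
        fix x
        have "epow (ennreal (\<bar>v x\<bar> powr r)) (1 - 1 / p) = ennreal (\<bar>v x\<bar> powr (c - 1))"
          using p by (simp add: epow_ennreal powr_powr c1)
        moreover have "epow (ennreal (s x powr p)) (1 / p) = ennreal (s x)"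
          using p s0[of x] by (simp add: epow_ennreal powr_powr)
        ultimately show "g x = ennreal c * (epow (ennreal (\<bar>v x\<bar> powr r)) (1 - 1 / p) * epow (ennreal (s x powr p)) (1 / p))"
          using c s0[of x] by (simp add: g_def mult.assoc flip: ennreal_mult)
      qed
      also have "\<dots> = ennreal c * (\<integral>\<^sup>+x. epow (ennreal (\<bar>v x\<bar> powr r)) (1 - 1 / p) * epow (ennreal (s x powr p)) (1 / p) \<partial>lborel)"
        by (rule nn_integral_cmult) measurable
      also have "\<dots> \<le> ennreal c * (epow (ennreal X) (1 - 1 / p) * epow (ennreal Y) (1 / p))"
        unfolding X_nn[symmetric] Y_nn[symmetric] using p
        by (intro mult_left_mono holder_nn_integral_2) auto
      finally show ?thesis .
    qed
    have X0: "X \<ge> 0" by (simp add: X_def)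
    have key: "X powr ((n - 1) / n) \<le> c * (X powr (1 - 1 / p) * Y powr (1 / p))"
    proof -
      let ?Z = "c * (X powr (1 - 1 / p) * Y powr (1 / p))"
      have Z0: "?Z \<ge> 0" using c by simp
      have "ennreal X \<le> epow (ennreal c * (epow (ennreal X) (1 - 1 / p) * epow (ennreal Y) (1 / p))) (n / (n - 1))"
        using order_trans[OF GNS epow_mono[OF _ hol]] n2 by (simp add: lhs)
      also have "\<dots> = ennreal (?Z powr (n / (n - 1)))"
        using n2 p c X0 Y0 by (simp add: epow_ennreal flip: ennreal_mult)
      finally have "X \<le> ?Z powr (n / (n - 1))"
        by (simp add: ennreal_le_iff)
      then have "X powr ((n - 1) / n) \<le> (?Z powr (n / (n - 1))) powr ((n - 1) / n)"
        using X0 n2 by (intro powr_mono2) auto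
      also have "\<dots> = ?Z"
        using n2 Z0 by (simp add: powr_powr)
      finally show ?thesis .
    qed
    \<comment> \<open>Dividing by X^(1 - 1/p) leaves the exponent (n - 1)/n - (1 - 1/p) = 1/p - 1/n
      = 1/r; this is possible when \<open>X\<close> is nonzero.\<close>
    have main: "X powr (1 / r) \<le> c * Y powr (1 / p)"
    proof (cases "X = 0")
      case True
      then show ?thesis using c by simp
    next
      case False
      then have "X powr (1 - 1 / p) > 0" using X0 by simp
      moreover have "X powr ((n - 1) / n) = X powr (1 - 1 / p) * X powr (1 / r)"
        unfolding powr_add[symmetric] rinv[symmetric] by simp
      ultimately show ?thesis
        using key by (simp add: mult.left_commute[of c])
    qed
    have "Y powr (1 / p) \<le> (n powr p * (\<Sum>i\<in>UNIV. powr_int p (pd i v))) powr (1 / p)"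
      using Y_le Y0 p by (intro powr_mono2) auto
    also have "\<dots> = n * (\<Sum>i\<in>UNIV. powr_int p (pd i v)) powr (1 / p)"
      using p n2 by (simp add: powr_mult sum_nonneg powr_powr)
    also have "\<dots> \<le> n * (n powr (1 / p) * (\<Sum>i\<in>UNIV. powr_int p (pd i v) powr (1 / p)))"
      unfolding n_def using p by (intro mult_left_mono powr_sum_le) auto
    finally have "c * Y powr (1 / p) \<le> c * (n * (n powr (1 / p) * (\<Sum>i\<in>UNIV. powr_int p (pd i v) powr (1 / p))))"
      using c by (intro mult_left_mono) auto
    with main show ?thesis
      by (simp add: X_def C_def mult.assoc)
  qed
  moreover have "C \<ge> 0" using c n2 by (simp add: C_def)
  ultimately show ?thesis by blast
qed

text \<open>The exponents 2n/(n - 2k) form the orbit of 2 under p -> np/(n - p). Each step costs one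
  derivative, and the induction hypothesis is applied to the functions
  \<open>pd i v\<close>.\<close>

lemma sobolev_iterated:
  assumes "2 * k < CARD('n)" "CARD('n) \<ge> 2"
  shows "\<exists>C\<ge>0. \<forall>v\<in>test_functions (UNIV :: (real^'n) set).
    powr_int (2 * real CARD('n) / (real CARD('n) - 2 * real k)) v powr ((real CARD('n) - 2 * real k) / (2 * real CARD('n)))
      \<le> C * (\<Sum>is | length is = k. sqrt (LINT x|lborel. (partial_deriv is v x)\<^sup>2))"
  using assms(1)
proof (induction k)
  case 0
  have "powr_int 2 v powr (1 / 2) = sqrt (LINT x|lborel. (v x)\<^sup>2)" for v :: "real^'n \<Rightarrow> real"
    by (simp add: powr_int_def powr_half_sqrt)
  then show ?case
    by (intro exI[of _ 1]) auto
next
  case (Suc k)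
  define n where "n = real CARD('n)"
  have nk: "2 * real k + 2 < n" using Suc.prems by (simp add: n_def)
  define p where "p = 2 * n / (n - 2 * real k)"
  define r where "r = 2 * n / (n - 2 * real (Suc k))"
  have "n * 2 < n * (n - 2 * real k)"
    using nk by (intro mult_strict_left_mono) auto
  then have p: "1 < p" "p < n" using nk by (auto simp: p_def field_simps)
  have r: "r = n * p / (n - p)"
  proof -
    define a where "a = n - 2 * real k"
    have nz: "a \<noteq> 0" "a - 2 \<noteq> 0" "n \<noteq> 0" using nk by (auto simp: a_def)
    have pa: "p = 2 * n / a" by (simp add: p_def a_def)
    have "n - p = n * (a - 2) / a"
      using nz by (simp add: pa field_simps)
    moreover have "r = 2 * n / (a - 2)" by (simp add: r_def a_def algebra_simps)
    ultimately show ?thesis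
      using nz by (simp add: pa)
  qed
  obtain C where C: "C \<ge> 0" "\<And>v. v \<in> test_functions (UNIV :: (real^'n) set) \<Longrightarrow>
    powr_int p v powr (1 / p) \<le> C * (\<Sum>is | length is = k. sqrt (LINT x|lborel. (partial_deriv is v x)\<^sup>2))"
    using Suc by (auto simp: p_def n_def)
  obtain C' where C': "C' \<ge> 0" "\<And>v. v \<in> test_functions (UNIV :: (real^'n) set) \<Longrightarrow>
    powr_int r v powr (1 / r) \<le> C' * (\<Sum>i\<in>UNIV. powr_int p (pd i v) powr (1 / p))"
    using sobolev_step[where 'n='n, of p r] p r assms(2) by (auto simp: n_def)
  have "powr_int r v powr (1 / r) \<le> C' * C * (\<Sum>is | length is = Suc k. sqrt (LINT x|lborel. (partial_deriv is v x)\<^sup>2))"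
    if v: "v \<in> test_functions (UNIV :: (real^'n) set)" for v
  proof -
    have "powr_int r v powr (1 / r) \<le> C' * (\<Sum>i\<in>UNIV. powr_int p (pd i v) powr (1 / p))"
      by (rule C'(2)[OF v])
    also have "\<dots> \<le> C' * (\<Sum>i\<in>UNIV. C * (\<Sum>is | length is = k. sqrt (LINT x|lborel. (partial_deriv is (pd i v) x)\<^sup>2)))"
      using C' by (intro mult_left_mono sum_mono C test_pd v)
    also have "\<dots> = C' * C * (\<Sum>is | length is = Suc k. sqrt (LINT x|lborel. (partial_deriv is v x)\<^sup>2))"
      by (simp add: sum_lists_Suc partial_deriv_pd test_smooth[OF v] sum_distrib_left mult.assoc)
    finally show ?thesis .
  qed
  then show ?case
    using C(1) C'(1) by (intro exI[of _ "C' * C"]) (auto simp: r_def n_def)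
qed

lemma sobolev_inequality:
  assumes "2 * m < CARD('n)" "CARD('n) \<ge> 2"
  shows "\<exists>C>0. \<forall>v\<in>test_functions (UNIV :: (real^'n) set).
    (Lp_norm (2 * real CARD('n) / (real CARD('n) - 2 * real m)) UNIV v)\<^sup>2 \<le> C * energy m v"
proof -
  let ?q = "2 * real CARD('n) / (real CARD('n) - 2 * real m)"
  obtain C where C: "C \<ge> 0" "\<And>v. v \<in> test_functions (UNIV :: (real^'n) set) \<Longrightarrow>
    powr_int ?q v powr ((real CARD('n) - 2 * real m) / (2 * real CARD('n)))
      \<le> C * (\<Sum>is | length is = m. sqrt (LINT x|lborel. (partial_deriv is v x)\<^sup>2))"
    using sobolev_iterated[OF assms] by blast
  define L where "L = real (card {is :: 'n list. length is = m})"
  \<comment> \<open>Adding 1 keeps the constant positive even if \<open>C = 0\<close>; the factor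
    \<open>L\<close> comes from Cauchy-Schwarz for the sum of square roots.\<close>
  have "(Lp_norm ?q UNIV v)\<^sup>2 \<le> (C\<^sup>2 * L + 1) * energy m v"
    if v: "v \<in> test_functions (UNIV :: (real^'n) set)" for v
  proof -
    have q: "?q > 0" using assms by simp
    have "(\<lambda>x. \<bar>v x\<bar> powr ?q) \<in> borel_measurable lborel"
      using smooth_borel[OF test_smooth[OF v]] by simp
    then have "Lp_norm ?q UNIV v = powr_int ?q v powr (1 / ?q)"
      unfolding Lp_norm_def powr_int_def by (simp only: lebesgue_on_UNIV_eq integral_completion)
    then have "Lp_norm ?q UNIV v \<le> C * (\<Sum>is | length is = m. sqrt (LINT x|lborel. (partial_deriv is v x)\<^sup>2))"
      using C(2)[OF v] by simp
    then have "(Lp_norm ?q UNIV v)\<^sup>2 \<le> (C * (\<Sum>is | length is = m. sqrt (LINT x|lborel. (partial_deriv is v x)\<^sup>2)))\<^sup>2"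
      by (intro power_mono) (auto simp: Lp_norm_def)
    also have "\<dots> = C\<^sup>2 * (\<Sum>is | length is = m. sqrt (LINT x|lborel. (partial_deriv is v x)\<^sup>2))\<^sup>2"
      by (simp add: power_mult_distrib)
    also have "(\<Sum>is | length is = m. sqrt (LINT x|lborel. (partial_deriv is v x)\<^sup>2))\<^sup>2 \<le>
        (\<Sum>is | length is = m. (sqrt (LINT x|lborel. (partial_deriv is v x)\<^sup>2))\<^sup>2) * (\<Sum>is :: 'n list | length is = m. 1\<^sup>2)"
      using Cauchy_Schwarz_ineq_sum[of "\<lambda>is. sqrt (LINT x|lborel. (partial_deriv is v x)\<^sup>2)" "\<lambda>_. 1" "{is. length is = m}"]
      by simp
    also have "\<dots> = L * energy m v"
      by (simp add: energy_def L_def)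
    finally have "(Lp_norm ?q UNIV v)\<^sup>2 \<le> C\<^sup>2 * (L * energy m v)"
      by (simp add: mult_left_mono)
    also have "\<dots> \<le> (C\<^sup>2 * L + 1) * energy m v"
      using energy_nonneg[of m v] by (simp add: algebra_simps)
    finally show ?thesis .
  qed
  moreover have "C\<^sup>2 * L + 1 > 0" by (simp add: L_def add_nonneg_pos)
  ultimately show ?thesis by blast
qed

section \<open>Positivity of the Sobolev constant\<close>

lemma smooth_nonneg_integral_pos:
  fixes f :: "real^'n \<Rightarrow> real"
  assumes f: "continuous_on UNIV f" "\<And>x. 0 \<le> f x" "f y > 0" and int: "integrable lborel f"
  shows "0 < (LINT x|lborel. f x)"
proof -
  have "(LINT x|lborel. f x) \<noteq> 0"
  proof
    assume "(LINT x|lborel. f x) = 0"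
    then have ae: "AE x in lborel. f x = 0"
      using int f(2) by (subst (asm) integral_nonneg_eq_0_iff_AE) auto
    define U where "U = f -` {0<..}"
    have U: "open U" unfolding U_def by (intro open_vimage open_greaterThan f(1))
    have "AE x in lebesgue. x \<notin> U"
      using AE_completion[OF ae] by eventually_elim (simp add: U_def)
    then have "negligible U"
      using U by (simp add: negligible_iff_null_sets AE_iff_null_sets)
    moreover have "U \<noteq> {}" using f(3) by (auto simp: U_def)
    ultimately show False
      using open_not_negligible[OF U] by blast
  qed
  then show ?thesis
    using f(2) by (simp add: less_le)
qed

text \<open>The admissible constants are exactly the lower bounds of the Rayleigh quotients, so the
  greatest one exists and equals their infimum, which the Sobolev inequality keeps away from
  0.\<close>

lemma sobolev_constant_pos:
  assumes "2 * m < CARD('n)" "CARD('n) \<ge> 2"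
  shows "0 < sobolev_constant TYPE('n::finite) m"
proof -
  let ?q = "2 * real CARD('n) / (real CARD('n) - 2 * real m)"
  let ?T = "test_functions (UNIV :: (real^'n) set)"
  let ?L = "\<lambda>v :: real^'n \<Rightarrow> real. (Lp_norm ?q UNIV v)\<^sup>2"
  have q: "?q > 0" using assms by simp
  obtain C where C: "C > 0" "\<And>v. v \<in> ?T \<Longrightarrow> ?L v \<le> C * energy m v"
    using sobolev_inequality[OF assms] by blast
  have E: "(LINT x|lebesgue. nabla_inner partial_deriv m v v x) = energy m v" if v: "v \<in> ?T" for v
  proof -
    have "(\<lambda>x. nabla_inner partial_deriv m v v x) \<in> borel_measurable lborel"
      unfolding nabla_inner_partial_deriv
      unfolding measurable_lborel2
      by (intro borel_measurable_sum borel_measurable_times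
          smooth_borel[OF smooth_partial_deriv[OF smooth_lap_funpow[OF test_smooth[OF v]]]])
    then show ?thesis
      by (simp only: integral_completion energy_nabla_inner[OF v])
  qed
  \<comment> \<open>A nonzero bump: it makes the set of quotients nonempty, as otherwise every real
    number would be admissible and no greatest one would exist.\<close>
  define b where "b x = flat 0 1 (1 - (x - 0) \<bullet> (x - 0))" for x :: "real^'n"
  have b: "b \<in> ?T"
  proof (rule test_functionsI[of _ "cball 0 1"])
    show "smooth b"
      unfolding b_def by (intro smooth_flat smooth_diff smooth_const smooth_inner_self) simp
    show "b x = 0" if "x \<notin> cball 0 1" for x
      using that by (simp add: b_def flat_def dot_square_norm power_less_one_iff)
  qed auto
  have Lb: "?L b > 0"
  proof -
    have meas: "(\<lambda>x. \<bar>b x\<bar> powr ?q) \<in> borel_measurable lborel"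
      using smooth_borel[OF test_smooth[OF b]] by simp
    have "0 < (LINT x|lborel. \<bar>b x\<bar> powr ?q)"
    proof (rule smooth_nonneg_integral_pos[where y=0])
      show "continuous_on UNIV (\<lambda>x. \<bar>b x\<bar> powr ?q)"
        using q by (intro continuous_abs_powr test_continuous[OF b])
      show "integrable lborel (\<lambda>x. \<bar>b x\<bar> powr ?q)"
        by (rule test_powr_integrable[OF b q])
      show "0 < \<bar>b 0\<bar> powr ?q" by (simp add: b_def flat_def)
    qed simp
    then have "Lp_norm ?q UNIV b > 0"
      unfolding Lp_norm_def using meas
      by (simp only: lebesgue_on_UNIV_eq integral_completion) simp
    then show ?thesis by simp
  qed
  define R where "R = (\<lambda>v. energy m v / ?L v) ` {v \<in> ?T. ?L v > 0}"
  have R_ne: "R \<noteq> {}" using b Lb by (auto simp: R_def)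
  have R_ge: "1 / C \<le> y" if "y \<in> R" for y
    using that C by (auto simp: R_def field_simps)
  have bdd: "bdd_below R" using R_ge by (rule bdd_belowI)
  have iff: "(\<forall>v\<in>?T. S * ?L v \<le> (LINT x|lebesgue. nabla_inner partial_deriv m v v x)) \<longleftrightarrow> (\<forall>y\<in>R. S \<le> y)" for S
  proof
    assume *: "\<forall>v\<in>?T. S * ?L v \<le> (LINT x|lebesgue. nabla_inner partial_deriv m v v x)"
    show "\<forall>y\<in>R. S \<le> y"
    proof
      fix y assume "y \<in> R"
      then obtain v where v: "v \<in> ?T" "?L v > 0" "y = energy m v / ?L v" by (auto simp: R_def)
      have "S * ?L v \<le> energy m v" using * v(1) E by auto
      then show "S \<le> y" using v(2,3) by (simp add: pos_le_divide_eq)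
    qed
  next
    assume *: "\<forall>y\<in>R. S \<le> y"
    show "\<forall>v\<in>?T. S * ?L v \<le> (LINT x|lebesgue. nabla_inner partial_deriv m v v x)"
    proof
      fix v assume v: "v \<in> ?T"
      have "S * ?L v \<le> energy m v"
      proof (cases "?L v > 0")
        case True
        then have "S \<le> energy m v / ?L v" using * v by (auto simp: R_def)
        then show ?thesis using True by (simp add: pos_le_divide_eq)
      next
        case False
        then have "?L v = 0" using zero_le_power2[of "Lp_norm ?q UNIV v"] by linarith
        then show ?thesis using energy_nonneg[of m v] by simp
      qed
      then show "S * ?L v \<le> (LINT x|lebesgue. nabla_inner partial_deriv m v v x)"
        by (simp only: E[OF v])
    qed
  qed
  have "sobolev_constant TYPE('n) m = Inf R"
    unfolding sobolev_constant_def
  proof (rule Greatest_equality)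
    show "\<forall>v\<in>?T. Inf R * ?L v \<le> (LINT x|lebesgue. nabla_inner partial_deriv m v v x)"
      unfolding iff using cInf_lower[OF _ bdd] by blast
    show "S \<le> Inf R" if "\<forall>v\<in>?T. S * ?L v \<le> (LINT x|lebesgue. nabla_inner partial_deriv m v v x)" for S
      using that unfolding iff by (intro cInf_greatest R_ne) blast
  qed
  moreover have "1 / C \<le> Inf R"
    by (intro cInf_greatest R_ne R_ge)
  moreover have "1 / C > 0" using C(1) by simp
  ultimately show ?thesis by linarith
qed

section \<open>The boundary defining function\<close>

lemma pd_inner_self: "pd i (\<lambda>x. (x - y) \<bullet> (x - y)) x = 2 * (x $ i - y $ i)"
proof -
  have "((\<lambda>x. (x - y) \<bullet> (x - y)) has_derivative (\<lambda>h. (x - y) \<bullet> h + h \<bullet> (x - y))) (at x)"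
    by (auto intro!: derivative_eq_intros)
  from pd_eqI[OF this, of i] show ?thesis
    by (simp add: inner_axis inner_axis' algebra_simps)
qed

text \<open>The coefficients do not depend on the one-dimensional profile \<open>K 0\<close>, so that two profiles
  can be compared derivative by derivative.\<close>

lemma partial_deriv_radial:
  fixes "is" :: "'n::finite list"
  obtains c :: "nat \<Rightarrow> real^'n \<Rightarrow> real" where
    "\<And>k. smooth (c k)"
    "\<And>K a x. (\<And>k t. (K k has_real_derivative K (Suc k) t) (at t)) \<Longrightarrow>
      partial_deriv is (\<lambda>x. K 0 (a - x \<bullet> x)) x = (\<Sum>k\<le>length is. c k x * K k (a - x \<bullet> x))"
proof -
  have "\<exists>c :: nat \<Rightarrow> real^'n \<Rightarrow> real. (\<forall>k. smooth (c k)) \<and>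
    (\<forall>K a. (\<forall>k t. (K k has_real_derivative K (Suc k) t) (at t)) \<longrightarrow>
      partial_deriv is (\<lambda>x. K 0 (a - x \<bullet> x)) = (\<lambda>x. \<Sum>k\<le>length is. c k x * K k (a - x \<bullet> x)))"
  proof (induction "is")
    case Nil
    show ?case
      by (intro exI[of _ "\<lambda>k x. 1"]) (auto intro: smooth_const)
  next
    case (Cons i "is")
    then obtain c where c: "\<And>k. smooth (c k)"
      "\<And>K a. (\<forall>k t. (K k has_real_derivative K (Suc k) t) (at t)) \<Longrightarrow>
        partial_deriv is (\<lambda>x. K 0 (a - x \<bullet> x)) = (\<lambda>x. \<Sum>k\<le>length is. c k x * K k (a - x \<bullet> x))"
      by blast
    \<comment> \<open>The first summand is the derivative falling on the coefficient, the second the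
      chain rule, which raises the order of the profile and produces the inner derivative -2
      x_i.\<close>
    define c' where "c' k x = (if k \<le> length is then pd i (c k) x else 0) +
      (if k = 0 then 0 else c (k - 1) x * (- 2 * x $ i))" for k x
    have "smooth (c' k)" for k
    proof -
      have "smooth (\<lambda>x. if k \<le> length is then pd i (c k) x else 0)"
        using c(1) by (cases "k \<le> length is") (auto intro: smooth_pd smooth_const)
      moreover have "smooth (\<lambda>x. if k = 0 then 0 else c (k - 1) x * (- 2 * x $ i))"
        using c(1) by (cases "k = 0") (auto intro!: smooth_const smooth_mult smooth_cmult smooth_nth smooth_minus)
      ultimately show ?thesis
        unfolding c'_def by (rule smooth_add)
    qed
    moreover have "partial_deriv (i # is) (\<lambda>x. K 0 (a - x \<bullet> x)) x = (\<Sum>k\<le>length (i # is). c' k x * K k (a - x \<bullet> x))"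
      if K: "\<forall>k t. (K k has_real_derivative K (Suc k) t) (at t)" for K a x
    proof -
      have t: "smooth (\<lambda>x. a - x \<bullet> x :: real)"
        using smooth_inner_self[of 0] by (intro smooth_diff smooth_const) simp
      have Kt: "smooth (\<lambda>x. K k (a - x \<bullet> x))" for k
        using smooth_compose[of "\<lambda>j. K (k + j)" "\<lambda>x. a - x \<bullet> x" 0] K t by simp
      have pdt: "pd i (\<lambda>x. a - x \<bullet> x) x = - 2 * x $ i"
      proof -
        have "((\<lambda>x. a - x \<bullet> x) has_derivative (\<lambda>h. 0 - (x \<bullet> h + h \<bullet> x))) (at x)"
          by (auto intro!: derivative_eq_intros)
        from pd_eqI[OF this, of i] show ?thesis
          by (simp add: inner_axis inner_axis')
      qed
      have "partial_deriv (i # is) (\<lambda>x. K 0 (a - x \<bullet> x)) x = partial_deriv [i] (\<lambda>x. \<Sum>k\<le>length is. c k x * K k (a - x \<bullet> x)) x"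
        using c(2)[OF K] by simp
      also have "\<dots> = (\<Sum>k\<le>length is. pd i (\<lambda>x. c k x * K k (a - x \<bullet> x)) x)"
        by (subst partial_deriv_sum) (auto intro: smooth_mult c Kt)
      also have "\<dots> = (\<Sum>k\<le>length is. pd i (c k) x * K k (a - x \<bullet> x) + c k x * (- 2 * x $ i) * K (Suc k) (a - x \<bullet> x))"
      proof (rule sum.cong[OF refl])
        fix k
        have "pd i (\<lambda>x. K k (a - x \<bullet> x)) x = K (Suc k) (a - x \<bullet> x) * pd i (\<lambda>x. a - x \<bullet> x) x"
          by (rule pd_compose) (use K t in \<open>auto intro: smooth_differentiable\<close>)
        then show "pd i (\<lambda>x. c k x * K k (a - x \<bullet> x)) x =
            pd i (c k) x * K k (a - x \<bullet> x) + c k x * (- 2 * x $ i) * K (Suc k) (a - x \<bullet> x)"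
          by (subst pd_mult) (auto simp: pdt intro: smooth_differentiable c Kt)
      qed
      also have "\<dots> = (\<Sum>k\<le>length is. pd i (c k) x * K k (a - x \<bullet> x)) +
          (\<Sum>k\<le>length is. c k x * (- 2 * x $ i) * K (Suc k) (a - x \<bullet> x))"
        by (rule sum.distrib)
      also have "(\<Sum>k\<le>length is. pd i (c k) x * K k (a - x \<bullet> x)) =
          (\<Sum>k\<le>Suc (length is). (if k \<le> length is then pd i (c k) x else 0) * K k (a - x \<bullet> x))"
        by simp
      also have "(\<Sum>k\<le>length is. c k x * (- 2 * x $ i) * K (Suc k) (a - x \<bullet> x)) =
          (\<Sum>k\<le>Suc (length is). (if k = 0 then 0 else c (k - 1) x * (- 2 * x $ i)) * K k (a - x \<bullet> x))"
        by (subst sum.atMost_Suc_shift) simp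
      finally show ?thesis
        by (simp only: c'_def distrib_right sum.distrib list.size add_0_right add_Suc_right One_nat_def)
    qed
    ultimately show ?case by blast
  qed
  then obtain c :: "nat \<Rightarrow> real^'n \<Rightarrow> real" where c: "\<And>k. smooth (c k)"
    "\<And>K a. (\<forall>k t. (K k has_real_derivative K (Suc k) t) (at t)) \<Longrightarrow>
      partial_deriv is (\<lambda>x. K 0 (a - x \<bullet> x)) = (\<lambda>x. \<Sum>k\<le>length is. c k x * K k (a - x \<bullet> x))"
    by blast
  show ?thesis
  proof (rule that)
    show "smooth (c k)" for k by (rule c(1))
    show "partial_deriv is (\<lambda>x. K 0 (a - x \<bullet> x)) x = (\<Sum>k\<le>length is. c k x * K k (a - x \<bullet> x))"
      if "\<And>k t. (K k has_real_derivative K (Suc k) t) (at t)" for K a x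
      using c(2)[of K a] that by simp
  qed
qed

section \<open>Uniform bounds and limits of the approximating profiles\<close>

lemma power_le_fact_exp:
  assumes "0 \<le> z"
  shows "z ^ j \<le> fact j * exp (z :: real)"
proof -
  have "(\<Sum>n\<in>{j}. z ^ n /\<^sub>R fact n) \<le> (\<Sum>n. z ^ n /\<^sub>R fact n)"
    using assms by (intro sum_le_suminf summable_exp_generic) auto
  then have "z ^ j / fact j \<le> exp z"
    by (simp add: exp_def divide_inverse mult.commute)
  then show ?thesis
    by (simp add: field_simps)
qed

text \<open>With z = e/s the left side is s^(m-k) z^j exp(-z), and z^j exp(-z) is at most j!. The
  bound is uniform in \<open>e\<close>, and \<open>k \<le> m\<close> keeps the power of
  \<open>s\<close> nonnegative.\<close>

lemma flat_bound:
  assumes e: "e > 0" and s: "s \<le> 1" and k: "k \<le> m"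
  shows "\<bar>e ^ j * flat (int m - int k - int j) e s\<bar> \<le> fact j"
proof (cases "s > 0")
  case True
  have "int m - int k - int j = int (m - k) - int j" using k by (simp add: of_nat_diff)
  moreover have "s powi (int (m - k) - int j) = s ^ (m - k) / s ^ j"
    using True by (subst power_int_diff) (auto simp del: of_nat_diff)
  ultimately have "s powi (int m - int k - int j) = s ^ (m - k) / s ^ j"
    by (simp only:)
  then have eq: "e ^ j * flat (int m - int k - int j) e s = s ^ (m - k) * ((e / s) ^ j * exp (- (e / s)))"
    using True by (simp add: flat_def power_divide)
  have nonneg: "0 \<le> s ^ (m - k) * ((e / s) ^ j * exp (- (e / s)))"
    using True e by (intro mult_nonneg_nonneg) auto
  have "s ^ (m - k) * ((e / s) ^ j * exp (- (e / s))) \<le> 1 * fact j"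
  proof (rule mult_mono)
    show "s ^ (m - k) \<le> 1" using True s by (intro power_le_one) auto
    show "(e / s) ^ j * exp (- (e / s)) \<le> fact j"
      using power_le_fact_exp[of "e / s" j] True e by (simp add: exp_minus field_simps)
  qed (use True e in auto)
  with nonneg show ?thesis
    unfolding eq by (simp only: abs_of_nonneg mult_1)
qed (simp add: flat_def)

text \<open>The coefficient free of \<open>e\<close>, hence the only one that survives e -> 0: the
  falling factorial from the \<open>k\<close>-th derivative of t^m.\<close>

lemma flat_coeff_diag: "flat_coeff (int m) k 0 = (\<Prod>i<k. real m - real i)"
  by (induction k) (auto simp: mult.commute)

text \<open>For \<open>k > m\<close> the product contains the factor m - m, so the truncated
  exponent \<open>m - k\<close> does no harm and the family continues through all orders.\<close>

lemma power_iterated_derivative: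
  "((\<lambda>t. (\<Prod>i<k. real m - real i) * t ^ (m - k)) has_real_derivative
    (\<Prod>i<Suc k. real m - real i) * t ^ (m - Suc k)) (at t)"
proof (cases "k \<le> m")
  case True
  have "((\<lambda>t. (\<Prod>i<k. real m - real i) * t ^ (m - k)) has_real_derivative
      (\<Prod>i<k. real m - real i) * (real (m - k) * t ^ (m - k - 1))) (at t)"
    by (auto intro!: derivative_eq_intros)
  then show ?thesis
    using True by (simp add: of_nat_diff mult.assoc)
next
  case False
  then have z: "(\<Prod>i<k. real m - real i) = 0" by (intro prod_zero) auto
  then have z': "(\<Prod>i<Suc k. real m - real i) = 0" by (simp only: prod.lessThan_Suc mult_zero_left)
  show ?thesis unfolding z z' by simp
qed

text \<open>The argument is shifted by \<open>e j\<close> as well, since the approximants must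
  vanish already before \<open>t\<close> reaches 0. All summands with a positive power of
  \<open>e j\<close> disappear in the limit.\<close>

lemma flat_deriv_tendsto:
  assumes t: "t > 0" and k: "k \<le> m" and e: "\<And>j::nat. e j > 0" "e \<longlonglongrightarrow> 0"
  shows "(\<lambda>j. flat_deriv (int m) (e j) k (t - e j)) \<longlonglongrightarrow> (\<Prod>i<k. real m - real i) * t ^ (m - k)"
proof -
  have lim: "(\<lambda>j. e j ^ l * flat q (e j) (t - e j)) \<longlonglongrightarrow> 0 ^ l * (t powi q)" for l q
  proof -
    have "(\<lambda>j. t - e j) \<longlonglongrightarrow> t - 0" by (intro tendsto_intros e)
    then have te: "(\<lambda>j. t - e j) \<longlonglongrightarrow> t" by simp
    have "(\<lambda>j. e j ^ l * ((t - e j) powi q * exp (- e j / (t - e j)))) \<longlonglongrightarrow> 0 ^ l * (t powi q * exp (- 0 / t))"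
      using t by (intro tendsto_intros e te) auto
    moreover have "\<forall>\<^sub>F j in sequentially. t - e j > 0"
      using order_tendstoD(1)[OF te t] .
    then have "\<forall>\<^sub>F j in sequentially. e j ^ l * ((t - e j) powi q * exp (- e j / (t - e j))) = e j ^ l * flat q (e j) (t - e j)"
      by eventually_elim (simp add: flat_def)
    ultimately show ?thesis
      using Lim_transform_eventually by fastforce
  qed
  have "(\<lambda>j. \<Sum>l\<le>k. flat_coeff (int m) k l * (e j ^ l * flat (int m - int k - int l) (e j) (t - e j))) \<longlonglongrightarrow>
      (\<Sum>l\<le>k. flat_coeff (int m) k l * (0 ^ l * (t powi (int m - int k - int l))))"
    by (intro tendsto_sum tendsto_mult_left lim)
  also have "(\<Sum>l\<le>k. flat_coeff (int m) k l * (0 ^ l * (t powi (int m - int k - int l)))) =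
      (\<Sum>l\<in>{0}. flat_coeff (int m) k l * (0 ^ l * (t powi (int m - int k - int l))))"
    by (rule sum.mono_neutral_right) auto
  also have "\<dots> = (\<Prod>i<k. real m - real i) * t ^ (m - k)"
  proof -
    have "int m - int k = int (m - k)" using k by (simp add: of_nat_diff)
    then have "t powi (int m - int k - int 0) = t ^ (m - k)"
      by (simp only: of_nat_0 diff_0_right power_int_of_nat)
    then show ?thesis by (simp only: flat_coeff_diag sum.insert sum.empty finite.emptyI empty_iff
        not_False_eq_True power_0 mult_1 add_0_right)
  qed
  finally show ?thesis
    by (simp add: flat_deriv_def mult.assoc)
qed

context bounded_domain
begin

lemma l2_tendsto_0_bounded:
  assumes f: "\<And>j::nat. f j \<in> borel_measurable \<mu>"
    and bnd: "\<And>j x. x \<in> \<Omega> \<Longrightarrow> \<bar>f j x\<bar> \<le> C"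
    and lim: "\<And>x. x \<in> \<Omega> \<Longrightarrow> (\<lambda>j. f j x) \<longlonglongrightarrow> 0"
  shows "(\<lambda>j. l2 \<mu> (f j)) \<longlonglongrightarrow> 0"
proof -
  have "(\<lambda>j. LINT x|\<mu>. (f j x)\<^sup>2) \<longlonglongrightarrow> (LINT x|\<mu>. 0)"
  proof (rule integral_dominated_convergence[where w="\<lambda>x. C\<^sup>2"])
    show "AE x in \<mu>. (\<lambda>j. (f j x)\<^sup>2) \<longlonglongrightarrow> 0"
    proof (rule AE_I2)
      fix x assume "x \<in> space \<mu>"
      then have "(\<lambda>j. (f j x)\<^sup>2) \<longlonglongrightarrow> 0\<^sup>2" by (intro tendsto_power lim) simp
      then show "(\<lambda>j. (f j x)\<^sup>2) \<longlonglongrightarrow> 0" by simp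
    qed
    show "AE x in \<mu>. norm ((f j x)\<^sup>2) \<le> C\<^sup>2" for j
    proof (rule AE_I2)
      fix x assume "x \<in> space \<mu>"
      then have "\<bar>f j x\<bar>\<^sup>2 \<le> C\<^sup>2" by (intro power_mono bnd) auto
      then show "norm ((f j x)\<^sup>2) \<le> C\<^sup>2" by simp
    qed
  qed (use f in auto)
  then have "(\<lambda>j. sqrt (LINT x|\<mu>. (f j x)\<^sup>2)) \<longlonglongrightarrow> sqrt 0"
    by (intro tendsto_real_sqrt) simp
  then show ?thesis by (simp add: l2_def)
qed

end

interpretation unit_ball: bounded_domain "ball 0 1 :: (real^'n) set"
  by unfold_locales auto

text \<open>The power t^m at t = 1 - |x|^2 is replaced by the flat profile at t - e. The shift gives
  compact support in the ball, the exponential factor smoothness, and the derivatives of order at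
  most \<open>m\<close> converge by dominated convergence.\<close>

lemma power_defining_function_H0:
  "(\<lambda>x :: real^'n. (1 - x \<bullet> x) ^ m) \<in> sobolev_space0 (ball 0 1) m"
proof -
  \<comment> \<open>Starting at 1/2 keeps every \<open>e j\<close> below 1, so the supporting radius
    \<open>sqrt (1 - e j)\<close> is real and positive.\<close>
  define e :: "nat \<Rightarrow> real" where "e j = 1 / real (Suc (Suc j))" for j
  have e: "e j > 0" "e j < 1" for j by (auto simp: e_def)
  have e0: "e \<longlonglongrightarrow> 0"
    unfolding e_def by (intro LIMSEQ_Suc lim_1_over_n)
  define \<psi> where "\<psi> x = (1 - x \<bullet> x) ^ m" for x :: "real^'n"
  define \<phi> where "\<phi> j x = flat (int m) (e j) ((1 - e j) - x \<bullet> x)" for j and x :: "real^'n"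
  define P where "P k t = (\<Prod>i<k. real m - real i) * t ^ (m - k)" for k and t :: real
  have P: "(P k has_real_derivative P (Suc k) t) (at t)" for k t
    unfolding P_def by (rule power_iterated_derivative)
  have sq: "smooth (\<lambda>x :: real^'n. a - x \<bullet> x)" for a
    using smooth_inner_self[of 0] by (intro smooth_diff smooth_const) simp
  have \<psi>_smooth: "smooth \<psi>"
    unfolding \<psi>_def by (intro smooth_power sq)
  have \<phi>_test: "\<phi> j \<in> test_functions (ball 0 1)" for j
  proof (rule test_functionsI[of _ "cball 0 (sqrt (1 - e j))"])
    show "smooth (\<phi> j)" unfolding \<phi>_def by (intro smooth_flat e sq)
    have "norm x < 1" if "norm x \<le> sqrt (1 - e j)" for x :: "real^'n"
      by (rule le_less_trans[OF that]) (use e[of j] in simp)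
    then show "cball 0 (sqrt (1 - e j)) \<subseteq> ball (0 :: real^'n) 1" by auto
    show "\<phi> j x = 0" if "x \<notin> cball 0 (sqrt (1 - e j))" for x
    proof -
      have "sqrt (1 - e j) < norm x" using that by simp
      then have "(sqrt (1 - e j))\<^sup>2 < (norm x)\<^sup>2" using e(2)[of j] by (intro power_strict_mono) auto
      then have "1 - e j < (norm x)\<^sup>2" using e(2)[of j] by simp
      then show ?thesis by (simp add: \<phi>_def flat_def dot_square_norm)
    qed
  qed simp
  have "\<psi> \<in> sobolev_space0 (ball 0 1) m"
  proof (rule unit_ball.smooth_H0_I[OF \<psi>_smooth \<phi>_test])
    fix "is" :: "'n list" assume len: "length is \<le> m"
    obtain c :: "nat \<Rightarrow> real^'n \<Rightarrow> real" where c: "\<And>k. smooth (c k)"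
      "\<And>K a x. (\<And>k t. (K k has_real_derivative K (Suc k) t) (at t)) \<Longrightarrow>
      partial_deriv is (\<lambda>x. K 0 (a - x \<bullet> x)) x = (\<Sum>k\<le>length is. c k x * K k (a - x \<bullet> x))"
      using partial_deriv_radial[of "is"] by blast
    define F where "F k j x = P k (1 - x \<bullet> x) - flat_deriv (int m) (e j) k ((1 - e j) - x \<bullet> x)" for k j and x :: "real^'n"
    have diff: "partial_deriv is \<psi> x - partial_deriv is (\<phi> j) x = (\<Sum>k\<le>length is. c k x * F k j x)" for j x
    proof -
      have "partial_deriv is \<psi> x = (\<Sum>k\<le>length is. c k x * P k (1 - x \<bullet> x))"
        using c(2)[of P 1 x, OF P] by (simp add: \<psi>_def[abs_def] P_def)
      moreover have "partial_deriv is (\<phi> j) x = (\<Sum>k\<le>length is. c k x * flat_deriv (int m) (e j) k ((1 - e j) - x \<bullet> x))"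
        using c(2)[of "flat_deriv (int m) (e j)" "1 - e j" x, OF flat_deriv_has_derivative[OF e(1)]]
        by (simp add: \<phi>_def[abs_def])
      ultimately show ?thesis
        by (simp add: F_def right_diff_distrib sum_subtractf)
    qed
    have sF: "smooth (F k j)" for k j
    proof -
      have "smooth (\<lambda>x :: real^'n. P k (1 - x \<bullet> x))"
        unfolding P_def by (intro smooth_cmult smooth_power sq)
      moreover have "smooth (\<lambda>x :: real^'n. flat_deriv (int m) (e j) k ((1 - e j) - x \<bullet> x))"
        unfolding flat_deriv_def by (intro smooth_sum smooth_cmult smooth_flat e sq)
      ultimately show ?thesis unfolding F_def by (rule smooth_diff)
    qed
    have xx: "0 < 1 - x \<bullet> x \<and> 1 - x \<bullet> x \<le> 1" if "x \<in> ball 0 1" for x :: "real^'n"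
      using that by (simp add: dot_square_norm power_less_one_iff)
    have "(\<lambda>j. l2 (lebesgue_on (ball 0 1)) (\<lambda>x. c k x * F k j x)) \<longlonglongrightarrow> 0" if k: "k \<le> length is" for k
    proof -
      obtain B where B: "B \<ge> 0" "\<And>x. x \<in> ball 0 1 \<Longrightarrow> \<bar>c k x\<bar> \<le> B"
        using unit_ball.smooth_bounded[OF c(1)[of k]] by blast
      define C where "C = \<bar>\<Prod>i<k. real m - real i\<bar> + (\<Sum>l\<le>k. \<bar>flat_coeff (int m) k l\<bar> * fact l)"
      have km: "k \<le> m" using k len by simp
      \<comment> \<open>A bound independent of \<open>j\<close>, the majorant for dominated
        convergence; it rests on \<open>k \<le> m\<close>.\<close>
      have bnd: "\<bar>F k j x\<bar> \<le> C" if x: "x \<in> ball 0 1" for j x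
      proof -
        have "\<bar>P k (1 - x \<bullet> x)\<bar> \<le> \<bar>\<Prod>i<k. real m - real i\<bar> * 1"
          unfolding P_def abs_mult using xx[OF x] by (intro mult_left_mono) (auto simp: power_abs power_le_one)
        moreover have "\<bar>flat_deriv (int m) (e j) k ((1 - e j) - x \<bullet> x)\<bar> \<le> (\<Sum>l\<le>k. \<bar>flat_coeff (int m) k l\<bar> * fact l)"
          unfolding flat_deriv_def
        proof (rule order_trans[OF sum_abs], rule sum_mono)
          fix l
          have "(1 - e j) - x \<bullet> x \<le> 1" using xx[OF x] e(1)[of j] by linarith
          from flat_bound[OF e(1)[of j] this km, of l]
          show "\<bar>flat_coeff (int m) k l * e j ^ l * flat (int m - int k - int l) (e j) ((1 - e j) - x \<bullet> x)\<bar>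
              \<le> \<bar>flat_coeff (int m) k l\<bar> * fact l"
            unfolding mult.assoc abs_mult[of "flat_coeff _ _ _"] by (intro mult_left_mono) auto
        qed
        ultimately show ?thesis unfolding F_def C_def by linarith
      qed
      show ?thesis
      proof (rule unit_ball.l2_tendsto_0_bounded[where C="B * C"])
        show "(\<lambda>x. c k x * F k j x) \<in> borel_measurable (lebesgue_on (ball 0 1))" for j
          by (intro unit_ball.smooth_measurable smooth_mult c sF)
        show "\<bar>c k x * F k j x\<bar> \<le> B * C" if "x \<in> ball 0 1" for j x
          unfolding abs_mult using B bnd that by (intro mult_mono) auto
        show "(\<lambda>j. c k x * F k j x) \<longlonglongrightarrow> 0" if x: "x \<in> ball 0 1" for x
        proof -
          have "(\<lambda>j. flat_deriv (int m) (e j) k ((1 - x \<bullet> x) - e j)) \<longlonglongrightarrow> P k (1 - x \<bullet> x)"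
            unfolding P_def by (rule flat_deriv_tendsto[OF _ km e(1) e0]) (use xx[OF x] in simp)
          then have "(\<lambda>j. P k (1 - x \<bullet> x) - flat_deriv (int m) (e j) k ((1 - x \<bullet> x) - e j)) \<longlonglongrightarrow> P k (1 - x \<bullet> x) - P k (1 - x \<bullet> x)"
            by (intro tendsto_diff tendsto_const)
          moreover have "F k j x = P k (1 - x \<bullet> x) - flat_deriv (int m) (e j) k ((1 - x \<bullet> x) - e j)" for j
            by (simp add: F_def algebra_simps)
          ultimately have "(\<lambda>j. F k j x) \<longlonglongrightarrow> 0" by simp
          from tendsto_mult_left[OF this, of "c k x"] show ?thesis by simp
        qed
      qed
    qed
    then have "(\<lambda>j. \<Sum>k\<le>length is. l2 (lebesgue_on (ball 0 1)) (\<lambda>x. c k x * F k j x)) \<longlonglongrightarrow> (\<Sum>k\<le>length is. 0)"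
      by (intro tendsto_sum) auto
    then have sum_lim: "(\<lambda>j. \<Sum>k\<le>length is. l2 (lebesgue_on (ball 0 1)) (\<lambda>x. c k x * F k j x)) \<longlonglongrightarrow> 0"
      by simp
    show "(\<lambda>j. l2 (lebesgue_on (ball 0 1)) (\<lambda>x. partial_deriv is \<psi> x - partial_deriv is (\<phi> j) x)) \<longlonglongrightarrow> 0"
    proof (rule tendsto_sandwich[OF _ _ tendsto_const sum_lim])
      show "\<forall>\<^sub>F j in sequentially. l2 (lebesgue_on (ball 0 1)) (\<lambda>x. partial_deriv is \<psi> x - partial_deriv is (\<phi> j) x)
          \<le> (\<Sum>k\<le>length is. l2 (lebesgue_on (ball 0 1)) (\<lambda>x. c k x * F k j x))"
        unfolding diff by (intro always_eventually allI l2_sum_le unit_ball.smooth_sqint smooth_mult c sF)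
    qed simp
  qed
  then show ?thesis by (simp add: \<psi>_def[abs_def])
qed

section \<open>A sign-changing supersolution\<close>

lemma lap_add: "smooth f \<Longrightarrow> smooth g \<Longrightarrow> lap (\<lambda>x. f x + g x) = (\<lambda>x. lap f x + lap g x)"
  by (simp only: lap_eq partial_deriv_add sum.distrib fun_eq_iff simp_thms)

lemma lap_cmult: "smooth f \<Longrightarrow> lap (\<lambda>x. a * f x) = (\<lambda>x. a * lap f x)"
  by (simp only: lap_eq partial_deriv_cmult sum_distrib_left fun_eq_iff simp_thms)

lemma lap_funpow_add:
  "smooth f \<Longrightarrow> smooth g \<Longrightarrow> (lap ^^ k) (\<lambda>x. f x + g x) = (\<lambda>x. (lap ^^ k) f x + (lap ^^ k) g x)"
  by (induction k) (simp_all add: lap_add smooth_lap_funpow)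

lemma lap_funpow_cmult: "smooth f \<Longrightarrow> (lap ^^ k) (\<lambda>x. a * f x) = (\<lambda>x. a * (lap ^^ k) f x)"
  by (induction k) (simp_all add: lap_cmult smooth_lap_funpow)

lemma lap_funpow_0: "(lap ^^ k) (\<lambda>x. 0) = (\<lambda>x. 0)"
  using lap_funpow_cmult[OF smooth_const[of 0], of k 0] by simp

lemma lap_funpow_sum:
  "finite I \<Longrightarrow> (\<And>i. i \<in> I \<Longrightarrow> smooth (f i)) \<Longrightarrow>
    (lap ^^ k) (\<lambda>x. \<Sum>i\<in>I. f i x) = (\<lambda>x. \<Sum>i\<in>I. (lap ^^ k) (f i) x)"
  by (induction I rule: finite_induct) (simp_all add: lap_funpow_0 lap_funpow_add smooth_sum)

text \<open>With q = |x - y|^2 one has |grad q|^2 = 4q and second derivatives 2 in each direction.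
  For \<open>j = 0\<close> the factor \<open>real j\<close> makes the truncated exponent
  harmless.\<close>

lemma lap_power_inner_self:
  fixes y :: "real^'n"
  shows "lap (\<lambda>x. ((x - y) \<bullet> (x - y)) ^ j) x =
    2 * real j * (2 * real j - 2 + real CARD('n)) * ((x - y) \<bullet> (x - y)) ^ (j - 1)"
proof -
  define q where "q x = (x - y) \<bullet> (x - y)" for x
  have q: "smooth q" unfolding q_def by (rule smooth_inner_self)
  have pdq: "pd i q x = 2 * (x $ i - y $ i)" for i x
    unfolding q_def by (rule pd_inner_self)
  have pd_pow: "pd i (\<lambda>x. q x ^ l) x = real l * q x ^ (l - 1) * (2 * (x $ i - y $ i))" for l i x
  proof -
    have "((\<lambda>s. s ^ l) has_real_derivative real l * q x ^ (l - 1)) (at (q x))"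
      by (auto intro!: derivative_eq_intros)
    from pd_compose[OF this smooth_differentiable[OF q]] show ?thesis by (simp add: pdq)
  qed
  have lin: "smooth (\<lambda>x. 2 * (x $ i - y $ i))" for i
    by (intro smooth_cmult smooth_diff smooth_nth smooth_const)
  have pd_lin: "pd i (\<lambda>x. 2 * (x $ i - y $ i)) x = 2" for i x
  proof -
    have "((\<lambda>x. 2 * (x $ i - y $ i)) has_derivative (\<lambda>h. 2 * (h $ i))) (at x)"
      by (auto intro!: derivative_eq_intros bounded_linear_imp_has_derivative bounded_linear_vec_nth)
    from pd_eqI[OF this, of i] show ?thesis by (simp add: axis_def)
  qed
  have second: "pd i (pd i (\<lambda>x. q x ^ j)) x =
    real j * (real (j - 1) * q x ^ (j - 1 - 1) * 4 * (x $ i - y $ i)\<^sup>2 + 2 * q x ^ (j - 1))" for i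
  proof -
    have "pd i (\<lambda>x. q x ^ j) = (\<lambda>x. (real j * q x ^ (j - 1)) * (2 * (x $ i - y $ i)))"
      by (rule ext) (rule pd_pow)
    then have "pd i (pd i (\<lambda>x. q x ^ j)) x = pd i (\<lambda>x. (real j * q x ^ (j - 1)) * (2 * (x $ i - y $ i))) x"
      by simp
    also have "\<dots> = (real j * q x ^ (j - 1)) * pd i (\<lambda>x. 2 * (x $ i - y $ i)) x +
        pd i (\<lambda>x. real j * q x ^ (j - 1)) x * (2 * (x $ i - y $ i))"
      by (rule pd_mult) (intro smooth_differentiable smooth_cmult smooth_power q lin)+
    also have "pd i (\<lambda>x. real j * q x ^ (j - 1)) x = real j * pd i (\<lambda>x. q x ^ (j - 1)) x"
      by (rule pd_cmult) (intro smooth_differentiable smooth_power q)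
    finally show ?thesis
      by (simp only: pd_lin pd_pow[of i "j - 1" x]) (simp add: algebra_simps power2_eq_square)
  qed
  have "(\<Sum>i\<in>UNIV. (x $ i - y $ i)\<^sup>2) = q x"
    by (simp add: q_def inner_vec_def power2_eq_square)
  then have "lap (\<lambda>x. q x ^ j) x = real j * (real (j - 1) * q x ^ (j - 1 - 1) * 4 * q x + 2 * q x ^ (j - 1) * real CARD('n))"
    unfolding lap_def second by (simp add: sum.distrib flip: sum_distrib_left)
  also have "\<dots> = 2 * real j * (2 * real j - 2 + real CARD('n)) * q x ^ (j - 1)"
  proof (cases "j \<le> 1")
    case True
    then have "j = 0 \<or> j = 1" by auto
    then show ?thesis by auto
  next
    case False
    then obtain l where "j = Suc (Suc l)" by (metis One_nat_def not_less_eq_eq Suc_le_D le_SucE nat_le_linear)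
    then show ?thesis by (simp add: algebra_simps)
  qed
  finally show ?thesis by (simp add: q_def)
qed

text \<open>The factor picked up by |x - y|^(2j) under \<open>k\<close> Laplacians. Real subtraction
  is used so that the factor with \<open>i = j\<close> vanishes when \<open>j < k\<close>.\<close>

definition lap_coeff :: "'n::finite itself \<Rightarrow> nat \<Rightarrow> nat \<Rightarrow> real" where
  "lap_coeff _ j k = (\<Prod>i<k. 2 * (real j - real i) * (2 * (real j - real i) - 2 + real CARD('n)))"

lemma lap_coeff_eq_0: "j < k \<Longrightarrow> lap_coeff TYPE('n::finite) j k = 0"
  unfolding lap_coeff_def by (rule prod_zero) auto

lemma lap_coeff_pos: "0 < lap_coeff TYPE('n::finite) m m"
proof -
  have "0 < 2 * (real m - real i) * (2 * (real m - real i) - 2 + real CARD('n))" if "i < m" for i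
  proof (rule mult_pos_pos)
    have "real i + 1 \<le> real m" using that by linarith
    moreover have "0 < real CARD('n)"
      using zero_less_card_finite by (simp only: of_nat_0_less_iff)
    ultimately have "0 < 2 * real m - 2 * real i - 2 + real CARD('n)"
      by linarith
    then show "0 < 2 * (real m - real i) - 2 + real CARD('n)"
      by (simp only: right_diff_distrib)
  qed (use that in simp)
  then show ?thesis
    unfolding lap_coeff_def by (intro prod_pos) auto
qed

lemma lap_funpow_power_inner_self:
  fixes y :: "real^'n"
  shows "(lap ^^ k) (\<lambda>x. ((x - y) \<bullet> (x - y)) ^ j) =
    (\<lambda>x. lap_coeff TYPE('n) j k * ((x - y) \<bullet> (x - y)) ^ (j - k))"
proof (induction k)
  case 0
  show ?case by (simp add: lap_coeff_def)
next
  case (Suc k)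
  let ?q = "\<lambda>x. (x - y) \<bullet> (x - y)"
  have "(lap ^^ Suc k) (\<lambda>x. ?q x ^ j) = lap (\<lambda>x. lap_coeff TYPE('n) j k * ?q x ^ (j - k))"
    by (simp add: Suc.IH)
  also have "\<dots> = (\<lambda>x. lap_coeff TYPE('n) j k * lap (\<lambda>x. ?q x ^ (j - k)) x)"
    by (intro lap_cmult smooth_power smooth_inner_self)
  also have "\<dots> = (\<lambda>x. lap_coeff TYPE('n) j (Suc k) * ?q x ^ (j - Suc k))"
  proof (cases "k \<le> j")
    case True
    then show ?thesis
      by (simp add: lap_power_inner_self lap_coeff_def of_nat_diff mult.assoc fun_eq_iff)
  next
    case False
    then show ?thesis by (simp add: lap_coeff_eq_0)
  qed
  finally show ?case .
qed

text \<open>Each Laplacian lowers the degree in |x - y|^2 by one, so all powers below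
  \<open>m\<close> are annihilated. Their coefficients are the freedom used to shape the
  well.\<close>

lemma lap_funpow_polynomial:
  fixes y :: "real^'n"
  shows "(lap ^^ m) (\<lambda>x. \<Sum>j\<le>m. a j * ((x - y) \<bullet> (x - y)) ^ j) x = a m * lap_coeff TYPE('n) m m"
proof -
  have s: "smooth (\<lambda>x. ((x - y) \<bullet> (x - y)) ^ j)" for j
    by (intro smooth_power smooth_inner_self)
  have "(lap ^^ m) (\<lambda>x. \<Sum>j\<le>m. a j * ((x - y) \<bullet> (x - y)) ^ j) x =
      (\<Sum>j\<le>m. a j * (lap_coeff TYPE('n) j m * ((x - y) \<bullet> (x - y)) ^ (j - m)))"
    by (subst lap_funpow_sum) (auto intro!: smooth_cmult s sum.cong
        simp: lap_funpow_cmult[OF s] lap_funpow_power_inner_self)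
  also have "\<dots> = (\<Sum>j\<in>{m}. a j * (lap_coeff TYPE('n) j m * ((x - y) \<bullet> (x - y)) ^ (j - m)))"
    by (rule sum.mono_neutral_right) (auto simp: lap_coeff_eq_0)
  finally show ?thesis by simp
qed

lemma lap_funpow_one_minus_power:
  "(lap ^^ m) (\<lambda>x :: real^'n. (1 - x \<bullet> x) ^ m) x = (-1) ^ m * lap_coeff TYPE('n) m m"
proof -
  have "(1 - x \<bullet> x) ^ m = (\<Sum>j\<le>m. (of_nat (m choose j) * (-1) ^ j) * ((x - 0) \<bullet> (x - 0)) ^ j)" for x :: "real^'n"
  proof -
    have "(- (x \<bullet> x)) ^ j = (-1) ^ j * (x \<bullet> x) ^ j" for j
      using power_mult_distrib[of "-1" "x \<bullet> x" j] by simp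
    then show ?thesis
      using binomial_ring[of "- (x \<bullet> x)" 1 m] by (simp add: mult.assoc)
  qed
  then show ?thesis
    by (simp only: lap_funpow_polynomial) simp
qed

text \<open>The quadratic term has degree 1 in |x - y|^2, which is below \<open>m\<close>, and is
  invisible to the operator. The sign (-1)^m of the top term matches the top coefficient of (1 -
  |x|^2)^m.\<close>

lemma lap_funpow_well:
  fixes y :: "real^'n"
  assumes "m > 1"
  shows "(lap ^^ m) (\<lambda>x. (x - y) \<bullet> (x - y) + (-1) ^ m * ((x - y) \<bullet> (x - y)) ^ m - c) x
    = (-1) ^ m * lap_coeff TYPE('n) m m"
proof -
  define a where "a j = (if j = m then (-1) ^ m else if j = 1 then 1 else if j = 0 then - c else 0)" for j
  have "(x - y) \<bullet> (x - y) + (-1) ^ m * ((x - y) \<bullet> (x - y)) ^ m - c = (\<Sum>j\<le>m. a j * ((x - y) \<bullet> (x - y)) ^ j)" for x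
  proof -
    have "(\<Sum>j\<le>m. a j * ((x - y) \<bullet> (x - y)) ^ j) = (\<Sum>j\<in>{0, 1, m}. a j * ((x - y) \<bullet> (x - y)) ^ j)"
      using assms by (intro sum.mono_neutral_right) (auto simp: a_def)
    then show ?thesis using assms by (simp add: a_def)
  qed
  then show ?thesis
    by (simp only: lap_funpow_polynomial) (simp add: a_def)
qed

text \<open>The cutoff g/(g + h): the sets where \<open>g\<close> and \<open>h\<close> are positive
  cover the space because r < 2r.\<close>

lemma plateau:
  fixes y :: "real^'n"
  assumes r: "r > 0"
  obtains \<zeta> :: "real^'n \<Rightarrow> real" where "smooth \<zeta>" "\<And>x. 0 \<le> \<zeta> x \<and> \<zeta> x \<le> 1"
    "\<And>x. norm (x - y) \<le> r \<Longrightarrow> \<zeta> x = 1" "\<And>x. 2 * r \<le> norm (x - y) \<Longrightarrow> \<zeta> x = 0"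
proof
  define g h where "g x = flat 0 1 (4 * r\<^sup>2 - (x - y) \<bullet> (x - y))" and "h x = flat 0 1 ((x - y) \<bullet> (x - y) - r\<^sup>2)"
    for x :: "real^'n"
  have gh: "0 \<le> g x" "0 \<le> h x" "0 < g x + h x" for x
  proof -
    have "(x - y) \<bullet> (x - y) < 4 * r\<^sup>2 \<or> r\<^sup>2 < (x - y) \<bullet> (x - y)"
      using r zero_less_power[OF r, of 2] by linarith
    then show "0 \<le> g x" "0 \<le> h x" "0 < g x + h x"
      by (auto simp: g_def h_def flat_def add_pos_nonneg add_nonneg_pos)
  qed
  have "smooth g" "smooth h"
    unfolding g_def h_def by (intro smooth_flat smooth_diff smooth_inner_self smooth_const; simp)+
  moreover have "g x + h x \<noteq> 0" for x using gh(3)[of x] by simp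
  ultimately show "smooth (\<lambda>x. g x * (1 / (g x + h x)))"
    by (intro smooth_mult smooth_inverse smooth_add)
  show "0 \<le> g x * (1 / (g x + h x)) \<and> g x * (1 / (g x + h x)) \<le> 1" for x
    using gh[of x] by (simp add: divide_le_eq)
  show "g x * (1 / (g x + h x)) = 1" if "norm (x - y) \<le> r" for x
  proof -
    have "(norm (x - y))\<^sup>2 \<le> r\<^sup>2" using that by (intro power_mono) auto
    then have "h x = 0" by (simp add: h_def flat_def dot_square_norm)
    then show ?thesis using gh(3)[of x] by simp
  qed
  show "g x * (1 / (g x + h x)) = 0" if "2 * r \<le> norm (x - y)" for x
  proof -
    have "(2 * r)\<^sup>2 \<le> (norm (x - y))\<^sup>2" using that r by (intro power_mono) auto
    then have "g x = 0" by (simp add: g_def flat_def dot_square_norm power_mult_distrib)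
    then show ?thesis by simp
  qed
qed

text \<open>\<open>u\<close> is \<open>(1 - \<bar>x\<bar>\<^sup>2)\<^sup>m\<close> except for a well at \<open>y\<close>, where it equals
  \<open>\<bar>x - y\<bar>\<^sup>2 + (-1)\<^sup>m \<bar>x - y\<bar>\<^sup>2\<^sup>m - r\<^sup>2 / 4\<close>. Both functions satisfy \<open>(-\<Delta>)\<^sup>m u = \<kappa>\<close>, and in the
  transition zone, where \<open>(-\<Delta>)\<^sup>m u\<close> may be negative, \<open>u\<close> is bounded below by \<open>\<delta>\<close>.\<close>

lemma well_function:
  fixes y :: "real^'n"
  assumes m: "m > 1" and r: "0 < r" "r \<le> 1 / 8" and y: "norm y \<le> 1 / 2"
  obtains u :: "real^'n \<Rightarrow> real" and \<delta> M where
    "smooth u" "u \<in> sobolev_space0 (ball 0 1) m" "u y < 0"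
    "\<And>x. norm (x - y) < r \<Longrightarrow> (-1) ^ m * (lap ^^ m) u x = lap_coeff TYPE('n) m m"
    "\<And>x. norm (x - y) < r \<Longrightarrow> - 1 \<le> u x"
    "\<And>x. 2 * r < norm (x - y) \<Longrightarrow> (-1) ^ m * (lap ^^ m) u x = lap_coeff TYPE('n) m m"
    "\<And>x. 2 * r < norm (x - y) \<Longrightarrow> x \<in> ball 0 1 \<Longrightarrow> 0 \<le> u x"
    "\<delta> > 0" "\<And>x. r \<le> norm (x - y) \<Longrightarrow> norm (x - y) \<le> 2 * r \<Longrightarrow> \<delta> \<le> u x"
    "M \<ge> 0" "\<And>x. r \<le> norm (x - y) \<Longrightarrow> norm (x - y) \<le> 2 * r \<Longrightarrow> - M \<le> (-1) ^ m * (lap ^^ m) u x"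
proof -
  obtain \<zeta> :: "real^'n \<Rightarrow> real" where \<zeta>: "smooth \<zeta>" "\<And>x. 0 \<le> \<zeta> x \<and> \<zeta> x \<le> 1"
    "\<And>x. norm (x - y) \<le> r \<Longrightarrow> \<zeta> x = 1" "\<And>x. 2 * r \<le> norm (x - y) \<Longrightarrow> \<zeta> x = 0"
    using plateau[OF r(1), of y] by metis
  define \<psi> where "\<psi> x = (1 - x \<bullet> x) ^ m" for x :: "real^'n"
  define P where "P x = (x - y) \<bullet> (x - y) + (-1) ^ m * ((x - y) \<bullet> (x - y)) ^ m - r\<^sup>2 / 4" for x
  \<comment> \<open>A convex combination of \<open>\<psi>\<close> and \<open>P\<close> with weight
    \<open>\<zeta>\<close>, so it is positive where both are. The correction to
    \<open>\<psi>\<close> has compact support in the ball, so \<open>u\<close> stays in the space of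
    functions vanishing at the boundary.\<close>
  define u where "u x = \<psi> x + \<zeta> x * (P x - \<psi> x)" for x
  have s\<psi>: "smooth \<psi>"
    unfolding \<psi>_def using smooth_inner_self[of 0] by (intro smooth_power smooth_diff smooth_const) simp
  have sP: "smooth P"
    unfolding P_def by (intro smooth_diff smooth_add smooth_cmult smooth_power smooth_inner_self smooth_const)
  have su: "smooth u"
    unfolding u_def by (intro smooth_add smooth_mult smooth_diff s\<psi> sP \<zeta>)
  have sub: "cball y (2 * r) \<subseteq> ball 0 1"
  proof
    fix x assume "x \<in> cball y (2 * r)"
    then have "norm (x - y) \<le> 2 * r" by (simp add: dist_norm norm_minus_commute)
    moreover have "norm x \<le> norm (x - y) + norm y" by (metis diff_add_cancel norm_triangle_ineq)
    ultimately show "x \<in> ball 0 1" using r y by simp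
  qed
  have bump: "(\<lambda>x. \<zeta> x * (P x - \<psi> x)) \<in> test_functions (ball 0 1)"
  proof (rule test_functionsI[OF _ _ sub])
    show "\<zeta> x * (P x - \<psi> x) = 0" if "x \<notin> cball y (2 * r)" for x
      using \<zeta>(4)[of x] that by (simp add: dist_norm norm_minus_commute)
  qed (auto intro!: smooth_mult smooth_diff s\<psi> sP \<zeta>)
  have "\<psi> \<in> sobolev_space0 (ball 0 1) m"
    unfolding \<psi>_def by (rule power_defining_function_H0)
  then have uH: "u \<in> sobolev_space0 (ball 0 1) m"
    unfolding u_def by (rule unit_ball.H0_add[OF _ unit_ball.test_H0[OF bump]])
  have inner: "u x = P x" if "norm (x - y) < r" for x
    using \<zeta>(3)[of x] that by (simp add: u_def)
  have outer: "u x = \<psi> x" if "2 * r < norm (x - y)" for x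
    using \<zeta>(4)[of x] that by (simp add: u_def)
  have \<psi>_pos: "0 < \<psi> x" if "x \<in> ball 0 1" for x
    using that by (simp add: \<psi>_def dot_square_norm power_less_one_iff)
  have lap_in: "(-1) ^ m * (lap ^^ m) u x = lap_coeff TYPE('n) m m" if "norm (x - y) < r" for x
  proof -
    have "(lap ^^ m) u x = (lap ^^ m) P x"
      by (rule lap_funpow_cong_open[of "ball y r"]) (use that inner in \<open>auto simp: dist_norm norm_minus_commute\<close>)
    then show ?thesis
      unfolding P_def using lap_funpow_well[OF m, of y "r\<^sup>2 / 4" x] by (simp flip: power_mult_distrib mult.assoc)
  qed
  have lap_out: "(-1) ^ m * (lap ^^ m) u x = lap_coeff TYPE('n) m m" if "2 * r < norm (x - y)" for x
  proof -
    have "(lap ^^ m) u x = (lap ^^ m) \<psi> x"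
      by (rule lap_funpow_cong_open[of "- cball y (2 * r)"]) (use that outer in \<open>auto simp: dist_norm norm_minus_commute\<close>)
    then show ?thesis
      unfolding \<psi>_def using lap_funpow_one_minus_power[of m x] by (simp flip: power_mult_distrib mult.assoc)
  qed
  have r2: "r\<^sup>2 \<le> 1 / 64"
    using power_mono[OF r(2), of 2] r(1) by (simp add: power2_eq_square)
  \<comment> \<open>On this ball q = |x - y|^2 is at most 1/4, so q^m is at most q/4 because m is at
    least 2. Whatever the sign of (-1)^m, \<open>P\<close> is at least 3q/4 - r^2/4, which is
    positive once q is at least r^2.\<close>
  have P_lower: "- 1 \<le> P x \<and> (r \<le> norm (x - y) \<longrightarrow> 0 < P x)" if "norm (x - y) \<le> 2 * r" for x
  proof -
    define q where "q = (x - y) \<bullet> (x - y)"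
    have q: "q = (norm (x - y))\<^sup>2" by (simp add: q_def dot_square_norm)
    have "q \<le> (2 * r)\<^sup>2" unfolding q using that by (intro power_mono) auto
    then have q4: "q \<le> 1 / 4" using r2 by (simp add: power_mult_distrib)
    have q0: "0 \<le> q" by (simp add: q_def)
    have "q ^ m \<le> q ^ 2"
      using m q0 q4 by (intro power_decreasing) auto
    also have "q ^ 2 \<le> q * (1 / 4)"
      unfolding power2_eq_square using q0 q4 by (intro mult_left_mono) auto
    finally have qm: "q ^ m \<le> q / 4" by simp
    have "\<bar>(-1) ^ m * q ^ m\<bar> = q ^ m" using q0 by (simp add: abs_mult power_abs)
    then have "- (q ^ m) \<le> (-1) ^ m * q ^ m" by linarith
    then have low: "3 * q / 4 - r\<^sup>2 / 4 \<le> P x"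
      using qm unfolding P_def q_def[symmetric] by (simp add: field_simps)
    moreover have "0 < 3 * q / 4 - r\<^sup>2 / 4" if "r \<le> norm (x - y)"
    proof -
      have "r\<^sup>2 \<le> q" unfolding q using that r(1) by (intro power_mono) auto
      moreover have "0 < r\<^sup>2" using r(1) by simp
      ultimately have "r\<^sup>2 < 3 * q" by linarith
      then show ?thesis by simp
    qed
    ultimately show ?thesis using q0 r2 by auto
  qed
  define K where "K = cball y (2 * r) - ball y r"
  have K_iff: "x \<in> K \<longleftrightarrow> r \<le> norm (x - y) \<and> norm (x - y) \<le> 2 * r" for x
    by (auto simp: K_def dist_norm norm_minus_commute not_less)
  have K: "compact K" unfolding K_def by (intro compact_diff) auto
  have u_pos: "0 < u x" if "x \<in> K" for x
  proof -
    have "0 < P x" using P_lower[of x] that by (simp add: K_iff)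
    moreover have "0 < \<psi> x" using sub that by (intro \<psi>_pos) (auto simp: K_def)
    ultimately have "0 < (1 - \<zeta> x) * \<psi> x + \<zeta> x * P x"
      using \<zeta>(2)[of x] by (cases "\<zeta> x = 0") (auto intro!: add_nonneg_pos mult_pos_pos mult_nonneg_nonneg)
    then show ?thesis by (simp add: u_def algebra_simps)
  qed
  have "\<exists>\<delta>>0. \<forall>x\<in>K. \<delta> \<le> u x"
  proof (cases "K = {}")
    case True
    then show ?thesis by (intro exI[of _ 1]) auto
  next
    case False
    then obtain z where "z \<in> K" "\<And>x. x \<in> K \<Longrightarrow> u z \<le> u x"
      using continuous_attains_inf[OF K False smooth_continuous_on[OF su]] by blast
    then show ?thesis using u_pos by blast
  qed
  then obtain \<delta> where \<delta>: "\<delta> > 0" "\<And>x. x \<in> K \<Longrightarrow> \<delta> \<le> u x" by blast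
  obtain M where M: "M \<ge> 0" "\<And>x. x \<in> ball 0 1 \<Longrightarrow> \<bar>(-1) ^ m * (lap ^^ m) u x\<bar> \<le> M"
    using unit_ball.smooth_bounded[OF smooth_cmult[OF smooth_lap_funpow[OF su]]] by blast
  show ?thesis
  proof (rule that[of u \<delta> M])
    show "u y < 0"
      using inner[of y] r m by (simp add: P_def zero_power)
    show "- 1 \<le> u x" if "norm (x - y) < r" for x
      using inner[OF that] P_lower[of x] that r by simp
    show "0 \<le> u x" if "2 * r < norm (x - y)" "x \<in> ball 0 1" for x
      using outer[OF that(1)] \<psi>_pos[OF that(2)] by simp
    show "\<delta> \<le> u x" if "r \<le> norm (x - y)" "norm (x - y) \<le> 2 * r" for x
      using \<delta>(2) that by (simp add: K_iff)
    show "- M \<le> (-1) ^ m * (lap ^^ m) u x" if "r \<le> norm (x - y)" "norm (x - y) \<le> 2 * r" for x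
    proof -
      have "x \<in> cball y (2 * r)" using that by (simp add: dist_norm norm_minus_commute)
      then have "x \<in> ball 0 1" using sub by blast
      from M(2)[OF this] show ?thesis by linarith
    qed
  qed (use su uH lap_in lap_out \<delta> M in auto)
qed

lemma indicator_ball_Lp:
  fixes S :: "(real^'n) set"
  assumes p: "p > 0" and c: "c \<ge> 0"
  shows "(\<lambda>x. c * indicator (ball 0 1) x) \<in> Lp_space p (UNIV :: (real^'n) set)"
    and "Lp_norm p (UNIV :: (real^'n) set) (\<lambda>x. c * indicator (ball 0 1) x)
      = c * measure lebesgue (ball (0 :: real^'n) 1) powr (1 / p)"
proof -
  let ?f = "\<lambda>x :: real^'n. c * indicator (ball 0 1) x"
  have eq: "\<bar>?f x\<bar> powr p = c powr p * indicator (ball 0 1) x" for x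
    using c p by (simp add: indicator_def)
  have ball: "ball (0 :: real^'n) 1 \<in> sets lebesgue" by simp
  have int: "integrable lebesgue (indicator (ball (0 :: real^'n) 1) :: _ \<Rightarrow> real)"
    using lmeasurable_ball[of "0 :: real^'n" 1] by (intro integrable_real_indicator) (auto simp: fmeasurable_def)
  have "integrable lebesgue (\<lambda>x. \<bar>?f x\<bar> powr p)"
    unfolding eq using int by simp
  then show "?f \<in> Lp_space p UNIV"
    unfolding Lp_space_def lebesgue_on_UNIV_eq
    by (intro CollectI conjI borel_measurable_times borel_measurable_const borel_measurable_indicator ball)
  have "(LINT x|lebesgue. \<bar>?f x\<bar> powr p) = c powr p * measure lebesgue (ball (0 :: real^'n) 1)"
    unfolding eq using ball by simp
  then have "Lp_norm p UNIV ?f = (c powr p * measure lebesgue (ball (0 :: real^'n) 1)) powr (1 / p)"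
    by (simp only: Lp_norm_def lebesgue_on_UNIV_eq)
  then show "Lp_norm p UNIV ?f = c * measure lebesgue (ball (0 :: real^'n) 1) powr (1 / p)"
    using c p by (simp add: powr_mult powr_powr)
qed

lemma bounded_Lp_ball:
  assumes f: "f \<in> borel_measurable borel" "\<And>x. \<bar>f x\<bar> \<le> C" and p: "p > 0"
  shows "f \<in> Lp_space p (ball 0 1 :: (real^'n) set)"
proof -
  have meas: "f \<in> borel_measurable (lebesgue_on (ball 0 1))"
    by (rule unit_ball.borel_measurable_domain[OF f(1)])
  have "integrable (lebesgue_on (ball 0 1)) (\<lambda>x. \<bar>f x\<bar> powr p)"
  proof (rule unit_ball.integrable_const_bound[where B="C powr p"])
    show "AE x in lebesgue_on (ball 0 1). norm (\<bar>f x\<bar> powr p) \<le> C powr p"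
      using f(2) p by (intro AE_I2) (auto intro!: powr_mono2)
  qed (use meas in auto)
  with meas show ?thesis by (simp add: Lp_space_def)
qed

theorem proposition5:
  fixes m :: nat and x\<^sub>0 :: "real^'n"
  assumes "m > 1" and "CARD('n) > 2 * m"
    and "x\<^sub>0 \<in> ball 0 1"
  shows "\<exists>(\<alpha>bar :: real^'n \<Rightarrow> real) (\<alpha> :: real^'n \<Rightarrow> real).
    \<alpha>bar \<in> Lp_space (real CARD('n) / (2 * real m)) (ball 0 1) \<and>
    (\<forall>x\<in>ball 0 1. 0 \<le> \<alpha>bar x) \<and>
    \<alpha> \<in> Lp_space (real CARD('n) / (2 * real m)) UNIV \<and>
    (\<forall>x. 0 \<le> \<alpha> x) \<and>
    \<not> (AE x in lebesgue. \<alpha> x = 0) \<and>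
    Lp_norm (real CARD('n) / (2 * real m)) UNIV \<alpha>
      < sobolev_constant TYPE('n) m * (2 powr (2 * real m / real CARD('n)) - 1) \<and>
    (\<forall>l::real. l > 0 \<longrightarrow>
      sobolev_isomorphism (ball 0 1) m
        (polyharmonic_op (ball 0 1) m (\<lambda>x. \<alpha>bar x + l ^ (2 * m) * \<alpha> (l *\<^sub>R (x - x\<^sub>0)))) \<and>
      \<not> inverse_positivity_preserving (ball 0 1) m
        (polyharmonic_op (ball 0 1) m (\<lambda>x. \<alpha>bar x + l ^ (2 * m) * \<alpha> (l *\<^sub>R (x - x\<^sub>0)))))"
proof -
  have m: "m > 1" by fact
  define p where "p = real CARD('n) / (2 * real m)"
  have p: "p > 0" using assms by (simp add: p_def)
  \<comment> \<open>The well sits at any point other than \<open>x\<^sub>0\<close> in the ball of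
    radius 1/2.\<close>
  define y :: "real^'n" where "y = (if x\<^sub>0 = 0 then (1 / 2) *\<^sub>R axis undefined 1 else 0)"
  have y: "norm y \<le> 1 / 2" by (simp add: y_def)
  have "y \<noteq> x\<^sub>0" by (auto simp: y_def axis_eq_0_iff)
  then have dpos: "norm (x\<^sub>0 - y) > 0" by simp
  \<comment> \<open>By the second bound, a point within \<open>r\<close> of \<open>y\<close> is
    farther than \<open>r\<close> from \<open>x\<^sub>0\<close>; the first keeps the well and its
    transition shell inside the unit ball.\<close>
  define r where "r = min (1 / 8) (norm (x\<^sub>0 - y) / 2)"
  have r: "0 < r" "r \<le> 1 / 8" "2 * r \<le> norm (x\<^sub>0 - y)"
    using dpos by (auto simp: r_def)
  let ?\<kappa> = "lap_coeff TYPE('n) m m"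
  obtain u :: "real^'n \<Rightarrow> real" and \<delta> M where u: "smooth u" "u \<in> sobolev_space0 (ball 0 1) m" "u y < 0"
    and u_in: "\<And>x. norm (x - y) < r \<Longrightarrow> (-1) ^ m * (lap ^^ m) u x = ?\<kappa>"
      "\<And>x. norm (x - y) < r \<Longrightarrow> - 1 \<le> u x"
    and u_out: "\<And>x. 2 * r < norm (x - y) \<Longrightarrow> (-1) ^ m * (lap ^^ m) u x = ?\<kappa>"
      "\<And>x. 2 * r < norm (x - y) \<Longrightarrow> x \<in> ball 0 1 \<Longrightarrow> 0 \<le> u x"
    and u_mid: "\<delta> > 0" "\<And>x. r \<le> norm (x - y) \<Longrightarrow> norm (x - y) \<le> 2 * r \<Longrightarrow> \<delta> \<le> u x"
      "M \<ge> 0" "\<And>x. r \<le> norm (x - y) \<Longrightarrow> norm (x - y) \<le> 2 * r \<Longrightarrow> - M \<le> (-1) ^ m * (lap ^^ m) u x"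
    by (rule well_function[OF m r(1,2) y]) blast
  have \<kappa>: "?\<kappa> > 0" by (rule lap_coeff_pos)
  define T where "T = sobolev_constant TYPE('n) m * (2 powr (2 * real m / real CARD('n)) - 1)"
  have "1 < (2::real) powr (2 * real m / real CARD('n))"
    using assms by (intro gr_one_powr) auto
  then have T: "T > 0"
    unfolding T_def using assms by (intro mult_pos_pos sobolev_constant_pos) auto
  define V where "V = measure lebesgue (ball (0 :: real^'n) 1) powr (1 / p)"
  have V: "V \<ge> 0" by (simp add: V_def)
  \<comment> \<open>The first bound controls the rescaled potential on the well at every scale, the
    second its norm, which equals \<open>\<epsilon> * V\<close>; the summand 1 makes that inequality
    strict and the division safe.\<close>
  define \<epsilon> where "\<epsilon> = min (?\<kappa> * r ^ (2 * m)) (T / (V + 1))"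
  have \<epsilon>: "\<epsilon> > 0" "\<epsilon> \<le> ?\<kappa> * r ^ (2 * m)"
    using \<kappa> r(1) T V by (auto simp: \<epsilon>_def)
  have "\<epsilon> * V < T"
  proof -
    have "\<epsilon> * V < \<epsilon> * (V + 1)" using \<epsilon>(1) by simp
    also have "\<dots> \<le> T / (V + 1) * (V + 1)" using V by (intro mult_right_mono) (auto simp: \<epsilon>_def)
    also have "\<dots> = T" using V by simp
    finally show ?thesis .
  qed
  define S where "S = cball y (2 * r) - ball y r"
  have S_iff: "x \<in> S \<longleftrightarrow> r \<le> norm (x - y) \<and> norm (x - y) \<le> 2 * r" for x
    by (auto simp: S_def dist_norm norm_minus_commute not_less)
  \<comment> \<open>On the shell \<open>u\<close> is at least \<open>\<delta>\<close> and
    (-\<Delta>)^m u at least \<open>- M\<close>, so the height \<open>M / \<delta>\<close>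
    compensates exactly.\<close>
  define \<alpha>bar where "\<alpha>bar x = M / \<delta> * indicator S x" for x
  define \<alpha> where "\<alpha> x = \<epsilon> * indicator (ball 0 1) x" for x :: "real^'n"
  have S_meas: "S \<in> sets borel" by (simp add: S_def)
  have bar_meas: "\<alpha>bar \<in> borel_measurable borel"
    unfolding \<alpha>bar_def by (intro borel_measurable_times borel_measurable_const borel_measurable_indicator S_meas)
  have bar: "0 \<le> \<alpha>bar x" "\<alpha>bar x \<le> M / \<delta>" for x
    using u_mid(1,3) by (auto simp: \<alpha>bar_def indicator_def)
  have \<alpha>01: "0 \<le> \<alpha> x" "\<alpha> x \<le> \<epsilon>" for x
    using \<epsilon>(1) by (auto simp: \<alpha>_def indicator_def)
  have not_AE: "\<not> (AE x in lebesgue. \<alpha> x = 0)"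
  proof
    assume "AE x in lebesgue. \<alpha> x = 0"
    then have "AE x in lebesgue. x \<notin> ball (0 :: real^'n) 1"
      by eventually_elim (use \<epsilon>(1) in \<open>auto simp: \<alpha>_def\<close>)
    then have "negligible (ball (0 :: real^'n) 1)"
      by (simp add: negligible_iff_null_sets AE_iff_null_sets)
    moreover have "ball (0 :: real^'n) 1 \<noteq> {}" by simp
    ultimately show False
      using open_not_negligible[OF open_ball] by blast
  qed
  have main: "sobolev_isomorphism (ball 0 1) m (polyharmonic_op (ball 0 1) m (\<lambda>x. \<alpha>bar x + l ^ (2 * m) * \<alpha> (l *\<^sub>R (x - x\<^sub>0)))) \<and>
      \<not> inverse_positivity_preserving (ball 0 1) m (polyharmonic_op (ball 0 1) m (\<lambda>x. \<alpha>bar x + l ^ (2 * m) * \<alpha> (l *\<^sub>R (x - x\<^sub>0))))"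
    if l: "l > 0" for l :: real
  proof -
    define A where "A x = \<alpha>bar x + l ^ (2 * m) * \<alpha> (l *\<^sub>R (x - x\<^sub>0))" for x
    have "\<alpha> \<in> borel_measurable borel"
      unfolding \<alpha>_def by (intro borel_measurable_times borel_measurable_const borel_measurable_indicator) simp
    then have "(\<lambda>x. \<alpha> (l *\<^sub>R (x - x\<^sub>0))) \<in> borel_measurable borel"
      by (rule measurable_compose[rotated]) measurable
    then have A_meas: "A \<in> borel_measurable (lebesgue_on (ball 0 1))"
      unfolding A_def using bar_meas
      by (intro unit_ball.borel_measurable_domain borel_measurable_add borel_measurable_times) auto
    have A_nonneg: "0 \<le> A x" for x
      unfolding A_def using bar \<alpha>01 l by (intro add_nonneg_nonneg mult_nonneg_nonneg) auto
    \<comment> \<open>This bound grows with \<open>l\<close>, which is harmless: boundedness is used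
      for one fixed scale at a time, while the sign estimate below is uniform in
      \<open>l\<close>.\<close>
    have A_le: "A x \<le> M / \<delta> + l ^ (2 * m) * \<epsilon>" for x
      unfolding A_def using bar \<alpha>01 l by (intro add_mono mult_left_mono) auto
    have nonneg: "0 \<le> (-1) ^ m * (lap ^^ m) u x + A x * u x" if x: "x \<in> ball 0 1" for x
    proof -
      consider "norm (x - y) < r" | "x \<in> S" | "2 * r < norm (x - y)"
        unfolding S_iff by linarith
      then show ?thesis
      proof cases
        \<comment> \<open>On the well \<open>u\<close> is at least -1, so \<open>A x * u x\<close>
          is at least \<open>- A x\<close>; everything reduces to bounding \<open>A x\<close> by
          \<kappa>.\<close>
        case 1
        have "A x \<le> ?\<kappa>"
        proof (cases "norm (l *\<^sub>R (x - x\<^sub>0)) < 1")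
          case True
          have "norm (x\<^sub>0 - y) \<le> norm (x - x\<^sub>0) + norm (x - y)"
            using norm_triangle_ineq4[of "x - y" "x - x\<^sub>0"] by (simp add: algebra_simps)
          then have "r < norm (x - x\<^sub>0)" using r(3) 1 by linarith
          \<comment> \<open>If the rescaled potential reaches this point of the well, then l |x -
            x_0| < 1 and hence l r < 1, which cancels the growth of l^(2m) against the factor r^(2m)
            in \<open>\<epsilon>\<close>.\<close>
          then have "l * r \<le> l * norm (x - x\<^sub>0)"
            using l by (intro mult_left_mono) auto
          then have "l * r < 1"
            by (rule le_less_trans) (use True l in simp)
          then have "(l * r) ^ (2 * m) \<le> 1"
            using l r(1) by (intro power_le_one) auto
          have "A x = l ^ (2 * m) * \<epsilon>"
            using True 1 by (simp add: A_def \<alpha>bar_def \<alpha>_def S_iff)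
          also have "\<dots> \<le> l ^ (2 * m) * (?\<kappa> * r ^ (2 * m))"
            using \<epsilon>(2) l by (intro mult_left_mono) auto
          also have "\<dots> = ?\<kappa> * (l * r) ^ (2 * m)"
            by (simp add: power_mult_distrib mult_ac)
          also have "\<dots> \<le> ?\<kappa> * 1"
            using \<kappa> \<open>(l * r) ^ (2 * m) \<le> 1\<close> by (intro mult_left_mono) auto
          finally show ?thesis by simp
        next
          case False
          then show ?thesis using 1 \<kappa> by (simp add: A_def \<alpha>bar_def \<alpha>_def S_iff)
        qed
        moreover have "A x * (- 1) \<le> A x * u x"
          using u_in(2)[OF 1] A_nonneg by (intro mult_left_mono)
        ultimately show ?thesis using u_in(1)[OF 1] by linarith
      next
        case 2
        then have x2: "r \<le> norm (x - y)" "norm (x - y) \<le> 2 * r" by (auto simp: S_iff)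
        have "M / \<delta> \<le> A x"
          using 2 \<alpha>01 l by (simp add: A_def \<alpha>bar_def)
        then have "M / \<delta> * \<delta> \<le> A x * u x"
          using u_mid(1,3) u_mid(2)[OF x2] A_nonneg by (intro mult_mono) auto
        then have "M \<le> A x * u x" using u_mid(1) by simp
        then show ?thesis using u_mid(4)[OF x2] by linarith
      next
        case 3
        then show ?thesis
          using u_out(1)[OF 3] u_out(2)[OF 3 x] A_nonneg[of x] \<kappa> by simp
      qed
    qed
    have "y \<in> ball 0 1" using y by simp
    show ?thesis
      unfolding A_def[symmetric]
      using unit_ball.polyharmonic_op_isomorphism[OF A_meas A_nonneg A_le]
        unit_ball.not_inverse_positivity_preserving[OF u(1,2) A_meas A_nonneg A_le nonneg \<open>y \<in> ball 0 1\<close> u(3)]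
      by blast
  qed
  show ?thesis
    unfolding p_def[symmetric] T_def[symmetric]
  proof (rule exI[of _ \<alpha>bar], rule exI[of _ \<alpha>], intro conjI ballI allI impI)
    show "\<alpha>bar \<in> Lp_space p (ball 0 1)"
      using bar by (intro bounded_Lp_ball[OF bar_meas _ p, of "M / \<delta>"]) (simp add: abs_of_nonneg)
    show "\<alpha> \<in> Lp_space p UNIV"
      unfolding \<alpha>_def by (rule indicator_ball_Lp(1)[OF p]) (use \<epsilon>(1) in simp)
    show "Lp_norm p UNIV \<alpha> < T"
      unfolding \<alpha>_def using \<epsilon>(1) \<open>\<epsilon> * V < T\<close> by (subst indicator_ball_Lp(2)[OF p]) (simp_all add: V_def)
  qed (use bar \<alpha>01 not_AE main in auto)
qed

end
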